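(* Suppose that the following five conditions hold. (A1) For $n$ large enough and for some $m\ge 2$, $K(p_0^{(n)},p_{0j_n}^{(n)})\le n\epsilon_n^2$ and $V_{m,0}(p_0^{(n)},p_{0j_n}^{(n)})\le (n\epsilon_n^2)^{m/2}$. (A2) With the same $m$, there exists $H_1>0$ such that $\mathcal{A}_n(H_1)\subset\widetilde{\mathcal{B}}_n(m)$. (A3) There exist three non-negative constants $D_0,D_1,D_2$ such that, for any two $\boldsymbol\theta,\boldsymbol\theta'\in\Theta_{k_n}(Q)$, $d_n(\boldsymbol\theta,\boldsymbol\theta')\le D_0k_n^{D_1}\|\boldsymbol\theta-\boldsymbol\theta'\|_{2,k_n}^{D_2}$. (A4) There exist two positive constants $c_1$ and $\zeta<1$ such that, for every $\boldsymbol\theta_1\in\Theta_{k_n}(Q)$, there exists a test $\phi_n(\boldsymbol\theta_1)\in[0,1]$ which satisfies $$\mathbb{E}_0^{(n)}(\phi_n(\boldsymbol\theta_1))\le e^{-c_1nd_n^2(\boldsymbol\theta_0,\boldsymbol\theta_1)}\quad\text{and}\quad \sup_{d_n(\boldsymbol\theta,\boldsymbol\theta_1)<\zeta d_n(\boldsymbol\theta_0,\boldsymbol\theta_1)}\mathbb{E}_{\boldsymbol\theta}^{(n)}(1-\phi_n(\boldsymbol\theta_1))\le e^{-c_1nd_n^2(\boldsymbol\theta_0,\boldsymbol\theta_1)}.$$ (A5) There exist positive constants $a,b,G_1,G_2,G_3,G_4,H_2,\alpha,\tau_0$ and a constant $C$ such that $e^{-akL(k)}\le\pi(k)\le e^{-bkL(k)}$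 for all $k=1,2,\ldots$; $G_1e^{-G_2|\theta|^\alpha}\le g(\theta)\le G_3e^{-G_4|\theta|^\alpha}$ for all $\theta\in\mathbb{R}$; $\max_{j\ge1}\tau_j\le\tau_0$; $\min_{j\le k_n}\tau_j\ge n^{-H_2}$; and $\sum_{j=1}^{j_n}|\theta_{0j}|^\alpha/\tau_j^\alpha\le Cj_n\log n$. Then, for $M$ large enough, $$\mathbb{E}_0^{(n)}\,\Pi\Big(\boldsymbol\theta:\ d_n^2(\boldsymbol\theta,\boldsymbol\theta_0)\ge M\frac{\log n}{L(n)}\epsilon_n^2\ \Big|\ X^n\Big)=\mathcal{O}\big((n\epsilon_n^2)^{-m/2}\big)\underset{n\to\infty}{\longrightarrow}0.$$
   Context: Model. For each $n\ge1$, $(\mathcal{X}^{(n)},A^{(n)},P_{\boldsymbol\theta}^{(n)}:\boldsymbol\theta\in\Theta)$ is a statistical model with $\Theta\subseteq\mathbb{R}^{\mathbb{N}}$ (sequences $\boldsymbol\theta=(\theta_j)_{j\ge1}$, with a $\sigma$-field), dominated by a reference measure $\mu$, with densities $p_{\boldsymbol\theta}^{(n)}$; the observations are $X^n$. The true parameter is $\boldsymbol\theta_0\in\Theta$; $p_0^{(n)}=p_{\boldsymbol\theta_0}^{(n)}$, and $\mathbb{E}_0^{(n)},\mathbb{E}_{\boldsymbol\theta}^{(n)}$ are expectations under $P_{\boldsymbol\theta_0}^{(n)},P_{\boldsymbol\theta}^{(n)}$. $d_n$ is a semimetric on $\Theta$. Sieves. $\Theta_k=\mathbb{R}^k$ is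 identified with the set of sequences whose entries vanish beyond index $k$. $\boldsymbol\theta_{0k}$ is the projection of $\boldsymbol\theta_0$ on its first $k$ coordinates, $p_{0k}^{(n)}$ is the density of the observations at $\boldsymbol\theta_{0k}$, and $\|\cdot\|_{2,k}$ is the $l^2$ norm restricted to the first $k$ coordinates. Rates. $(\epsilon_n)_{n\ge1}$ is a sequence of positive numbers with $\epsilon_n\to0$ and $n\epsilon_n^2/\log n\to\infty$. For $j_0>0$ and $M_0>1$, $j_n=\lfloor j_0n\epsilon_n^2/\log n\rfloor$ and $k_n=\lfloor M_0j_n\log(n)/L(n)\rfloor$, where $L$ is a slowly varying function such that $L\le\log$ (hence $j_n\le k_n$). For $Q>0$, $\Theta_{k_n}(Q)=\{\boldsymbol\theta\in\Theta_{k_n}:\|\boldsymbol\theta\|_{2,k_n}\le n^Q\}$. Divergences. $K(f,g)=\int f\log(f/g)\,d\mu$; for $m\ge2$, $V_{m,0}(f,g)=\int f|\log(f/g)-K(f,g)|^m d\mu$; $\widetilde K(f,g)=\int p_0^{(n)}|\log(f/g)|\,d\mu$; $\widetilde V_{m,0}(f,g)=\int p_0^{(n)}|\log(f/g)-K(f,g)|^md\mu$. Neighbourhoods. $\widetilde{\mathcal{B}}_n(m)=\{\boldsymbol\theta\in\Theta_{j_n}:\widetilde K(p_{0j_n}^{(n)},p_{\boldsymbol\theta}^{(n)})\le n\epsilon_n^2,\ \widetilde V_{m,0}(p_{0j_n}^{(n)},p_{\boldsymbol\theta}^{(n)})\le(n\epsilon_n^2)^{m/2}\}$ and, for $H_1>0$,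 $\mathcal{A}_n(H_1)=\{\boldsymbol\theta\in\Theta_{j_n}:\|\boldsymbol\theta_{0j_n}-\boldsymbol\theta\|_{2,j_n}\le n^{-H_1}\}$. Sieve prior. $\Pi=\sum_{k\ge1}\pi(k)\Pi_k$ with $\pi(k)\ge0$, $\sum_k\pi(k)=1$, where $\Pi_k$ has mass only on $\Theta_k$, with Lebesgue density $\prod_{j=1}^k\tau_j^{-1}g(\theta_j/\tau_j)$ on $\mathbb{R}^k$, for a probability density $g$ on $\mathbb{R}$ and positive scales $\boldsymbol\tau=(\tau_j)_{j\ge1}$ ($\Pi,\Pi_k,\pi,g,\boldsymbol\tau$ may depend on $n$). The case of the prior truncated to an $l^1$ ball of radius $r_1>0$, $\Pi_k(\boldsymbol\theta_k)\propto\prod_{j=1}^k\tau_j^{-1}g(\theta_j/\tau_j)\,\mathbb{I}(\sum_{j=1}^k|\theta_j|\le r_1)$, is also considered. Posterior. For measurable $B\subseteq\Theta$, $\Pi(B|X^n)=\int_Bp_{\boldsymbol\theta}^{(n)}(X^n)d\Pi(\boldsymbol\theta)/\int_\Theta p_{\boldsymbol\theta}^{(n)}(X^n)d\Pi(\boldsymbol\theta)$.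
   Formalization: Proved for M_0 and Q above thresholds depending on the model and prior, with D_2>0, with the added condition that L(j_n log n/L(n)) is at least a positive constant times L(n), with L≤log only for large arguments, and, for the truncated prior, with the l^1 norm of θ_0 at most r_1. *)

theory Defs
  imports "HOL-Probability.Probability" "HOL-Library.Landau_Symbols"
begin

text \<open>
  A sequence \<open>(\<theta>\<^sub>j)\<close>, \<open>j \<ge> 1\<close>, is a function \<open>\<theta> :: nat \<Rightarrow> real\<close> whose value at \<open>j\<close> is the
  \<open>(j+1)\<close>-st coordinate, so the first \<open>k\<close> coordinates are those with index in \<open>{..<k}\<close>.
\<close>

definition first_coords :: "nat \<Rightarrow> (nat \<Rightarrow> real) \<Rightarrow> nat \<Rightarrow> real" where
  "first_coords k \<theta> = (\<lambda>j. if j < k then \<theta> j else 0)"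

definition sieve :: "nat \<Rightarrow> (nat \<Rightarrow> real) set" where
  "sieve k = {\<theta>. \<forall>j\<ge>k. \<theta> j = 0}"

definition norm2 :: "nat \<Rightarrow> (nat \<Rightarrow> real) \<Rightarrow> real" where
  "norm2 k \<theta> = L2_set \<theta> {..<k}"

text \<open>The sets \<open>\<Theta>\<^sub>k(Q)\<close> at sample size \<open>n\<close>.\<close>

definition bounded_sieve :: "nat \<Rightarrow> nat \<Rightarrow> real \<Rightarrow> (nat \<Rightarrow> real) set" where
  "bounded_sieve n k Q = {\<theta> \<in> sieve k. norm2 k \<theta> \<le> real n powr Q}"

definition semimetric_on :: "'a set \<Rightarrow> ('a \<Rightarrow> 'a \<Rightarrow> real) \<Rightarrow> bool" where
  "semimetric_on S d \<longleftrightarrow>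
     (\<forall>x\<in>S. d x x = 0) \<and>
     (\<forall>x\<in>S. \<forall>y\<in>S. 0 \<le> d x y \<and> d x y = d y x) \<and>
     (\<forall>x\<in>S. \<forall>y\<in>S. \<forall>z\<in>S. d x z \<le> d x y + d y z)"

text \<open>Slow variation in the sense of Karamata: only the behaviour near infinity matters.\<close>

definition slowly_varying :: "(real \<Rightarrow> real) \<Rightarrow> bool" where
  "slowly_varying L \<longleftrightarrow>
     (\<exists>X. set_borel_measurable borel {X..} L \<and> (\<forall>x\<ge>X. 0 < L x)) \<and>
     (\<forall>c>0. ((\<lambda>x. L (c * x) / L x) \<longlongrightarrow> 1) at_top)"

definition j_seq :: "real \<Rightarrow> (nat \<Rightarrow> real) \<Rightarrow> nat \<Rightarrow> nat" where
  "j_seq j0 \<epsilon> n = nat \<lfloor>j0 * real n * (\<epsilon> n)\<^sup>2 / ln (real n)\<rfloor>"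

definition k_seq :: "real \<Rightarrow> real \<Rightarrow> (nat \<Rightarrow> real) \<Rightarrow> (real \<Rightarrow> real) \<Rightarrow> nat \<Rightarrow> nat" where
  "k_seq j0 M0 \<epsilon> L n = nat \<lfloor>M0 * real (j_seq j0 \<epsilon> n) * ln (real n) / L (real n)\<rfloor>"

text \<open>
  The logarithm of a ratio of densities is extended-valued and the divergences below are built
  from non-negative integrals, so that a divergent integral, or a density vanishing where the
  other one does not, yields \<open>\<infinity>\<close> (a Bochner integral would yield \<open>0\<close>). The value at \<open>0/0\<close>
  is irrelevant for \<open>K\<close> and \<open>V\<close>, where such points have weight \<open>0\<close>; for the versions weighted
  by \<open>p\<^sub>0\<close> it is irrelevant as soon as \<open>K(p\<^sub>0, f)\<close> is finite, as then \<open>f > 0\<close> almost everywhere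
  on \<open>{p\<^sub>0 > 0}\<close>.
\<close>

definition log_ratio :: "real \<Rightarrow> real \<Rightarrow> ereal" where
  "log_ratio a b =
     (if 0 < a \<and> 0 < b then ereal (ln (a / b))
      else if 0 < a then \<infinity> else if 0 < b then -\<infinity> else 0)"

definition abs_powr :: "ereal \<Rightarrow> real \<Rightarrow> ennreal" where
  "abs_powr z m = (if \<bar>z\<bar> = \<infinity> then \<infinity> else ennreal (real_of_ereal \<bar>z\<bar> powr m))"

text \<open>
  The integral of \<open>f log (f/g)\<close>, as the difference of its positive and negative parts; the
  negative part is finite for probability densities \<open>f\<close> and \<open>g\<close>.
\<close>

definition KL :: "'x measure \<Rightarrow> ('x \<Rightarrow> real) \<Rightarrow> ('x \<Rightarrow> real) \<Rightarrow> ereal" where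
  "KL \<mu> f g =
     enn2ereal (\<integral>\<^sup>+x. ennreal (f x) * e2ennreal (log_ratio (f x) (g x)) \<partial>\<mu>) -
     enn2ereal (\<integral>\<^sup>+x. ennreal (f x) * e2ennreal (- log_ratio (f x) (g x)) \<partial>\<mu>)"

definition V_weighted ::
  "'x measure \<Rightarrow> ('x \<Rightarrow> real) \<Rightarrow> real \<Rightarrow> ('x \<Rightarrow> real) \<Rightarrow> ('x \<Rightarrow> real) \<Rightarrow> ennreal" where
  "V_weighted \<mu> w m f g =
     (\<integral>\<^sup>+x. ennreal (w x) * abs_powr (log_ratio (f x) (g x) - KL \<mu> f g) m \<partial>\<mu>)"

definition V :: "'x measure \<Rightarrow> real \<Rightarrow> ('x \<Rightarrow> real) \<Rightarrow> ('x \<Rightarrow> real) \<Rightarrow> ennreal" where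
  "V \<mu> m f g = V_weighted \<mu> f m f g"

definition KL_tilde ::
  "'x measure \<Rightarrow> ('x \<Rightarrow> real) \<Rightarrow> ('x \<Rightarrow> real) \<Rightarrow> ('x \<Rightarrow> real) \<Rightarrow> ennreal" where
  "KL_tilde \<mu> p0 f g = (\<integral>\<^sup>+x. ennreal (p0 x) * e2ennreal \<bar>log_ratio (f x) (g x)\<bar> \<partial>\<mu>)"

definition V_tilde ::
  "'x measure \<Rightarrow> ('x \<Rightarrow> real) \<Rightarrow> real \<Rightarrow> ('x \<Rightarrow> real) \<Rightarrow> ('x \<Rightarrow> real) \<Rightarrow> ennreal" where
  "V_tilde \<mu> p0 m f g = V_weighted \<mu> p0 m f g"

text \<open>
  The neighbourhoods of the true parameter in the sieve of dimension \<open>j\<close>; \<open>p\<close> is the family of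
  densities at sample size \<open>n\<close>, and \<open>e\<close> stands for \<open>n\<epsilon>\<^sub>n\<^sup>2\<close>.
\<close>

definition B_tilde ::
  "'x measure \<Rightarrow> ((nat \<Rightarrow> real) \<Rightarrow> 'x \<Rightarrow> real) \<Rightarrow> (nat \<Rightarrow> real) \<Rightarrow> nat \<Rightarrow> real \<Rightarrow> real
     \<Rightarrow> (nat \<Rightarrow> real) set" where
  "B_tilde \<mu> p \<theta>0 j e m =
     {\<theta> \<in> sieve j.
        KL_tilde \<mu> (p \<theta>0) (p (first_coords j \<theta>0)) (p \<theta>) \<le> ennreal e \<and>
        V_tilde \<mu> (p \<theta>0) m (p (first_coords j \<theta>0)) (p \<theta>) \<le> ennreal (e powr (m / 2))}"

definition A_nbhd :: "(nat \<Rightarrow> real) \<Rightarrow> nat \<Rightarrow> nat \<Rightarrow> real \<Rightarrow> (nat \<Rightarrow> real) set" where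
  "A_nbhd \<theta>0 n j H1 =
     {\<theta> \<in> sieve j. norm2 j (\<lambda>i. first_coords j \<theta>0 i - \<theta> i) \<le> real n powr (- H1)}"

definition sample_law :: "'x measure \<Rightarrow> ('x \<Rightarrow> real) \<Rightarrow> 'x measure" where
  "sample_law \<mu> f = density \<mu> (\<lambda>x. ennreal (f x))"

text \<open>
  The conditional prior on the sieve of dimension \<open>k\<close>, truncated to the \<open>l\<^sup>1\<close> ball of radius
  \<open>r1\<close>. The radius \<open>r1 = \<infinity>\<close> gives the prior without truncation (the normalizing constant is
  then \<open>1\<close>). The prior lives on the \<open>\<sigma>\<close>-field of \<open>T\<close>, whose space is the parameter set.
\<close>

definition prior_kernel ::
  "(real \<Rightarrow> real) \<Rightarrow> (nat \<Rightarrow> real) \<Rightarrow> ereal \<Rightarrow> nat \<Rightarrow> (nat \<Rightarrow> real) \<Rightarrow> ennreal" where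
  "prior_kernel g \<tau> r1 k u =
     ennreal ((\<Prod>j<k. g (u j / \<tau> j) / \<tau> j) * of_bool (ereal (\<Sum>j<k. \<bar>u j\<bar>) \<le> r1))"

definition prior_component ::
  "(nat \<Rightarrow> real) measure \<Rightarrow> (real \<Rightarrow> real) \<Rightarrow> (nat \<Rightarrow> real) \<Rightarrow> ereal \<Rightarrow> nat
     \<Rightarrow> (nat \<Rightarrow> real) measure" where
  "prior_component T g \<tau> r1 k =
     (let leb = (\<Pi>\<^sub>M j\<in>{..<k}. lborel) in
      distr (density leb (\<lambda>u. prior_kernel g \<tau> r1 k u / (\<integral>\<^sup>+v. prior_kernel g \<tau> r1 k v \<partial>leb)))
        T (first_coords k))"

definition sieve_prior ::
  "(nat \<Rightarrow> real) measure \<Rightarrow> nat pmf \<Rightarrow> (real \<Rightarrow> real) \<Rightarrow> (nat \<Rightarrow> real) \<Rightarrow> ereal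
     \<Rightarrow> (nat \<Rightarrow> real) measure" where
  "sieve_prior T \<pi> g \<tau> r1 = Giry_Monad.bind (measure_pmf \<pi>) (prior_component T g \<tau> r1)"

definition posterior ::
  "(nat \<Rightarrow> real) measure \<Rightarrow> ((nat \<Rightarrow> real) \<Rightarrow> 'x \<Rightarrow> real) \<Rightarrow> (nat \<Rightarrow> real) set \<Rightarrow> 'x \<Rightarrow> real"
  where
  "posterior prior p B x =
     enn2real ((\<integral>\<^sup>+\<theta>\<in>B. ennreal (p \<theta> x) \<partial>prior) / (\<integral>\<^sup>+\<theta>. ennreal (p \<theta> x) \<partial>prior))"

end

theory Submission
  imports Defs "HOL-Real_Asymp.Real_Asymp"
begin

text \<open>
  Write \<open>e = n\<epsilon>\<^sub>n\<^sup>2\<close>. The proof is the testing argument for posterior contraction. For any test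
  \<open>\<psi>\<close>, splitting the expectation according to \<open>\<psi>\<close> and to whether the evidence \<open>\<integral> p\<^sub>\<theta> d\<Pi>\<close> exceeds
  \<open>exp (-A) p\<^sub>0\<close> gives (\<open>posterior_expectation_le\<close>) \<open>E\<^sub>0 \<Pi>(B | X) \<le> E\<^sub>0 \<psi> + P\<^sub>0(evidence < exp
  (-A) p\<^sub>0) + exp A \<integral>\<^sub>B E\<^sub>\<theta>(1 - \<psi>) d\<Pi>(\<theta>)\<close>. It is used with \<open>A\<close> a multiple of \<open>e\<close>, so that
  everything else has to be exponentially small with a larger multiple of \<open>e\<close>, apart from the
  middle term, which gives the rate \<open>e\<^bsup>-m/2\<^esup>\<close>.

  \<^emph>\<open>Evidence.\<close> For one \<open>\<theta>\<close> in the Kullback-Leibler neighbourhood, two Markov inequalities of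
  order \<open>m\<close> show that \<open>p\<^sub>\<theta> \<ge> exp (-6e) p\<^sub>0\<close> outside an event of probability \<open>2 e\<^bsup>-m/2\<^esup>\<close>
  (\<open>density_drop_probability\<close>). By Fubini, the prior proportion of those \<open>\<theta>\<close> in a neighbourhood
  for which this fails has small expectation, hence exceeds one half with probability \<open>O(e\<^bsup>-m/2\<^esup>)\<close>
  only; otherwise the evidence is at least half of \<open>exp (-6e) p\<^sub>0\<close> times the prior mass of the
  neighbourhood (\<open>evidence_lower_bound\<close>). The neighbourhood contains a cube of side polynomial in
  \<open>1/n\<close> in dimension \<open>j\<^sub>n\<close>, whose prior mass is \<open>exp (-O(j\<^sub>n log n)) = exp (-O(e))\<close>
  (\<open>coord_law_neighbourhood_mass\<close>).

  \<^emph>\<open>Mass outside the sieve.\<close> Dimensions above \<open>k\<^sub>n\<close> have prior mass at most \<open>exp (-c\<surd>M\<^sub>0 e)\<close>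
  (\<open>prior_dimension_tail\<close>): Potter's bound for \<open>L\<close> (\<open>slowly_varying_Potter\<close>) makes \<open>k L(k)\<close> grow
  at least like a square root beyond \<open>y\<^sub>n = j\<^sub>n log n / L(n)\<close>, where it is at least of order \<open>j\<^sub>n
  log n\<close>. This fixes \<open>M\<^sub>0\<close>. In dimensions up to \<open>k\<^sub>n\<close>, the sequences of norm above \<open>n\<^sup>Q\<close> have
  prior mass \<open>O(n\<^sup>3 exp (-c n\<^sup>2))\<close> when \<open>Q \<ge> 3 + 2/\<alpha>\<close> (\<open>norm_tail\<close>), which fixes \<open>Q\<close>.

  \<^emph>\<open>Tests.\<close> The logarithm of the number of cells of a polynomially fine grid on \<open>\<Theta>\<^sub>k\<^sub>n(Q)\<close> is
  \<open>O(k\<^sub>n log n) = O(e log n / L(n))\<close>, the same order as \<open>n\<close> times the squared radius of the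
  excluded ball. A single grid therefore serves the whole region outside that ball: choose one
  representative in each cell that meets the region and add up the tests given for these
  representatives. The number of cells is beaten by the error \<open>exp (-c\<^sub>1 n R\<^sup>2)\<close> of each test as
  soon as \<open>M\<close> is large (\<open>sieve_test\<close>, \<open>mesh_asymptotics\<close>).

  Two points of form. The \<open>\<sigma>\<close>-field on the parameter set need not contain the sieves \<open>\<Theta>\<^sub>k\<close>, so
  all integrals over the prior are first written as sums over \<open>k\<close> of integrals over coordinate
  space (\<open>nn_integral_sieve_prior\<close>), where the sets in question are measurable. And the thresholds
  for \<open>M\<^sub>0\<close> and \<open>Q\<close> are announced before the constants in the conditions on the prior are known.
  Among these conditions only the lower bound on the scales involves \<open>M\<^sub>0\<close>, and it is applied to
  the scales with index below \<open>j\<^sub>n \<le> k\<^sub>n\<close>; so the constants belonging to any one \<open>M\<^sub>0 > 1\<close> for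
  which the conditions hold determine thresholds that are valid for all
  (\<open>thresholds_before_constants\<close>).
\<close>

section \<open>Slowly varying functions\<close>

text \<open>
  Continuity from below: the sets increase to \<open>{0..2}\<close> when \<open>f n \<longlonglongrightarrow> 0\<close> pointwise. A pointwise
  limit thus becomes a bound that is uniform outside a set of small measure.
\<close>

lemma increasing_tail_sets_measure:
  fixes f :: "nat \<Rightarrow> real \<Rightarrow> real"
  assumes [measurable]: "\<And>n. f n \<in> borel_measurable borel"
    and lim: "\<And>v. (\<lambda>n. f n v) \<longlonglongrightarrow> 0"
  shows "(\<lambda>n. measure lborel {v\<in>{0..2}. \<forall>m\<ge>n. \<bar>f m v\<bar> \<le> 1/2}) \<longlonglongrightarrow> 2"
proof -
  define V where "V n = {v\<in>{0..2}. \<forall>m\<ge>n. \<bar>f m v\<bar> \<le> 1/2}" for n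
  have V_meas: "V n \<in> sets lborel" for n
  proof -
    have "{v \<in> space borel. v \<in> {0..2} \<and> (\<forall>m\<in>{n..}. \<bar>f m v\<bar> \<le> 1/2)} \<in> sets borel"
      by measurable
    then show ?thesis by (simp add: V_def Ball_def)
  qed
  have "incseq V"
    by (auto simp: V_def incseq_def)
  have "(\<Union>n. V n) = {0..2}"
  proof
    show "{0..2} \<subseteq> (\<Union>n. V n)"
    proof
      fix v :: real assume v: "v \<in> {0..2}"
      have "\<forall>\<^sub>F n in sequentially. \<bar>f n v\<bar> < 1/2"
        using tendstoD[OF lim[of v], of "1/2"] by (simp add: dist_real_def)
      then obtain N where "\<And>n. n \<ge> N \<Longrightarrow> \<bar>f n v\<bar> < 1/2"
        by (auto simp: eventually_sequentially)
      then have "v \<in> V N" using v by (force simp: V_def)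
      then show "v \<in> (\<Union>n. V n)" by blast
    qed
  qed (auto simp: V_def)
  moreover have "(\<lambda>n. measure lborel (V n)) \<longlonglongrightarrow> measure lborel (\<Union>n. V n)"
  proof (rule Lim_measure_incseq)
    show "range V \<subseteq> sets lborel" using V_meas by auto
    show "incseq V" by fact
    show "emeasure lborel (\<Union>n. V n) \<noteq> \<infinity>"
      unfolding \<open>(\<Union>n. V n) = {0..2}\<close> by simp
  qed
  ultimately show ?thesis by (simp add: V_def)
qed

text \<open>
  The uniform convergence theorem for slowly varying functions in additive form, in the weak
  version that suffices for Potter's bound. If the bound failed along \<open>x n\<close> and \<open>x n + u n\<close>, then
  for large \<open>n\<close> the increments in \<open>{0..2}\<close> over which \<open>h\<close> changes by at most \<open>1/2\<close> from \<open>x n\<close> and,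
  shifted by \<open>u n\<close>, those from \<open>x n + u n\<close> would be two subsets of \<open>{0..3}\<close> of measure above
  \<open>3/2\<close>. They share a point, through which \<open>h (x n)\<close> and \<open>h (x n + u n)\<close> can be compared.
\<close>

lemma additive_slow_variation_bounded:
  fixes h :: "real \<Rightarrow> real"
  assumes [measurable]: "h \<in> borel_measurable borel"
    and lim: "\<And>u. ((\<lambda>x. h (x + u) - h x) \<longlongrightarrow> 0) at_top"
  shows "\<exists>X. \<forall>x\<ge>X. \<forall>u\<in>{0..1}. \<bar>h (x + u) - h x\<bar> \<le> 1"
proof (rule ccontr)
  assume "\<not> ?thesis"
  then have "\<forall>n::nat. \<exists>x u. x \<ge> real n \<and> u \<in> {0..1} \<and> \<bar>h (x + u) - h x\<bar> > 1"
    by (metis linorder_not_less)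
  then obtain x u where xu: "\<And>n::nat. x n \<ge> real n" "\<And>n. u n \<in> {0..1}"
      "\<And>n. \<bar>h (x n + u n) - h (x n)\<bar> > 1"
    by metis
  define V where "V y n = {v\<in>{0..2}. \<forall>m\<ge>n. \<bar>h (y m + v) - h (y m)\<bar> \<le> 1/2}"
    for y :: "nat \<Rightarrow> real" and n :: nat
  have V_meas: "V y n \<in> sets borel" for n y
  proof -
    have "{v \<in> space borel. v \<in> {0..2} \<and> (\<forall>m\<in>{n..}. \<bar>h (y m + v) - h (y m)\<bar> \<le> 1/2)} \<in> sets borel"
      by measurable
    then show ?thesis by (simp add: V_def Ball_def)
  qed
  have big: "\<forall>\<^sub>F n in sequentially. measure lborel (V y n) > 3/2"
    if "\<And>n. y n \<ge> real n" for y
  proof -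
    have y: "filterlim y at_top sequentially"
      using that filterlim_at_top_mono[OF filterlim_real_sequentially] by simp
    have "(\<lambda>n. measure lborel (V y n)) \<longlonglongrightarrow> 2"
      unfolding V_def
      by (rule increasing_tail_sets_measure) (use filterlim_compose[OF lim y] in simp_all)
    then show ?thesis by (rule order_tendstoD) simp
  qed
  have xu': "x n + u n \<ge> real n" for n using xu(1)[of n] xu(2)[of n] by simp
  have "\<exists>n. measure lborel (V x n) > 3/2 \<and> measure lborel (V (\<lambda>n. x n + u n) n) > 3/2"
    by (rule eventually_happens'[OF sequentially_bot eventually_conj[OF big[OF xu(1)] big[OF xu']]])
  then obtain n where n: "measure lborel (V x n) > 3/2" "measure lborel (V (\<lambda>n. x n + u n) n) > 3/2"
    by blast
  define W where "W = (\<lambda>v. v + u n) ` V (\<lambda>n. x n + u n) n"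
  have W_eq: "W = (+) (- u n) -` V (\<lambda>n. x n + u n) n"
    unfolding W_def by force
  have W_meas: "W \<in> sets borel"
    unfolding W_eq by (rule measurable_sets_borel[OF _ V_meas]) simp
  have "measure lborel (V (\<lambda>n. x n + u n) n) = measure (distr lborel borel ((+) (- u n))) (V (\<lambda>n. x n + u n) n)"
    by (simp only: lborel_distr_plus)
  also have "\<dots> = measure lborel W"
    using V_meas by (subst measure_distr) (auto simp: W_eq)
  finally have W_measure: "measure lborel W > 3/2" using n by simp
  show False
  proof (cases "V x n \<inter> W = {}")
    case True
    have "V x n \<subseteq> {0..3}" "W \<subseteq> {0..3}"
      using xu(2)[of n] by (auto simp: V_def W_def)
    then have "measure lborel (V x n \<union> W) \<le> measure lborel {0..3::real}"
      by (intro measure_mono_fmeasurable) (use V_meas W_meas in \<open>auto simp: fmeasurable_def\<close>)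
    moreover have "emeasure lborel (V x n) \<le> emeasure lborel {0..3::real}"
        "emeasure lborel W \<le> emeasure lborel {0..3::real}"
      by (intro emeasure_mono; use \<open>V x n \<subseteq> {0..3}\<close> \<open>W \<subseteq> {0..3}\<close> in simp)+
    then have "measure lborel (V x n \<union> W) = measure lborel (V x n) + measure lborel W"
      using V_meas W_meas True
      by (intro measure_Union) (auto simp: top_unique)
    ultimately show False using n W_measure by simp
  next
    case False
    then obtain s where s: "s \<in> V x n" "- u n + s \<in> V (\<lambda>n. x n + u n) n"
      by (auto simp: W_eq)
    have "\<bar>h (x n + s) - h (x n)\<bar> \<le> 1/2" "\<bar>h (x n + s) - h (x n + u n)\<bar> \<le> 1/2"
      using s by (force simp: V_def)+
    then show False using xu(3)[of n] by linarith
  qed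
qed

text \<open>
  One side of Potter's bound with exponent \<open>1/2\<close>: \<open>h t = ln (L (exp t))\<close> eventually loses at most
  \<open>1/2\<close> over a unit step, and at most \<open>1\<close> over the remaining fraction of a step.
\<close>

lemma slowly_varying_Potter:
  assumes "slowly_varying L"
  shows "\<exists>X>0. \<exists>c>0. \<forall>x\<ge>X. 0 < L x \<and> (\<forall>y\<ge>x. c * sqrt (x / y) * L x \<le> L y)"
proof -
  obtain X0 where X0: "set_borel_measurable borel {X0..} L" "\<And>x. x \<ge> X0 \<Longrightarrow> 0 < L x"
    and lim: "\<And>c. c > 0 \<Longrightarrow> ((\<lambda>x. L (c * x) / L x) \<longlongrightarrow> 1) at_top"
    using assms by (auto simp: slowly_varying_def)
  define X1 where "X1 = max X0 1"
  have [measurable]: "(\<lambda>x. indicator {X0..} x *\<^sub>R L x) \<in> borel_measurable borel"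
    using X0(1) by (simp add: set_borel_measurable_def)
  define h where "h t = (if exp t \<ge> X1 then ln (indicator {X0..} (exp t) *\<^sub>R L (exp t)) else 0)" for t
  have h_meas: "h \<in> borel_measurable borel"
  proof -
    have [measurable]: "(\<lambda>t. indicator {X0..} (exp t) *\<^sub>R L (exp t)) \<in> borel_measurable borel"
      by (rule measurable_compose[where f = exp, OF _ \<open>(\<lambda>x. indicator {X0..} x *\<^sub>R L x) \<in> borel_measurable borel\<close>]) simp
    show ?thesis unfolding h_def by measurable
  qed
  have exp_ge: "exp t \<ge> X1" if "t \<ge> ln X1" for t
  proof -
    have "exp (ln X1) \<le> exp t" using that by simp
    then show ?thesis by (simp add: X1_def)
  qed
  have h_eq: "h t = ln (L (exp t))" if "exp t \<ge> X1" for t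
    using that by (simp add: h_def X1_def)
  have exp_h: "exp (h t) = L (exp t)" if "exp t \<ge> X1" for t
    using that X0(2)[of "exp t"] by (simp add: h_eq X1_def)
  have h_lim: "((\<lambda>x. h (x + u) - h x) \<longlongrightarrow> 0) at_top" for u
  proof -
    have "((\<lambda>x. L (exp u * exp x) / L (exp x)) \<longlongrightarrow> 1) at_top"
      using filterlim_compose[OF lim[of "exp u"] exp_at_top] by simp
    then have l: "((\<lambda>x. ln (L (exp u * exp x) / L (exp x))) \<longlongrightarrow> 0) at_top"
      using tendsto_ln by fastforce
    have ev: "\<forall>\<^sub>F x in at_top. exp x \<ge> X1" "\<forall>\<^sub>F x in at_top. exp (x + u) \<ge> X1"
    proof -
      have "\<forall>\<^sub>F x in at_top. x \<ge> ln X1" "\<forall>\<^sub>F x in at_top. x \<ge> ln X1 - u"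
        by (rule eventually_ge_at_top)+
      then show "\<forall>\<^sub>F x in at_top. exp x \<ge> X1" "\<forall>\<^sub>F x in at_top. exp (x + u) \<ge> X1"
        by (eventually_elim, simp add: exp_ge)+
    qed
    have "\<forall>\<^sub>F x in at_top. ln (L (exp u * exp x) / L (exp x)) = h (x + u) - h x"
      using ev
    proof eventually_elim
      case (elim x)
      then have "L (exp x) > 0" "L (exp (x + u)) > 0"
        using X0(2) by (auto simp: X1_def)
      then show ?case using elim by (simp add: h_eq ln_div exp_add mult.commute)
    qed
    with l show ?thesis by (rule Lim_transform_eventually)
  qed
  obtain A where A: "\<And>x u. x \<ge> A \<Longrightarrow> u \<in> {0..1} \<Longrightarrow> \<bar>h (x + u) - h x\<bar> \<le> 1"
    using additive_slow_variation_bounded[OF h_meas h_lim] by blast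
  have "\<forall>\<^sub>F x in at_top. \<bar>h (x + 1) - h x\<bar> < 1/2"
    using tendstoD[OF h_lim[of 1], of "1/2"] by (simp add: dist_real_def)
  then obtain A' where A': "\<And>x. x \<ge> A' \<Longrightarrow> \<bar>h (x + 1) - h x\<bar> < 1/2"
    by (auto simp: eventually_at_top_linorder)
  define B where "B = max A (max A' (ln X1))"
  have half_step: "h x - 1/2 \<le> h (x + 1)" if "x \<ge> B" for x
    using A'[of x] that unfolding B_def by linarith
  have steps: "h (x + real N) \<ge> h x - real N / 2" if "x \<ge> B" for x N
  proof (induction N)
    case (Suc N)
    have "h x - real (Suc N) / 2 = (h x - real N / 2) - 1/2"
      by (simp add: field_simps)
    also have "\<dots> \<le> h (x + real N) - 1/2"
      using Suc by simp
    also have "\<dots> \<le> h (x + real N + 1)"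
      by (rule half_step) (use that in \<open>simp add: B_def\<close>)
    also have "\<dots> = h (x + real (Suc N))"
      by (simp add: algebra_simps)
    finally show ?case .
  qed simp
  have main: "h y \<ge> h x - (y - x) / 2 - 1" if "x \<ge> B" "y \<ge> x" for x y
  proof -
    define N where "N = nat \<lfloor>y - x\<rfloor>"
    have N: "real N \<le> y - x" "y - x \<le> real N + 1"
      using that unfolding N_def by linarith+
    define z where "z = x + real N"
    have "\<bar>h (z + (y - z)) - h z\<bar> \<le> 1"
      by (rule A) (use that N in \<open>auto simp: B_def z_def\<close>)
    moreover have "h x - real N / 2 \<le> h z"
      using steps[OF that(1), of N] by (simp only: z_def)
    moreover have "h z - 1 \<le> h y"
      using calculation(1) by (simp add: abs_le_iff)
    ultimately show ?thesis using N(1) by argo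
  qed
  show ?thesis
  proof (rule exI[of _ "exp B"], rule conjI, simp, rule exI[of _ "exp (-1)"], intro conjI allI impI)
    fix x assume x: "exp B \<le> x"
    have "X1 > 0" by (simp add: X1_def)
    have "exp B \<ge> X1" by (rule exp_ge) (simp add: B_def)
    with x have "x \<ge> X1" "x > 0" using \<open>X1 > 0\<close> by auto
    show "0 < L x" using X0(2) \<open>x \<ge> X1\<close> by (simp add: X1_def)
    fix y assume y: "x \<le> y"
    have "ln x \<ge> B" using x \<open>x > 0\<close> by (simp add: ln_ge_iff)
    have "exp (h (ln y)) \<ge> exp (h (ln x) - (ln y - ln x) / 2 - 1)"
      using main[OF \<open>ln x \<ge> B\<close>, of "ln y"] y \<open>x > 0\<close> by simp
    moreover have "exp (h (ln x) - (ln y - ln x) / 2 - 1) = exp (-1) * exp ((ln x - ln y) / 2) * exp (h (ln x))"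
      by (simp add: field_simps flip: exp_add)
    moreover have "exp ((ln x - ln y) / 2) = sqrt (x / y)"
      using \<open>x > 0\<close> y by (simp add: powr_half_sqrt[symmetric] powr_def ln_div)
    ultimately show "exp (-1) * sqrt (x / y) * L x \<le> L y"
      using exp_h[of "ln x"] exp_h[of "ln y"] \<open>x > 0\<close> y \<open>x \<ge> X1\<close> by simp
  qed auto
qed

section \<open>Exponential bounds\<close>

lemma exp_minus_le_inverse_power:
  fixes z :: real assumes "0 < z" shows "exp (- z) \<le> fact N / z ^ N"
proof -
  have "summable (\<lambda>n. z ^ n / fact n)"
    using summable_exp_generic[of z] by (simp add: field_simps)
  then have "(\<Sum>n\<in>{N}. z ^ n / fact n) \<le> (\<Sum>n. z ^ n / fact n)"
    by (rule sum_le_suminf) (use assms in auto)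
  also have "\<dots> = exp z" by (simp add: exp_def divide_inverse mult.commute scaleR_conv_of_real)
  finally show ?thesis using assms by (simp add: exp_minus field_simps)
qed

lemma exp_minus_le_powr:
  assumes "1 \<le> z" "s \<le> real N"
  shows "exp (- z) \<le> fact N * z powr (- s)"
proof -
  have "exp (- z) \<le> fact N / z ^ N" by (rule exp_minus_le_inverse_power) (use assms in linarith)
  also have "z ^ N = z powr real N" using assms by (simp add: powr_realpow)
  also have "fact N / z powr real N = fact N * z powr (- real N)" by (simp add: powr_minus divide_inverse)
  also have "\<dots> \<le> fact N * z powr (- s)" using assms by (intro mult_left_mono powr_mono) auto
  finally show ?thesis .
qed

text \<open>
  Half of the exponent is kept as the factor \<open>exp (-\<Lambda>\<surd>M0/2)\<close>; the other half, bounded by a fourth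
  inverse power, makes the series converge like the sum of \<open>1/k\<^sup>2\<close>.
\<close>

lemma pmf_tail_le:
  fixes q :: "nat pmf"
  assumes y: "0 < y" and \<Lambda>: "1 \<le> \<Lambda>" and M0: "0 \<le> M0"
    and large: "\<And>k. K < k \<Longrightarrow> M0 * y \<le> real k"
    and q: "\<And>k. K < k \<Longrightarrow> pmf q k \<le> exp (- (\<Lambda> * sqrt (real k / y)))"
  shows "emeasure (measure_pmf q) {k. K < k}
    \<le> ennreal (384 * y\<^sup>2 * exp (- (\<Lambda> * sqrt M0 / 2)) * (\<Sum>k. inverse (real k ^ 2)))"
proof -
  let ?c = "384 * y\<^sup>2 * exp (- (\<Lambda> * sqrt M0 / 2))"
  have sm: "summable (\<lambda>k. inverse (real k ^ 2))" by (rule inverse_power_summable) simp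
  have bound: "pmf q k \<le> ?c * inverse (real k ^ 2)" if k: "K < k" for k
  proof -
    have "k > 0" using k by simp
    have "sqrt (M0) \<le> sqrt (real k / y)" using large[OF k] y by (simp add: le_divide_eq)
    then have "\<Lambda> * sqrt M0 / 2 \<le> \<Lambda> * sqrt (real k / y) / 2" using \<Lambda> by simp
    then have "exp (- (\<Lambda> * sqrt (real k / y))) \<le> exp (- (\<Lambda> * sqrt M0 / 2) + - (\<Lambda> * sqrt (real k / y) / 2))"
      by simp
    also have "\<dots> = exp (- (\<Lambda> * sqrt M0 / 2)) * exp (- (\<Lambda> * sqrt (real k / y) / 2))"
      by (rule exp_add)
    also have "exp (- (\<Lambda> * sqrt (real k / y) / 2)) \<le> exp (- (sqrt (real k / y) / 2))"
      using mult_right_mono[OF \<Lambda>, of "sqrt (real k / y)"] y by simp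
    also have "\<dots> \<le> fact 4 / (sqrt (real k / y) / 2) ^ 4"
      by (rule exp_minus_le_inverse_power) (use y \<open>k > 0\<close> in simp)
    also have "(sqrt (real k / y) / 2) ^ 4 = (real k / y) ^ 2 / 16"
    proof -
      have "(sqrt (real k / y)) ^ 4 = ((sqrt (real k / y))\<^sup>2)\<^sup>2" by simp
      also have "\<dots> = (real k / y)\<^sup>2" using y by (simp only: real_sqrt_pow2 divide_nonneg_nonneg of_nat_0_le_iff less_imp_le)
      finally show ?thesis by (simp add: power_divide)
    qed
    also have "fact 4 / ((real k / y) ^ 2 / 16) = 384 * y\<^sup>2 * inverse (real k ^ 2)"
      by (simp add: fact_numeral power_divide field_simps)
    finally show ?thesis using q[OF k] by (simp add: mult_left_mono mult_ac)
  qed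
  have "emeasure (measure_pmf q) {k. K < k} = (\<integral>\<^sup>+k. indicator {k. K < k} k \<partial>measure_pmf q)"
    by simp
  also have "\<dots> = (\<integral>\<^sup>+k. ennreal (pmf q k) * indicator {k. K < k} k \<partial>count_space UNIV)"
    by (rule nn_integral_measure_pmf)
  also have "\<dots> \<le> (\<integral>\<^sup>+k. ennreal (?c * inverse (real k ^ 2)) \<partial>count_space UNIV)"
    by (intro nn_integral_mono) (auto simp: indicator_def intro!: ennreal_leI bound)
  also have "\<dots> = (\<Sum>k. ennreal (?c * inverse (real k ^ 2)))"
    by (rule nn_integral_count_space_nat)
  also have "\<dots> = ennreal (\<Sum>k. ?c * inverse (real k ^ 2))"
    by (rule suminf_ennreal2) (use sm in \<open>auto intro: summable_mult\<close>)
  also have "(\<Sum>k. ?c * inverse (real k ^ 2)) = ?c * (\<Sum>k. inverse (real k ^ 2))"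
    by (rule suminf_mult[OF sm])
  finally show ?thesis .
qed

lemma stretched_exponential_integral_finite:
  fixes c \<alpha> :: real
  assumes "0 < c" "0 < \<alpha>"
  shows "(\<integral>\<^sup>+s. ennreal (exp (- (c * \<bar>s\<bar> powr \<alpha>))) \<partial>lborel) < \<infinity>"
proof -
  \<comment> \<open>then \<open>N \<alpha> \<ge> 2\<close>, and the \<open>N\<close>-th term of the exponential series already beats \<open>s\<^sup>2\<close>\<close>
  define N where "N = nat \<lceil>2 / \<alpha>\<rceil>"
  have "2 / \<alpha> \<le> real N" unfolding N_def by linarith
  then have N: "2 \<le> \<alpha> * real N" using assms by (simp add: divide_le_eq mult.commute)
  define D where "D = fact N / c ^ N"
  have "0 \<le> D" using assms by (simp add: D_def)
  define C where "C = 2 + 2 * D"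
  have C: "C \<ge> 2" "fact N / c ^ N \<le> C / 2"
    using \<open>0 \<le> D\<close> by (auto simp: C_def D_def[symmetric])
  have bound: "exp (- (c * \<bar>s\<bar> powr \<alpha>)) \<le> C * inverse (1 + s\<^sup>2)" for s
  proof (cases "\<bar>s\<bar> \<le> 1")
    case True
    then have "s\<^sup>2 \<le> 1" by (simp add: abs_square_le_1)
    have "0 < 1 + s\<^sup>2" by (simp add: add_pos_nonneg)
    have "exp (- (c * \<bar>s\<bar> powr \<alpha>)) \<le> 1" using assms by simp
    also have "\<dots> \<le> C * inverse (1 + s\<^sup>2)"
      using \<open>s\<^sup>2 \<le> 1\<close> C(1) \<open>0 < 1 + s\<^sup>2\<close> by (simp add: field_simps)
    finally show ?thesis .
  next
    case False
    then have s: "1 < \<bar>s\<bar>" by simp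
    have "s\<^sup>2 = \<bar>s\<bar> powr 2" using s by (simp add: powr_numeral)
    also have "\<dots> \<le> \<bar>s\<bar> powr (\<alpha> * real N)" using s N by (intro powr_mono) auto
    also have "\<dots> = (\<bar>s\<bar> powr \<alpha>) ^ N" using s by (simp add: powr_powr[symmetric] powr_realpow)
    finally have s2: "s\<^sup>2 \<le> (\<bar>s\<bar> powr \<alpha>) ^ N" .
    have "1 \<le> \<bar>s\<bar>\<^sup>2" using s by (intro one_le_power) simp
    then have "s\<^sup>2 \<ge> 1" by simp
    have "exp (- (c * \<bar>s\<bar> powr \<alpha>)) \<le> fact N / (c * \<bar>s\<bar> powr \<alpha>) ^ N"
      by (rule exp_minus_le_inverse_power) (use assms s in auto)
    also have "\<dots> = fact N / c ^ N / (\<bar>s\<bar> powr \<alpha>) ^ N" by (simp add: power_mult_distrib)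
    also have "\<dots> \<le> fact N / c ^ N / s\<^sup>2"
      using s2 \<open>s\<^sup>2 \<ge> 1\<close> assms by (intro divide_left_mono mult_pos_pos) (auto intro: less_le_trans[of 0 "s\<^sup>2"])
    also have "\<dots> \<le> C / 2 / s\<^sup>2" using C(2) by (intro divide_right_mono) auto
    also have "\<dots> \<le> C * inverse (1 + s\<^sup>2)"
      using \<open>s\<^sup>2 \<ge> 1\<close> C(1) by (simp add: divide_simps)
    finally show ?thesis .
  qed
  have "integrable lborel (\<lambda>s::real. C * inverse (1 + s\<^sup>2))"
    using integrable_inverse_1_plus_square by (auto simp: set_integrable_def)
  then have "(\<integral>\<^sup>+s. ennreal (norm (C * inverse (1 + s\<^sup>2))) \<partial>lborel) < \<infinity>"
    by (auto simp only: integrable_iff_bounded)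
  moreover have "(\<integral>\<^sup>+s. ennreal (exp (- (c * \<bar>s\<bar> powr \<alpha>))) \<partial>lborel) \<le> (\<integral>\<^sup>+s. ennreal (norm (C * inverse (1 + s\<^sup>2))) \<partial>lborel)"
    by (intro nn_integral_mono ennreal_leI order_trans[OF bound]) simp
  ultimately show ?thesis by (rule le_less_trans[rotated])
qed

text \<open>
  Again half of the exponent is given away for integrability. The constant depends only on the
  envelope of \<open>g\<close>, as \<open>g\<close> changes with \<open>n\<close> in the application.
\<close>

lemma stretched_exponential_tail:
  fixes c \<alpha> G :: real
  assumes c: "0 < c" "0 < \<alpha>" "0 < G"
  shows "\<exists>C\<ge>0. \<forall>g t. 0 \<le> t \<longrightarrow> (\<forall>s. g s \<le> G * exp (- c * \<bar>s\<bar> powr \<alpha>)) \<longrightarrow>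
    (\<integral>\<^sup>+s. ennreal (g s) * indicator {s. t < \<bar>s\<bar>} s \<partial>lborel) \<le> ennreal (C * exp (- (c / 2 * t powr \<alpha>)))"
proof -
  let ?I = "\<integral>\<^sup>+s. ennreal (exp (- (c / 2 * \<bar>s\<bar> powr \<alpha>))) \<partial>lborel"
  have fin: "?I < \<infinity>" using stretched_exponential_integral_finite[of "c/2" \<alpha>] c by simp
  define I where "I = enn2real ?I"
  have I: "?I = ennreal I" "0 \<le> I" using fin by (auto simp: I_def)
  show ?thesis
  proof (intro exI[of _ "G * I"] conjI allI impI)
    fix g t assume t: "0 \<le> (t :: real)" and g: "\<forall>s. g s \<le> G * exp (- c * \<bar>s\<bar> powr \<alpha>)"
    have "(\<integral>\<^sup>+s. ennreal (g s) * indicator {s. t < \<bar>s\<bar>} s \<partial>lborel)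
      \<le> (\<integral>\<^sup>+s. ennreal (G * exp (- (c / 2 * t powr \<alpha>))) * ennreal (exp (- (c / 2 * \<bar>s\<bar> powr \<alpha>))) \<partial>lborel)"
    proof (intro nn_integral_mono)
      fix s :: real
      show "ennreal (g s) * indicator {s. t < \<bar>s\<bar>} s \<le> ennreal (G * exp (- (c / 2 * t powr \<alpha>))) * ennreal (exp (- (c / 2 * \<bar>s\<bar> powr \<alpha>)))"
      proof (cases "t < \<bar>s\<bar>")
        case True
        then have "t powr \<alpha> \<le> \<bar>s\<bar> powr \<alpha>" using t c by (intro powr_mono2) auto
        then have le: "c / 2 * t powr \<alpha> \<le> c / 2 * \<bar>s\<bar> powr \<alpha>" using c by simp
        have "g s \<le> G * exp (- c * \<bar>s\<bar> powr \<alpha>)" using g by blast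
        also have "\<dots> \<le> G * exp (- (c / 2 * t powr \<alpha>) + - (c / 2 * \<bar>s\<bar> powr \<alpha>))"
        proof -
          have "- c * \<bar>s\<bar> powr \<alpha> = - (c / 2 * \<bar>s\<bar> powr \<alpha>) + - (c / 2 * \<bar>s\<bar> powr \<alpha>)"
            by (simp add: field_simps)
          then have "- c * \<bar>s\<bar> powr \<alpha> \<le> - (c / 2 * t powr \<alpha>) + - (c / 2 * \<bar>s\<bar> powr \<alpha>)"
            using le by linarith
          then show ?thesis using c by simp
        qed
        finally have "g s \<le> G * exp (- (c / 2 * t powr \<alpha>)) * exp (- (c / 2 * \<bar>s\<bar> powr \<alpha>))"
          by (simp only: exp_add mult.assoc)
        then show ?thesis using True c by (simp add: ennreal_leI flip: ennreal_mult)
      qed simp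
    qed
    also have "\<dots> = ennreal (G * exp (- (c / 2 * t powr \<alpha>))) * ?I"
      by (rule nn_integral_cmult) measurable
    also have "\<dots> = ennreal (G * I * exp (- (c / 2 * t powr \<alpha>)))"
      using I c by (simp add: mult_ac flip: ennreal_mult)
    finally show "(\<integral>\<^sup>+s. ennreal (g s) * indicator {s. t < \<bar>s\<bar>} s \<partial>lborel) \<le> ennreal (G * I * exp (- (c / 2 * t powr \<alpha>)))" .
  qed (use c I in auto)
qed

section \<open>Likelihood ratios in Kullback-Leibler neighbourhoods\<close>

lemma log_ratio_measurable [measurable (raw)]:
  assumes [measurable]: "f \<in> borel_measurable M" "g \<in> borel_measurable M"
  shows "(\<lambda>x. log_ratio (f x) (g x)) \<in> borel_measurable M"
  unfolding log_ratio_def by measurable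

lemma abs_powr_measurable [measurable (raw)]:
  assumes [measurable]: "z \<in> borel_measurable M"
  shows "(\<lambda>x. abs_powr (z x) m) \<in> borel_measurable M"
  unfolding abs_powr_def by measurable

lemma abs_less_if_abs_powr_less:
  assumes "0 < t" "0 \<le> m" "abs_powr z m < ennreal (t powr m)"
  shows "\<bar>z\<bar> < ereal t"
proof (cases "\<bar>z\<bar> = \<infinity>")
  case True
  then show ?thesis using assms by (simp add: abs_powr_def)
next
  case False
  then obtain r where r: "z = ereal r" by auto
  then have "\<bar>r\<bar> powr m < t powr m"
    using assms by (simp add: abs_powr_def ennreal_less_iff)
  then have "\<bar>r\<bar> < t"
    using powr_mono2[of m t "\<bar>r\<bar>"] assms by (meson linorder_not_less less_imp_le)
  then show ?thesis by (simp add: r)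
qed

text \<open>
  Extended-valued differences involving an infinity are infinite, so finiteness of one centred
  log ratio makes both the log ratio and its centring finite.
\<close>

lemma ereal_minus_finite_bound:
  assumes "\<bar>z - k\<bar> < ereal t"
  shows "\<bar>z\<bar> \<noteq> \<infinity>" "\<bar>k\<bar> \<noteq> \<infinity>"
  using assms by (cases z; cases k; auto)+

text \<open>
  The deterministic half of the evidence bound: \<open>log (f0/f2)\<close> is the sum of two log ratios, each
  within \<open>t\<close> of its centring.
\<close>

lemma density_ratio_ge:
  assumes "0 < f0" "0 \<le> f1" "0 \<le> f2"
    and 1: "\<bar>log_ratio f0 f1 - k1\<bar> < ereal t" and 2: "\<bar>log_ratio f1 f2 - k2\<bar> < ereal t"
    and k: "k1 \<le> ereal c1" "k2 \<le> ereal c2"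
  shows "f0 * exp (- (c1 + c2 + 2 * t)) \<le> f2"
proof -
  have "0 < f1" using ereal_minus_finite_bound(1)[OF 1] assms by (auto simp: log_ratio_def split: if_splits)
  have "0 < f2" using ereal_minus_finite_bound(1)[OF 2] assms \<open>0 < f1\<close>
    by (auto simp: log_ratio_def split: if_splits)
  obtain r1 r2 where r: "k1 = ereal r1" "k2 = ereal r2"
    using ereal_minus_finite_bound(2)[OF 1] ereal_minus_finite_bound(2)[OF 2] by auto
  have "ln (f0 / f1) - r1 < t" "ln (f1 / f2) - r2 < t"
    using 1 2 assms \<open>0 < f1\<close> \<open>0 < f2\<close> by (auto simp: log_ratio_def r)
  then have "ln f0 - ln f2 \<le> c1 + c2 + 2 * t"
    using k assms \<open>0 < f1\<close> \<open>0 < f2\<close> by (simp add: r ln_div)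
  then have "ln f0 - (c1 + c2 + 2 * t) \<le> ln f2" by simp
  then have "exp (ln f0 - (c1 + c2 + 2 * t)) \<le> exp (ln f2)" by simp
  moreover have "exp (ln f0 - (c1 + c2 + 2 * t)) = f0 * exp (- (c1 + c2 + 2 * t))"
    using assms(1) by (simp only: diff_conv_add_uminus exp_add exp_ln)
  ultimately show ?thesis using \<open>0 < f2\<close> by simp
qed

lemma abs_powr_Markov:
  assumes "0 < t" "0 \<le> m" "\<not> \<bar>z\<bar> < ereal t"
  shows "1 \<le> abs_powr z m / ennreal (t powr m)"
proof -
  have "ennreal (t powr m) \<le> abs_powr z m"
    using abs_less_if_abs_powr_less[OF assms(1,2), of z] assms(3) by (meson linorder_not_less)
  then have "ennreal (t powr m) / ennreal (t powr m) \<le> abs_powr z m / ennreal (t powr m)"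
    by (rule divide_right_mono_ennreal)
  moreover have "ennreal (t powr m) / ennreal (t powr m) = 1"
    using assms(1) by (intro ennreal_divide_self) auto
  ultimately show ?thesis by simp
qed

text \<open>
  The integrals with a tilde are taken under \<open>p0\<close>, whereas the centring \<open>KL \<mu> f g\<close> of \<open>V_tilde\<close>
  is an expectation under \<open>f\<close>, on which the hypotheses say nothing directly. But the centring is a
  constant \<open>r\<close>, and \<open>\<bar>r\<bar> \<le> \<bar>l\<bar> + \<bar>l - r\<bar>\<close> can be integrated under \<open>p0\<close> for the log ratio \<open>l\<close>; the
  last term is controlled by its \<open>m\<close>-th moment.
\<close>

lemma KL_le_if_tilde_bounds:
  fixes \<mu> :: "'x measure"
  assumes [measurable]: "p0 \<in> borel_measurable \<mu>" "f \<in> borel_measurable \<mu>" "g \<in> borel_measurable \<mu>"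
    and prob: "(\<integral>\<^sup>+x. ennreal (p0 x) \<partial>\<mu>) = 1"
    and m: "2 \<le> m" and e: "1 \<le> e"
    and K: "KL_tilde \<mu> p0 f g \<le> ennreal e"
    and V: "V_tilde \<mu> p0 m f g \<le> ennreal (e powr (m / 2))"
  shows "KL \<mu> f g \<le> ereal (3 * e)"
proof -
  let ?k = "KL \<mu> f g" and ?l = "\<lambda>x. log_ratio (f x) (g x)"
  have fin: "\<bar>?k\<bar> \<noteq> \<infinity>"
  proof
    assume inf: "\<bar>?k\<bar> = \<infinity>"
    have "\<bar>?l x - ?k\<bar> = \<infinity>" for x
      using inf by (cases "?l x"; cases ?k) auto
    then have "V_tilde \<mu> p0 m f g = (\<integral>\<^sup>+x. ennreal (p0 x) * \<infinity> \<partial>\<mu>)"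
      by (simp add: V_tilde_def V_weighted_def abs_powr_def)
    also have "\<dots> = \<infinity>" by (subst nn_integral_multc) (simp_all add: prob)
    finally show False using V by (simp add: top_unique)
  qed
  then obtain r where r: "?k = ereal r" by auto
  \<comment> \<open>the natural size of the fluctuation, as the \<open>m\<close>-th moment is at most \<open>s\<^sup>m\<close>\<close>
  define s where "s = sqrt e"
  have s: "s > 0" "s \<le> e" "s powr m = e powr (m / 2)"
    using e by (auto simp: s_def powr_half_sqrt[symmetric] powr_powr real_sqrt_le_iff)
      (use e in \<open>auto simp: powr_half_sqrt intro!: real_le_lsqrt simp: power2_eq_square\<close>)
  \<comment> \<open>\<open>\<bar>l - r\<bar> \<le> s + \<bar>l - r\<bar>\<^sup>m / s\<^bsup>m - 1\<^esup>\<close>, whose expectation is at most \<open>2s\<close>\<close>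
  have ptw: "ennreal \<bar>r\<bar> \<le> e2ennreal \<bar>?l x\<bar> + (ennreal s + ennreal (s / s powr m) * abs_powr (?l x - ?k) m)" for x
  proof (cases "\<bar>?l x\<bar> = \<infinity>")
    case True
    then show ?thesis by simp
  next
    case False
    then obtain l where l: "?l x = ereal l" by auto
    have "\<bar>l - r\<bar> \<le> s + s / s powr m * \<bar>l - r\<bar> powr m"
    proof (cases "\<bar>l - r\<bar> \<le> s")
      case True
      then show ?thesis using s by (simp add: add_increasing2)
    next
      case False
      define y where "y = \<bar>l - r\<bar> / s"
      have y: "y \<ge> 1" "\<bar>l - r\<bar> = s * y" using False s by (auto simp: y_def)
      have "y powr 1 \<le> y powr m" using y m by (intro powr_mono) auto
      then have "s * y \<le> s * y powr m" using y s by simp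
      also have "\<dots> = s / s powr m * \<bar>l - r\<bar> powr m" using s y by (simp add: powr_mult)
      finally show ?thesis using y s by simp
    qed
    then have "\<bar>r\<bar> \<le> \<bar>l\<bar> + (s + s / s powr m * \<bar>l - r\<bar> powr m)" by linarith
    then have "ennreal \<bar>r\<bar> \<le> ennreal (\<bar>l\<bar> + (s + s / s powr m * \<bar>l - r\<bar> powr m))"
      by (rule ennreal_leI)
    also have "\<dots> = ennreal \<bar>l\<bar> + (ennreal s + ennreal (s / s powr m) * ennreal (\<bar>l - r\<bar> powr m))"
      using s by (simp flip: ennreal_mult)
    finally show ?thesis by (simp add: l r abs_powr_def)
  qed
  have "ennreal \<bar>r\<bar> = (\<integral>\<^sup>+x. ennreal (p0 x) * ennreal \<bar>r\<bar> \<partial>\<mu>)"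
    by (subst nn_integral_multc) (simp_all add: prob)
  also have "\<dots> \<le> (\<integral>\<^sup>+x. ennreal (p0 x) * (e2ennreal \<bar>?l x\<bar> + (ennreal s + ennreal (s / s powr m) * abs_powr (?l x - ?k) m)) \<partial>\<mu>)"
    by (intro nn_integral_mono mult_left_mono ptw) simp
  also have "\<dots> = (\<integral>\<^sup>+x. ennreal (p0 x) * e2ennreal \<bar>?l x\<bar> + (ennreal (p0 x) * ennreal s + ennreal (s / s powr m) * (ennreal (p0 x) * abs_powr (?l x - ?k) m)) \<partial>\<mu>)"
    by (intro nn_integral_cong) (simp add: distrib_left mult.left_commute)
  also have "\<dots> = KL_tilde \<mu> p0 f g + (ennreal s + ennreal (s / s powr m) * V_tilde \<mu> p0 m f g)"
    by (simp add: nn_integral_add nn_integral_cmult nn_integral_multc prob KL_tilde_def V_tilde_def V_weighted_def)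
  also have "\<dots> \<le> ennreal e + (ennreal s + ennreal (s / s powr m) * ennreal (e powr (m / 2)))"
    by (intro add_mono mult_left_mono K V) auto
  also have "\<dots> = ennreal (e + (s + s))"
    using s e by (simp add: ennreal_plus[symmetric] ennreal_mult[symmetric] del: ennreal_plus)
  finally have "\<bar>r\<bar> \<le> e + (s + s)" using s e by (subst (asm) ennreal_le_iff) auto
  then show ?thesis using s r by simp
qed

text \<open>
  The factor \<open>6\<close> is \<open>1\<close> for the centring of \<open>log (p0/f)\<close>, \<open>3\<close> for that of \<open>log (f/g)\<close>, and \<open>1\<close>
  for each of the two deviations.
\<close>

lemma density_drop_probability:
  fixes \<mu> :: "'x measure"
  assumes [measurable]: "p0 \<in> borel_measurable \<mu>" "f \<in> borel_measurable \<mu>" "g \<in> borel_measurable \<mu>"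
    and nonneg: "\<And>x. x \<in> space \<mu> \<Longrightarrow> 0 \<le> p0 x" "\<And>x. x \<in> space \<mu> \<Longrightarrow> 0 \<le> f x" "\<And>x. x \<in> space \<mu> \<Longrightarrow> 0 \<le> g x"
    and prob: "(\<integral>\<^sup>+x. ennreal (p0 x) \<partial>\<mu>) = 1"
    and m: "2 \<le> m" and e: "1 \<le> e"
    and K1: "KL \<mu> p0 f \<le> ereal e" and V1: "V \<mu> m p0 f \<le> ennreal (e powr (m / 2))"
    and K2: "KL_tilde \<mu> p0 f g \<le> ennreal e" and V2: "V_tilde \<mu> p0 m f g \<le> ennreal (e powr (m / 2))"
  shows "(\<integral>\<^sup>+x. ennreal (p0 x) * indicator {x. g x < p0 x * exp (- (6 * e))} x \<partial>\<mu>)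
    \<le> ennreal (2 * e powr (- m / 2))"
proof -
  let ?k1 = "KL \<mu> p0 f" and ?k2 = "KL \<mu> f g"
  let ?a1 = "\<lambda>x. abs_powr (log_ratio (p0 x) (f x) - ?k1) m / ennreal (e powr m)"
  let ?a2 = "\<lambda>x. abs_powr (log_ratio (f x) (g x) - ?k2) m / ennreal (e powr m)"
  have k2: "?k2 \<le> ereal (3 * e)"
    by (rule KL_le_if_tilde_bounds[OF _ _ _ prob m e K2 V2]) measurable
  have ptw: "ennreal (p0 x) * indicator {x. g x < p0 x * exp (- (6 * e))} x
      \<le> ennreal (p0 x) * (?a1 x + ?a2 x)" if x: "x \<in> space \<mu>" for x
  proof (cases "g x < p0 x * exp (- (6 * e))")
    case True
    then have "0 < p0 x" using nonneg[OF x]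
      by (metis less_eq_real_def linorder_not_less mult_zero_left)
    have "\<not> (\<bar>log_ratio (p0 x) (f x) - ?k1\<bar> < ereal e \<and> \<bar>log_ratio (f x) (g x) - ?k2\<bar> < ereal e)"
      using density_ratio_ge[OF \<open>0 < p0 x\<close> nonneg(2,3)[OF x], of ?k1 e ?k2 e "3 * e"] True K1 k2
      by (auto simp: algebra_simps)
    then have "1 \<le> ?a1 x \<or> 1 \<le> ?a2 x"
      using abs_powr_Markov[of e m] e m by auto
    then have "1 \<le> ?a1 x + ?a2 x"
      by (metis add_increasing add_increasing2 zero_le)
    then show ?thesis using mult_left_mono[of 1 "?a1 x + ?a2 x" "ennreal (p0 x)"] by (simp add: indicator_def)
  qed simp
  have "(\<integral>\<^sup>+x. ennreal (p0 x) * indicator {x. g x < p0 x * exp (- (6 * e))} x \<partial>\<mu>)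
      \<le> (\<integral>\<^sup>+x. ennreal (p0 x) * (?a1 x + ?a2 x) \<partial>\<mu>)"
    by (intro nn_integral_mono ptw)
  also have "\<dots> = (\<integral>\<^sup>+x. ennreal (p0 x) * abs_powr (log_ratio (p0 x) (f x) - ?k1) m / ennreal (e powr m)
     + ennreal (p0 x) * abs_powr (log_ratio (f x) (g x) - ?k2) m / ennreal (e powr m) \<partial>\<mu>)"
    by (intro nn_integral_cong) (simp add: distrib_left ennreal_times_divide)
  also have "\<dots> = V \<mu> m p0 f / ennreal (e powr m) + V_tilde \<mu> p0 m f g / ennreal (e powr m)"
    by (simp add: nn_integral_add nn_integral_divide V_def V_tilde_def V_weighted_def)
  also have "\<dots> \<le> ennreal (e powr (m / 2)) / ennreal (e powr m) + ennreal (e powr (m / 2)) / ennreal (e powr m)"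
    by (intro add_mono divide_right_mono_ennreal V1 V2)
  also have "\<dots> = ennreal (2 * (e powr (m / 2) / e powr m))"
    using e by (simp add: divide_ennreal ennreal_plus[symmetric] del: ennreal_plus)
  also have "e powr (m / 2) / e powr m = e powr (- m / 2)"
    using e by (simp add: powr_diff[symmetric])
  finally show ?thesis .
qed

section \<open>Expected posterior mass at a fixed sample size\<close>

lemma probability_density_integral:
  assumes [measurable]: "f \<in> borel_measurable \<mu>" and "prob_space (sample_law \<mu> f)"
  shows "(\<integral>\<^sup>+x. ennreal (f x) \<partial>\<mu>) = 1"
proof -
  interpret prob_space "sample_law \<mu> f" by fact
  show ?thesis using emeasure_space_1
    by (simp add: sample_law_def emeasure_density cong: nn_integral_cong)
qed

lemma expectation_sample_law:
  assumes [measurable]: "f \<in> borel_measurable \<mu>" "h \<in> borel_measurable \<mu>"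
    and prob: "prob_space (sample_law \<mu> f)"
    and h: "\<And>x. x \<in> space \<mu> \<Longrightarrow> 0 \<le> h x \<and> h x \<le> (1 :: real)"
  shows "(\<integral>\<^sup>+x. ennreal (f x) * ennreal (h x) \<partial>\<mu>) = ennreal (LINT x|sample_law \<mu> f. h x)"
proof -
  interpret prob_space "sample_law \<mu> f" by fact
  have [measurable]: "h \<in> borel_measurable (sample_law \<mu> f)" by (simp add: sample_law_def)
  have int: "integrable (sample_law \<mu> f) h"
    by (rule integrable_const_bound[where B = 1]) (use h in \<open>auto simp: sample_law_def intro!: AE_I2\<close>)
  have "(\<integral>\<^sup>+x. ennreal (f x) * ennreal (h x) \<partial>\<mu>) = (\<integral>\<^sup>+x. ennreal (h x) \<partial>sample_law \<mu> f)"
    unfolding sample_law_def by (subst nn_integral_density) auto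
  also have "\<dots> = ennreal (LINT x|sample_law \<mu> f. h x)"
    by (rule nn_integral_eq_integral[OF int]) (use h in \<open>auto simp: sample_law_def intro!: AE_I2\<close>)
  finally show ?thesis .
qed

lemma posterior_bounds: "0 \<le> posterior Q p B x" "posterior Q p B x \<le> 1"
proof -
  let ?N = "\<integral>\<^sup>+\<theta>\<in>B. ennreal (p \<theta> x) \<partial>Q" and ?D = "\<integral>\<^sup>+\<theta>. ennreal (p \<theta> x) \<partial>Q"
  have le: "?N \<le> ?D" by (intro nn_integral_mono) (auto simp: indicator_def)
  have "?N / ?D \<le> 1"
  proof (cases "?D = 0 \<or> ?D = \<infinity>")
    case True
    then show ?thesis using le by (auto simp: divide_ennreal_def)
  next
    case False
    then show ?thesis using le
      by (metis divide_le_posI_ennreal mult.right_neutral zero_less_iff_neq_zero)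
  qed
  then show "posterior Q p B x \<le> 1"
    unfolding posterior_def using enn2real_leI[of 1 "?N / ?D"] by simp
qed (simp add: posterior_def)

text \<open>
  Multiplied by the true density, the posterior becomes its numerator as soon as the evidence is
  not much smaller than that density.
\<close>

lemma posterior_times_density_le:
  assumes D: "ennreal (f * exp (- A)) \<le> (\<integral>\<^sup>+\<theta>. ennreal (p \<theta> x) \<partial>Q)" and f: "0 \<le> f"
  shows "ennreal f * ennreal (posterior Q p B x)
    \<le> ennreal (exp A) * (\<integral>\<^sup>+\<theta>\<in>B. ennreal (p \<theta> x) \<partial>Q)"
proof -
  let ?N = "\<integral>\<^sup>+\<theta>\<in>B. ennreal (p \<theta> x) \<partial>Q" and ?D = "\<integral>\<^sup>+\<theta>. ennreal (p \<theta> x) \<partial>Q"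
  have "ennreal (posterior Q p B x) \<le> ?N / ?D"
    unfolding posterior_def by (simp add: ennreal_enn2real_if)
  have le: "?N \<le> ?D" by (intro nn_integral_mono) (auto simp: indicator_def)
  have "ennreal f = ennreal (exp A) * ennreal (f * exp (- A))"
    using f by (simp add: exp_minus field_simps flip: ennreal_mult)
  also have "\<dots> \<le> ennreal (exp A) * ?D" by (intro mult_left_mono D) simp
  finally have "ennreal f * ennreal (posterior Q p B x) \<le> (ennreal (exp A) * ?D) * (?N / ?D)"
    by (intro mult_mono) (use \<open>ennreal (posterior Q p B x) \<le> ?N / ?D\<close> in auto)
  also have "\<dots> = ennreal (exp A) * (?D * (?N / ?D))" by (simp add: mult.assoc)
  also have "?D * (?N / ?D) \<le> ?N"
  proof (cases "?D = 0 \<or> ?D = \<infinity>")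
    case True
    then show ?thesis using le by (auto simp: divide_ennreal_def)
  next
    case False
    then show ?thesis
      by (simp add: ennreal_times_divide mult.commute[of ?D] mult_divide_eq_ennreal)
  qed
  finally show ?thesis by (simp add: mult_left_mono)
qed

text \<open>
  If the \<open>\<nu>\<close>-mass of the indices that are bad at \<open>x\<close> is at most half of the total mass, the good
  ones contribute half of the total mass times \<open>exp (-c) p0 x\<close> to the mixture. By Fubini the
  expected bad mass is at most \<open>\<beta>\<close> times the total mass, and Markov's inequality costs the factor
  \<open>2\<close>.
\<close>

lemma evidence_lower_bound:
  fixes f :: "'u \<Rightarrow> 'x \<Rightarrow> real"
  assumes \<nu>: "finite_measure \<nu>" and \<mu>: "sigma_finite_measure \<mu>"
    and f_meas: "(\<lambda>(u, x). f u x) \<in> borel_measurable (\<nu> \<Otimes>\<^sub>M \<mu>)"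
    and p0_meas [measurable]: "p0 \<in> borel_measurable \<mu>"
    and nonneg: "\<And>x. x \<in> space \<mu> \<Longrightarrow> 0 \<le> p0 x"
    and w: "0 < w" "ennreal w \<le> emeasure \<nu> (space \<nu>)"
    and bad: "\<And>u. u \<in> space \<nu> \<Longrightarrow>
      (\<integral>\<^sup>+x. ennreal (p0 x) * indicator {x. f u x < p0 x * exp (- c)} x \<partial>\<mu>) \<le> ennreal \<beta>"
  shows "(\<integral>\<^sup>+x. ennreal (p0 x)
            * indicator {x. (\<integral>\<^sup>+u. ennreal (f u x) \<partial>\<nu>) < ennreal (p0 x * (exp (- c) * (w / 2)))} x \<partial>\<mu>)
    \<le> 2 * ennreal \<beta>"
proof -
  let ?F = "\<lambda>x. \<integral>\<^sup>+u. ennreal (f u x) \<partial>\<nu>"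
  interpret \<nu>: finite_measure \<nu> by fact
  interpret \<mu>: sigma_finite_measure \<mu> by fact
  interpret pair_sigma_finite \<nu> \<mu> ..
  have [measurable]: "(\<lambda>z. f (fst z) (snd z)) \<in> borel_measurable (\<nu> \<Otimes>\<^sub>M \<mu>)"
    using f_meas by (simp add: case_prod_unfold)
  have f_x [measurable]: "(\<lambda>u. f u x) \<in> borel_measurable \<nu>" if "x \<in> space \<mu>" for x
    using measurable_compose[OF measurable_Pair2'[OF that] f_meas] by simp
  define v where "v = measure \<nu> (space \<nu>)"
  have v: "emeasure \<nu> (space \<nu>) = ennreal v" "w \<le> v" "0 < v"
    using w by (auto simp: v_def \<nu>.emeasure_eq_measure)
  define I where "I u x = (if f u x < p0 x * exp (- c) then ennreal (p0 x) else 0)" for u x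
  have I_meas [measurable]: "(\<lambda>z. I (fst z) (snd z)) \<in> borel_measurable (\<nu> \<Otimes>\<^sub>M \<mu>)"
    unfolding I_def by measurable
  have [measurable]: "(\<lambda>z. I (snd z) (fst z)) \<in> borel_measurable (\<mu> \<Otimes>\<^sub>M \<nu>)"
    using measurable_compose[OF measurable_pair_swap' I_meas] by (simp add: case_prod_unfold)
  have ptw: "ennreal (p0 x)
            * indicator {x. ?F x < ennreal (p0 x * (exp (- c) * (w / 2)))} x
    \<le> ennreal (2 / v) * (\<integral>\<^sup>+u. I u x \<partial>\<nu>)" if x: "x \<in> space \<mu>" for x
  proof (cases "?F x < ennreal (p0 x * (exp (- c) * (w / 2)))")
    case True
    note [measurable] = f_x[OF x]
    define G where "G = {u \<in> space \<nu>. \<not> f u x < p0 x * exp (- c)}"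
    define H where "H = {u \<in> space \<nu>. f u x < p0 x * exp (- c)}"
    have [measurable]: "G \<in> sets \<nu>" "H \<in> sets \<nu>" by (auto simp: G_def H_def)
    have "p0 x > 0"
    proof (rule ccontr)
      assume "\<not> p0 x > 0"
      then have "p0 x = 0" using nonneg[OF x] by simp
      then show False using True by simp
    qed
    have "v = measure \<nu> (G \<union> H)" unfolding v_def by (rule arg_cong[where f = "measure \<nu>"]) (auto simp: G_def H_def)
    also have "\<dots> = measure \<nu> G + measure \<nu> H"
      by (rule \<nu>.finite_measure_Union) (auto simp: G_def H_def)
    finally have v_GH: "v = measure \<nu> G + measure \<nu> H" .
    have "ennreal (p0 x * exp (- c)) * emeasure \<nu> G
        = (\<integral>\<^sup>+u. ennreal (p0 x * exp (- c)) * indicator G u \<partial>\<nu>)"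
      by (simp add: nn_integral_cmult_indicator)
    also have "\<dots> \<le> ?F x"
      by (intro nn_integral_mono) (auto simp: G_def indicator_def intro!: ennreal_leI)
    also have "\<dots> < ennreal (p0 x * (exp (- c) * (w / 2)))" by fact
    finally have "p0 x * exp (- c) * measure \<nu> G < p0 x * exp (- c) * (w / 2)"
      using \<open>p0 x > 0\<close> by (simp add: \<nu>.emeasure_eq_measure ennreal_less_iff mult.assoc flip: ennreal_mult)
    then have "measure \<nu> G < w / 2" using \<open>p0 x > 0\<close> by (simp add: zero_less_mult_iff)
    then have "measure \<nu> H \<ge> v / 2" using v_GH v by simp
    then have "p0 x \<le> 2 / v * (p0 x * measure \<nu> H)" using v \<open>p0 x > 0\<close> by (simp add: field_simps)
    then have "ennreal (p0 x) \<le> ennreal (2 / v) * (ennreal (p0 x) * emeasure \<nu> H)"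
      using \<open>p0 x > 0\<close> v by (simp add: \<nu>.emeasure_eq_measure flip: ennreal_mult)
    also have "ennreal (p0 x) * emeasure \<nu> H = (\<integral>\<^sup>+u. ennreal (p0 x) * indicator H u \<partial>\<nu>)"
      by (simp add: nn_integral_cmult_indicator)
    also have "\<dots> = (\<integral>\<^sup>+u. I u x \<partial>\<nu>)"
      by (intro nn_integral_cong) (auto simp: I_def H_def)
    finally show ?thesis using True by simp
  qed simp
  have "(\<integral>\<^sup>+x. ennreal (p0 x)
            * indicator {x. ?F x < ennreal (p0 x * (exp (- c) * (w / 2)))} x \<partial>\<mu>)
      \<le> (\<integral>\<^sup>+x. ennreal (2 / v) * (\<integral>\<^sup>+u. I u x \<partial>\<nu>) \<partial>\<mu>)"
    by (intro nn_integral_mono ptw)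
  also have "\<dots> = ennreal (2 / v) * (\<integral>\<^sup>+x. (\<integral>\<^sup>+u. I u x \<partial>\<nu>) \<partial>\<mu>)"
    by (rule nn_integral_cmult) measurable
  also have "(\<integral>\<^sup>+x. (\<integral>\<^sup>+u. I u x \<partial>\<nu>) \<partial>\<mu>) = (\<integral>\<^sup>+u. (\<integral>\<^sup>+x. I u x \<partial>\<mu>) \<partial>\<nu>)"
    by (rule Fubini') (simp add: case_prod_unfold)
  also have "\<dots> \<le> (\<integral>\<^sup>+u. ennreal \<beta> \<partial>\<nu>)"
  proof (intro nn_integral_mono)
    fix u assume "u \<in> space \<nu>"
    have "(\<integral>\<^sup>+x. I u x \<partial>\<mu>) = (\<integral>\<^sup>+x. ennreal (p0 x) * indicator {x. f u x < p0 x * exp (- c)} x \<partial>\<mu>)"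
      by (intro nn_integral_cong) (auto simp: I_def)
    then show "(\<integral>\<^sup>+x. I u x \<partial>\<mu>) \<le> ennreal \<beta>" using bad[OF \<open>u \<in> space \<nu>\<close>] by simp
  qed
  also have "\<dots> = ennreal \<beta> * ennreal v" by (simp add: v)
  also have "ennreal (2 / v) * (ennreal \<beta> * ennreal v) = (ennreal (2 / v) * ennreal v) * ennreal \<beta>"
    by (simp add: mult_ac)
  also have "ennreal (2 / v) * ennreal v = 2"
    using v by (simp flip: ennreal_mult)
  finally show ?thesis by (simp add: mult_left_mono)
qed

text \<open>
  The basic inequality of the testing argument. The posterior is at most \<open>1\<close>, which settles its
  part weighted by \<open>\<psi>\<close> and the event of small evidence. In the part weighted by \<open>1 - \<psi>\<close> it is
  replaced by its numerator, whose integral is computed by Fubini.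
\<close>

lemma posterior_expectation_le:
  assumes Q: "finite_measure Q" and \<mu>: "sigma_finite_measure \<mu>"
    and p_meas: "(\<lambda>(\<theta>, x). p \<theta> x) \<in> borel_measurable (Q \<Otimes>\<^sub>M \<mu>)"
    and p0_meas [measurable]: "p0 \<in> borel_measurable \<mu>" and B [measurable]: "B \<in> sets Q"
    and nonneg: "\<And>x. x \<in> space \<mu> \<Longrightarrow> 0 \<le> p0 x"
    and \<phi> [measurable]: "\<phi> \<in> borel_measurable \<mu>" "\<And>x. x \<in> space \<mu> \<Longrightarrow> 0 \<le> \<phi> x \<and> \<phi> x \<le> 1"
  shows "(\<integral>\<^sup>+x. ennreal (p0 x) * ennreal (posterior Q p B x) \<partial>\<mu>)
    \<le> (\<integral>\<^sup>+x. ennreal (p0 x) * ennreal (\<phi> x) \<partial>\<mu>)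
      + (\<integral>\<^sup>+x. ennreal (p0 x) * indicator {x. (\<integral>\<^sup>+\<theta>. ennreal (p \<theta> x) \<partial>Q) < ennreal (p0 x * exp (- A))} x \<partial>\<mu>)
      + ennreal (exp A) * (\<integral>\<^sup>+\<theta>\<in>B. (\<integral>\<^sup>+x. ennreal (p \<theta> x) * ennreal (1 - \<phi> x) \<partial>\<mu>) \<partial>Q)"
proof -
  let ?D = "\<lambda>x. \<integral>\<^sup>+\<theta>. ennreal (p \<theta> x) \<partial>Q"
  interpret Q: finite_measure Q by fact
  interpret \<mu>: sigma_finite_measure \<mu> by fact
  interpret pair_sigma_finite Q \<mu> ..
  have p_meas' [measurable]: "(\<lambda>z. p (fst z) (snd z)) \<in> borel_measurable (Q \<Otimes>\<^sub>M \<mu>)"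
    using p_meas by (simp add: case_prod_unfold)
  have [measurable]: "(\<lambda>z. p (snd z) (fst z)) \<in> borel_measurable (\<mu> \<Otimes>\<^sub>M Q)"
    using measurable_compose[OF measurable_pair_swap' p_meas'] by (simp add: case_prod_unfold)
  define E where "E x = (if ?D x < ennreal (p0 x * exp (- A)) then ennreal (p0 x) else 0)" for x
  have E_meas [measurable]: "E \<in> borel_measurable \<mu>" unfolding E_def by measurable
  define N where "N x = (\<integral>\<^sup>+\<theta>. ennreal (p \<theta> x) * indicator B \<theta> * ennreal (1 - \<phi> x) \<partial>Q)" for x
  have N_meas [measurable]: "N \<in> borel_measurable \<mu>" unfolding N_def by measurable
  have p_x: "(\<lambda>\<theta>. p \<theta> x) \<in> borel_measurable Q" if "x \<in> space \<mu>" for x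
    using measurable_compose[OF measurable_Pair2'[OF that] p_meas] by simp
  have p_\<theta>: "p \<theta> \<in> borel_measurable \<mu>" if "\<theta> \<in> space Q" for \<theta>
    using measurable_compose[OF measurable_Pair1'[OF that] p_meas] by simp
  have ptw: "ennreal (p0 x) * ennreal (posterior Q p B x)
      \<le> ennreal (p0 x) * ennreal (\<phi> x) + E x + ennreal (exp A) * N x" if x: "x \<in> space \<mu>" for x
  proof (cases "?D x < ennreal (p0 x * exp (- A))")
    case True
    have "ennreal (p0 x) * ennreal (posterior Q p B x) \<le> ennreal (p0 x) * 1"
      by (intro mult_left_mono) (use posterior_bounds[of Q p B x] in auto)
    also have "\<dots> = E x" using True by (simp add: E_def)
    finally show ?thesis by (simp add: add_increasing add_increasing2)
  next
    case False
    note [measurable] = p_x[OF x]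
    let ?post = "posterior Q p B x"
    have "ennreal (p0 x) * ennreal ?post = ennreal (p0 x * ?post * \<phi> x + p0 x * ?post * (1 - \<phi> x))"
      using nonneg[OF x] posterior_bounds[of Q p B x] by (simp add: algebra_simps flip: ennreal_mult)
    also have "\<dots> = ennreal (p0 x * \<phi> x * ?post) + ennreal (1 - \<phi> x) * (ennreal (p0 x) * ennreal ?post)"
      using nonneg[OF x] posterior_bounds[of Q p B x] \<phi>(2)[OF x]
      by (simp add: ennreal_plus mult_ac flip: ennreal_mult)
    also have "\<dots> \<le> ennreal (p0 x * \<phi> x) + ennreal (1 - \<phi> x) * (ennreal (exp A) * (\<integral>\<^sup>+\<theta>\<in>B. ennreal (p \<theta> x) \<partial>Q))"
      using nonneg[OF x] posterior_bounds[of Q p B x] \<phi>(2)[OF x] False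
      by (intro add_mono mult_left_mono posterior_times_density_le ennreal_leI mult_left_le) auto
    also have "ennreal (1 - \<phi> x) * (ennreal (exp A) * (\<integral>\<^sup>+\<theta>\<in>B. ennreal (p \<theta> x) \<partial>Q)) = ennreal (exp A) * N x"
      unfolding N_def by (subst nn_integral_multc) (auto simp: mult_ac)
    also have "ennreal (p0 x * \<phi> x) = ennreal (p0 x) * ennreal (\<phi> x)"
      using nonneg[OF x] \<phi>(2)[OF x] by (simp add: ennreal_mult)
    finally show ?thesis by (simp add: E_def False)
  qed
  have "(\<integral>\<^sup>+x. ennreal (p0 x) * ennreal (posterior Q p B x) \<partial>\<mu>)
      \<le> (\<integral>\<^sup>+x. ennreal (p0 x) * ennreal (\<phi> x) + E x + ennreal (exp A) * N x \<partial>\<mu>)"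
    by (intro nn_integral_mono ptw)
  also have "\<dots> = (\<integral>\<^sup>+x. ennreal (p0 x) * ennreal (\<phi> x) \<partial>\<mu>) + (\<integral>\<^sup>+x. E x \<partial>\<mu>) + ennreal (exp A) * (\<integral>\<^sup>+x. N x \<partial>\<mu>)"
    by (simp add: nn_integral_add nn_integral_cmult)
  also have "(\<integral>\<^sup>+x. N x \<partial>\<mu>) = (\<integral>\<^sup>+\<theta>. (\<integral>\<^sup>+x. ennreal (p \<theta> x) * indicator B \<theta> * ennreal (1 - \<phi> x) \<partial>\<mu>) \<partial>Q)"
    unfolding N_def by (rule Fubini') (simp add: case_prod_unfold)
  also have "\<dots> = (\<integral>\<^sup>+\<theta>\<in>B. (\<integral>\<^sup>+x. ennreal (p \<theta> x) * ennreal (1 - \<phi> x) \<partial>\<mu>) \<partial>Q)"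
  proof (intro nn_integral_cong)
    fix \<theta> assume "\<theta> \<in> space Q"
    note [measurable] = p_\<theta>[OF this]
    show "(\<integral>\<^sup>+x. ennreal (p \<theta> x) * indicator B \<theta> * ennreal (1 - \<phi> x) \<partial>\<mu>)
        = (\<integral>\<^sup>+x. ennreal (p \<theta> x) * ennreal (1 - \<phi> x) \<partial>\<mu>) * indicator B \<theta>"
      by (subst nn_integral_multc[symmetric]) (auto intro!: nn_integral_cong simp: mult_ac)
  qed
  also have "(\<integral>\<^sup>+x. E x \<partial>\<mu>) = (\<integral>\<^sup>+x. ennreal (p0 x) * indicator {x. ?D x < ennreal (p0 x * exp (- A))} x \<partial>\<mu>)"
    by (intro nn_integral_cong) (auto simp: E_def)
  finally show ?thesis .
qed

section \<open>Tests for a region of the sieve\<close>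

lemma norm2_le_sum: "norm2 k u \<le> (\<Sum>j<k. \<bar>u j\<bar>)"
  unfolding norm2_def by (rule L2_set_le_sum_abs)

text \<open>
  One representative is taken inside \<open>S\<close> from every cell of a cubic grid of mesh \<open>h\<close> that meets
  \<open>S\<close>. Centres inside \<open>S\<close> matter: the tests are available with a good error only at points that
  are themselves far from the truth.
\<close>

lemma grid_cover:
  fixes S :: "(nat \<Rightarrow> real) set"
  assumes S: "\<And>\<theta> j. \<theta> \<in> S \<Longrightarrow> j < k \<Longrightarrow> \<bar>\<theta> j\<bar> \<le> real N * h" and h: "0 < h"
  obtains F where "finite F" "F \<subseteq> S" "card F \<le> (2 * N + 1) ^ k"
    "\<And>\<theta>. \<theta> \<in> S \<Longrightarrow> \<exists>\<theta>1\<in>F. \<forall>j<k. \<bar>\<theta> j - \<theta>1 j\<bar> \<le> h"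
proof -
  define cell where "cell \<theta> = (\<lambda>j\<in>{..<k}. \<lfloor>\<theta> j / h\<rfloor>)" for \<theta> :: "nat \<Rightarrow> real"
  let ?C = "PiE {..<k} (\<lambda>_. {- int N..int N})"
  have sub: "cell ` S \<subseteq> ?C"
  proof
    fix c assume "c \<in> cell ` S"
    then obtain \<theta> where \<theta>: "\<theta> \<in> S" "c = cell \<theta>" by auto
    have "- int N \<le> \<lfloor>\<theta> j / h\<rfloor> \<and> \<lfloor>\<theta> j / h\<rfloor> \<le> int N" if "j < k" for j
    proof -
      have "\<theta> j \<le> real N * h" "- (real N * h) \<le> \<theta> j" using S[OF \<theta>(1) that] by auto
      then have "- real N \<le> \<theta> j / h" "\<theta> j / h \<le> real N"
        using h by (simp_all add: divide_le_eq le_divide_eq)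
      then show ?thesis by linarith
    qed
    then show "c \<in> ?C" by (auto simp: \<theta> cell_def)
  qed
  have fin: "finite ?C" by (intro finite_PiE) auto
  have card: "card ?C = (2 * N + 1) ^ k"
    by (subst card_PiE) (auto simp: nat_add_distrib nat_mult_distrib)
  define F where "F = inv_into S cell ` (cell ` S)"
  show ?thesis
  proof
    show "finite F" unfolding F_def using finite_subset[OF sub fin] by blast
    show "F \<subseteq> S" unfolding F_def using inv_into_into[of _ cell S] by blast
    have "card F \<le> card (cell ` S)"
      unfolding F_def by (rule card_image_le) (use finite_subset[OF sub fin] in blast)
    also have "\<dots> \<le> card ?C" by (rule card_mono[OF fin sub])
    finally show "card F \<le> (2 * N + 1) ^ k" by (simp only: card)
    fix \<theta> assume "\<theta> \<in> S"
    let ?\<theta>1 = "inv_into S cell (cell \<theta>)"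
    have "cell ?\<theta>1 = cell \<theta>" by (rule f_inv_into_f[of "cell \<theta>" cell S]) (use \<open>\<theta> \<in> S\<close> in blast)
    have "\<bar>\<theta> j - ?\<theta>1 j\<bar> \<le> h" if "j < k" for j
    proof -
      have "\<lfloor>?\<theta>1 j / h\<rfloor> = \<lfloor>\<theta> j / h\<rfloor>"
        using fun_cong[OF \<open>cell ?\<theta>1 = cell \<theta>\<close>, of j] that by (simp add: cell_def)
      then have "\<bar>\<theta> j / h - ?\<theta>1 j / h\<bar> \<le> 1" by linarith
      then have "\<bar>(\<theta> j - ?\<theta>1 j) / h\<bar> \<le> 1" by (simp add: diff_divide_distrib)
      then show ?thesis using h by (simp add: abs_divide)
    qed
    then show "\<exists>\<theta>1\<in>F. \<forall>j<k. \<bar>\<theta> j - \<theta>1 j\<bar> \<le> h"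
      using \<open>\<theta> \<in> S\<close> by (intro bexI[of _ ?\<theta>1]) (auto simp: F_def)
  qed
qed

text \<open>
  The test \<open>min 1 (\<Sum>i\<in>F. \<phi> i)\<close> is at most the sum, which bounds the first error, and at least
  each single \<open>\<phi> i\<close>, which bounds the second.
\<close>

lemma combine_tests:
  fixes \<mu> :: "'x measure" and p :: "'t \<Rightarrow> 'x \<Rightarrow> real"
  assumes F: "finite F"
    and p0 [measurable]: "p0 \<in> borel_measurable \<mu>"
    and test: "\<And>i. i \<in> F \<Longrightarrow> \<phi> i \<in> borel_measurable \<mu> \<and> (\<forall>x\<in>space \<mu>. 0 \<le> \<phi> i x \<and> \<phi> i x \<le> (1 :: real))
        \<and> (\<integral>\<^sup>+x. ennreal (p0 x) * ennreal (\<phi> i x) \<partial>\<mu>) \<le> ennreal \<beta>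
        \<and> (\<forall>\<theta>\<in>R i. (\<integral>\<^sup>+x. ennreal (p \<theta> x) * ennreal (1 - \<phi> i x) \<partial>\<mu>) \<le> ennreal \<beta>)"
  obtains \<psi> where "\<psi> \<in> borel_measurable \<mu>" "\<And>x. x \<in> space \<mu> \<Longrightarrow> 0 \<le> \<psi> x \<and> \<psi> x \<le> (1 :: real)"
    "(\<integral>\<^sup>+x. ennreal (p0 x) * ennreal (\<psi> x) \<partial>\<mu>) \<le> of_nat (card F) * ennreal \<beta>"
    "\<And>\<theta>. \<theta> \<in> (\<Union>i\<in>F. R i) \<Longrightarrow> (\<integral>\<^sup>+x. ennreal (p \<theta> x) * ennreal (1 - \<psi> x) \<partial>\<mu>) \<le> ennreal \<beta>"
proof -
  define \<psi> where "\<psi> x = min 1 (\<Sum>i\<in>F. \<phi> i x)" for x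
  have [measurable]: "\<phi> i \<in> borel_measurable \<mu>" if "i \<in> F" for i using test[OF that] by blast
  show ?thesis
  proof
    show "\<psi> \<in> borel_measurable \<mu>" unfolding \<psi>_def by measurable
    show "0 \<le> \<psi> x \<and> \<psi> x \<le> 1" if "x \<in> space \<mu>" for x
      using test that by (auto simp: \<psi>_def intro!: sum_nonneg)
    have "(\<integral>\<^sup>+x. ennreal (p0 x) * ennreal (\<psi> x) \<partial>\<mu>) \<le> (\<integral>\<^sup>+x. (\<Sum>i\<in>F. ennreal (p0 x) * ennreal (\<phi> i x)) \<partial>\<mu>)"
    proof (intro nn_integral_mono)
      fix x assume x: "x \<in> space \<mu>"
      have "ennreal (\<psi> x) \<le> ennreal (\<Sum>i\<in>F. \<phi> i x)" by (intro ennreal_leI) (simp add: \<psi>_def)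
      also have "\<dots> = (\<Sum>i\<in>F. ennreal (\<phi> i x))" using test x by (subst sum_ennreal) auto
      finally have "ennreal (p0 x) * ennreal (\<psi> x) \<le> ennreal (p0 x) * (\<Sum>i\<in>F. ennreal (\<phi> i x))"
        by (rule mult_left_mono) simp
      then show "ennreal (p0 x) * ennreal (\<psi> x) \<le> (\<Sum>i\<in>F. ennreal (p0 x) * ennreal (\<phi> i x))"
        by (simp add: sum_distrib_left)
    qed
    also have "\<dots> = (\<Sum>i\<in>F. \<integral>\<^sup>+x. ennreal (p0 x) * ennreal (\<phi> i x) \<partial>\<mu>)"
      by (rule nn_integral_sum) measurable
    also have "\<dots> \<le> (\<Sum>i\<in>F. ennreal \<beta>)" by (intro sum_mono) (use test in blast)
    finally show "(\<integral>\<^sup>+x. ennreal (p0 x) * ennreal (\<psi> x) \<partial>\<mu>) \<le> of_nat (card F) * ennreal \<beta>" by simp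
    fix \<theta> assume "\<theta> \<in> (\<Union>i\<in>F. R i)"
    then obtain i where i: "i \<in> F" "\<theta> \<in> R i" by blast
    have "(\<integral>\<^sup>+x. ennreal (p \<theta> x) * ennreal (1 - \<psi> x) \<partial>\<mu>) \<le> (\<integral>\<^sup>+x. ennreal (p \<theta> x) * ennreal (1 - \<phi> i x) \<partial>\<mu>)"
    proof (intro nn_integral_mono mult_left_mono ennreal_leI)
      fix x assume x: "x \<in> space \<mu>"
      have "\<phi> i x \<le> (\<Sum>i\<in>F. \<phi> i x)" by (rule member_le_sum) (use i F test x in auto)
      moreover have "\<phi> i x \<le> 1" using test[OF i(1)] x by blast
      ultimately show "1 - \<psi> x \<le> 1 - \<phi> i x" by (simp add: \<psi>_def)
    qed simp
    also have "\<dots> \<le> ennreal \<beta>" using test i by blast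
    finally show "(\<integral>\<^sup>+x. ennreal (p \<theta> x) * ennreal (1 - \<psi> x) \<partial>\<mu>) \<le> ennreal \<beta>" .
  qed
qed

lemma abs_coord_le_norm2: "j < k \<Longrightarrow> \<bar>\<theta> j\<bar> \<le> norm2 k \<theta>"
proof -
  assume "j < k"
  then have "\<bar>\<theta> j\<bar> \<le> L2_set (\<lambda>i. \<bar>\<theta> i\<bar>) {..<k}"
    by (intro member_le_L2_set) auto
  also have "\<dots> = norm2 k \<theta>" by (simp add: norm2_def L2_set_def)
  finally show ?thesis .
qed

text \<open>
  A mesh for which neighbouring points are closer than \<open>\<zeta> R\<close> in \<open>d\<close> puts every point of the
  region \<open>R \<le> d \<theta> \<theta>0\<close> into the range of the test at its representative, since the representative
  is itself at distance at least \<open>R\<close> from \<open>\<theta>0\<close>.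
\<close>

lemma sieve_test:
  fixes \<mu> :: "'x measure" and p :: "(nat \<Rightarrow> real) \<Rightarrow> 'x \<Rightarrow> real"
  assumes semi: "semimetric_on \<Theta> d" and \<theta>0: "\<theta>0 \<in> \<Theta>" and sub: "sieve k \<subseteq> \<Theta>"
    and p_meas: "\<And>\<theta>. \<theta> \<in> \<Theta> \<Longrightarrow> p \<theta> \<in> borel_measurable \<mu>"
    and prob: "\<And>\<theta>. \<theta> \<in> \<Theta> \<Longrightarrow> prob_space (sample_law \<mu> (p \<theta>))"
    and D: "0 \<le> D0" "0 < D2"
    and A3: "\<forall>\<theta>\<in>bounded_sieve n k Q. \<forall>\<theta>'\<in>bounded_sieve n k Q.
        d \<theta> \<theta>' \<le> D0 * real k powr D1 * norm2 k (\<lambda>j. \<theta> j - \<theta>' j) powr D2"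
    and c1: "0 < c1" "0 < \<zeta>"
    and A4: "\<forall>\<theta>1\<in>bounded_sieve n k Q. \<exists>\<phi>. \<phi> \<in> borel_measurable \<mu> \<and>
         (\<forall>x \<in> space \<mu>. 0 \<le> \<phi> x \<and> \<phi> x \<le> (1 :: real)) \<and>
         (LINT x|sample_law \<mu> (p \<theta>0). \<phi> x) \<le> exp (- c1 * real n * (d \<theta>0 \<theta>1)\<^sup>2) \<and>
         (\<forall>\<theta> \<in> \<Theta>. d \<theta> \<theta>1 < \<zeta> * d \<theta>0 \<theta>1 \<longrightarrow>
           (LINT x|sample_law \<mu> (p \<theta>). 1 - \<phi> x) \<le> exp (- c1 * real n * (d \<theta>0 \<theta>1)\<^sup>2))"
    and R: "0 < R" and h: "0 < h" "D0 * real k powr D1 * (real k * h) powr D2 < \<zeta> * R"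
    and N: "real n powr Q \<le> real N * h"
  obtains \<psi> where "\<psi> \<in> borel_measurable \<mu>" "\<And>x. x \<in> space \<mu> \<Longrightarrow> 0 \<le> \<psi> x \<and> \<psi> x \<le> (1 :: real)"
    "(\<integral>\<^sup>+x. ennreal (p \<theta>0 x) * ennreal (\<psi> x) \<partial>\<mu>) \<le> ennreal (real (2 * N + 1) ^ k * exp (- c1 * real n * R\<^sup>2))"
    "\<And>\<theta>. \<theta> \<in> bounded_sieve n k Q \<Longrightarrow> R \<le> d \<theta> \<theta>0
      \<Longrightarrow> (\<integral>\<^sup>+x. ennreal (p \<theta> x) * ennreal (1 - \<psi> x) \<partial>\<mu>) \<le> ennreal (exp (- c1 * real n * R\<^sup>2))"
proof -
  define S where "S = {\<theta> \<in> bounded_sieve n k Q. R \<le> d \<theta> \<theta>0}"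
  have S_sub: "S \<subseteq> \<Theta>" "S \<subseteq> bounded_sieve n k Q" using sub by (auto simp: S_def bounded_sieve_def)
  have "\<bar>\<theta> j\<bar> \<le> real N * h" if "\<theta> \<in> S" "j < k" for \<theta> j
    using abs_coord_le_norm2[OF that(2), of \<theta>] that(1) N by (auto simp: S_def bounded_sieve_def)
  then obtain F where F: "finite F" "F \<subseteq> S" "card F \<le> (2 * N + 1) ^ k"
    "\<And>\<theta>. \<theta> \<in> S \<Longrightarrow> \<exists>\<theta>1\<in>F. \<forall>j<k. \<bar>\<theta> j - \<theta>1 j\<bar> \<le> h"
    using grid_cover[OF _ h(1), of S k N] by metis
  define \<beta> where "\<beta> = exp (- c1 * real n * R\<^sup>2)"
  have far: "R \<le> d \<theta>0 \<theta>1" "exp (- c1 * real n * (d \<theta>0 \<theta>1)\<^sup>2) \<le> \<beta>" if "\<theta>1 \<in> F" for \<theta>1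
  proof -
    have "\<theta>1 \<in> \<Theta>" "R \<le> d \<theta>1 \<theta>0" using that F S_sub by (auto simp: S_def)
    then show "R \<le> d \<theta>0 \<theta>1" using semi \<theta>0 by (simp add: semimetric_on_def)
    then have "R\<^sup>2 \<le> (d \<theta>0 \<theta>1)\<^sup>2" using R by (intro power_mono) auto
    then show "exp (- c1 * real n * (d \<theta>0 \<theta>1)\<^sup>2) \<le> \<beta>"
      using c1 by (auto simp: \<beta>_def intro!: mult_left_mono)
  qed
  obtain \<phi> where \<phi>: "\<And>\<theta>1. \<theta>1 \<in> F \<Longrightarrow> \<phi> \<theta>1 \<in> borel_measurable \<mu>"
      "\<And>\<theta>1 x. \<theta>1 \<in> F \<Longrightarrow> x \<in> space \<mu> \<Longrightarrow> 0 \<le> \<phi> \<theta>1 x \<and> \<phi> \<theta>1 x \<le> (1 :: real)"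
      "\<And>\<theta>1. \<theta>1 \<in> F \<Longrightarrow> (LINT x|sample_law \<mu> (p \<theta>0). \<phi> \<theta>1 x) \<le> exp (- c1 * real n * (d \<theta>0 \<theta>1)\<^sup>2)"
      "\<And>\<theta>1 \<theta>. \<theta>1 \<in> F \<Longrightarrow> \<theta> \<in> \<Theta> \<Longrightarrow> d \<theta> \<theta>1 < \<zeta> * d \<theta>0 \<theta>1 \<Longrightarrow>
           (LINT x|sample_law \<mu> (p \<theta>). 1 - \<phi> \<theta>1 x) \<le> exp (- c1 * real n * (d \<theta>0 \<theta>1)\<^sup>2)"
  proof -
    have "\<forall>\<theta>1\<in>F. \<exists>\<phi>. \<phi> \<in> borel_measurable \<mu> \<and>
         (\<forall>x \<in> space \<mu>. 0 \<le> \<phi> x \<and> \<phi> x \<le> (1 :: real)) \<and>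
         (LINT x|sample_law \<mu> (p \<theta>0). \<phi> x) \<le> exp (- c1 * real n * (d \<theta>0 \<theta>1)\<^sup>2) \<and>
         (\<forall>\<theta> \<in> \<Theta>. d \<theta> \<theta>1 < \<zeta> * d \<theta>0 \<theta>1 \<longrightarrow>
           (LINT x|sample_law \<mu> (p \<theta>). 1 - \<phi> x) \<le> exp (- c1 * real n * (d \<theta>0 \<theta>1)\<^sup>2))"
      using A4 F(2) S_sub(2) by blast
    from bchoice[OF this] show ?thesis using that by blast
  qed
  define Reg where "Reg \<theta>1 = {\<theta> \<in> \<Theta>. d \<theta> \<theta>1 < \<zeta> * d \<theta>0 \<theta>1}" for \<theta>1
  have test: "\<phi> \<theta>1 \<in> borel_measurable \<mu> \<and> (\<forall>x\<in>space \<mu>. 0 \<le> \<phi> \<theta>1 x \<and> \<phi> \<theta>1 x \<le> (1 :: real))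
        \<and> (\<integral>\<^sup>+x. ennreal (p \<theta>0 x) * ennreal (\<phi> \<theta>1 x) \<partial>\<mu>) \<le> ennreal \<beta>
        \<and> (\<forall>\<theta>\<in>Reg \<theta>1. (\<integral>\<^sup>+x. ennreal (p \<theta> x) * ennreal (1 - \<phi> \<theta>1 x) \<partial>\<mu>) \<le> ennreal \<beta>)"
    if F1: "\<theta>1 \<in> F" for \<theta>1
  proof (intro conjI ballI)
    note [measurable] = \<phi>(1)[OF F1]
    show "\<phi> \<theta>1 \<in> borel_measurable \<mu>" by measurable
    show "0 \<le> \<phi> \<theta>1 x" "\<phi> \<theta>1 x \<le> 1" if "x \<in> space \<mu>" for x using \<phi>(2)[OF F1 that] by auto
    have "(\<integral>\<^sup>+x. ennreal (p \<theta>0 x) * ennreal (\<phi> \<theta>1 x) \<partial>\<mu>) = ennreal (LINT x|sample_law \<mu> (p \<theta>0). \<phi> \<theta>1 x)"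
      by (rule expectation_sample_law[OF p_meas[OF \<theta>0] _ prob[OF \<theta>0]]) (use \<phi>(2)[OF F1] in auto)
    also have "\<dots> \<le> ennreal \<beta>" using \<phi>(3)[OF F1] far(2)[OF F1] by (intro ennreal_leI) simp
    finally show "(\<integral>\<^sup>+x. ennreal (p \<theta>0 x) * ennreal (\<phi> \<theta>1 x) \<partial>\<mu>) \<le> ennreal \<beta>" .
    fix \<theta> assume "\<theta> \<in> Reg \<theta>1"
    then have \<theta>: "\<theta> \<in> \<Theta>" "d \<theta> \<theta>1 < \<zeta> * d \<theta>0 \<theta>1" by (auto simp: Reg_def)
    have "(\<integral>\<^sup>+x. ennreal (p \<theta> x) * ennreal (1 - \<phi> \<theta>1 x) \<partial>\<mu>) = ennreal (LINT x|sample_law \<mu> (p \<theta>). 1 - \<phi> \<theta>1 x)"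
      by (rule expectation_sample_law[OF p_meas[OF \<theta>(1)] _ prob[OF \<theta>(1)]]) (use \<phi>(2)[OF F1] in auto)
    also have "\<dots> \<le> ennreal \<beta>" using \<phi>(4)[OF F1 \<theta>] far(2)[OF F1] by (intro ennreal_leI) simp
    finally show "(\<integral>\<^sup>+x. ennreal (p \<theta> x) * ennreal (1 - \<phi> \<theta>1 x) \<partial>\<mu>) \<le> ennreal \<beta>" .
  qed
  have cover: "\<theta> \<in> (\<Union>\<theta>1\<in>F. Reg \<theta>1)" if \<theta>: "\<theta> \<in> S" for \<theta>
  proof -
    obtain \<theta>1 where \<theta>1: "\<theta>1 \<in> F" "\<And>j. j < k \<Longrightarrow> \<bar>\<theta> j - \<theta>1 j\<bar> \<le> h" using F(4)[OF \<theta>] by blast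
    have "norm2 k (\<lambda>j. \<theta> j - \<theta>1 j) \<le> (\<Sum>j<k. \<bar>\<theta> j - \<theta>1 j\<bar>)"
      by (rule norm2_le_sum)
    also have "\<dots> \<le> (\<Sum>j<k. h)" by (intro sum_mono) (use \<theta>1(2) in auto)
    finally have "norm2 k (\<lambda>j. \<theta> j - \<theta>1 j) \<le> real k * h" by simp
    moreover have "0 \<le> norm2 k (\<lambda>j. \<theta> j - \<theta>1 j)" by (simp add: norm2_def)
    ultimately have "norm2 k (\<lambda>j. \<theta> j - \<theta>1 j) powr D2 \<le> (real k * h) powr D2" using D by (intro powr_mono2) auto
    then have "D0 * real k powr D1 * norm2 k (\<lambda>j. \<theta> j - \<theta>1 j) powr D2 \<le> D0 * real k powr D1 * (real k * h) powr D2"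
      using D by (intro mult_left_mono) auto
    moreover have "d \<theta> \<theta>1 \<le> D0 * real k powr D1 * norm2 k (\<lambda>j. \<theta> j - \<theta>1 j) powr D2"
      using A3 \<theta> \<theta>1(1) F(2) S_sub(2) by blast
    moreover have "\<zeta> * R \<le> \<zeta> * d \<theta>0 \<theta>1" using far(1)[OF \<theta>1(1)] c1 by simp
    ultimately have "d \<theta> \<theta>1 < \<zeta> * d \<theta>0 \<theta>1" using h(2) by linarith
    then show ?thesis using \<theta>1(1) \<theta> S_sub by (auto simp: Reg_def)
  qed
  obtain \<psi> where \<psi>: "\<psi> \<in> borel_measurable \<mu>" "\<And>x. x \<in> space \<mu> \<Longrightarrow> 0 \<le> \<psi> x \<and> \<psi> x \<le> (1 :: real)"
    "(\<integral>\<^sup>+x. ennreal (p \<theta>0 x) * ennreal (\<psi> x) \<partial>\<mu>) \<le> of_nat (card F) * ennreal \<beta>"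
    "\<And>\<theta>. \<theta> \<in> (\<Union>i\<in>F. Reg i) \<Longrightarrow> (\<integral>\<^sup>+x. ennreal (p \<theta> x) * ennreal (1 - \<psi> x) \<partial>\<mu>) \<le> ennreal \<beta>"
    by (rule combine_tests[where R = Reg and \<phi> = \<phi> and p = p and F = F and \<beta> = \<beta>,
        OF F(1) p_meas[OF \<theta>0] test], assumption, rule that)
  show ?thesis
  proof (rule that[OF \<psi>(1,2)])
    have "of_nat (card F) * ennreal \<beta> \<le> ennreal (real (2 * N + 1) ^ k) * ennreal \<beta>"
    proof (intro mult_right_mono)
      have "real (card F) \<le> real ((2 * N + 1) ^ k)" using F(3) by (rule of_nat_mono)
      then show "of_nat (card F) \<le> ennreal (real (2 * N + 1) ^ k)"
        by (simp only: ennreal_of_nat_eq_real_of_nat of_nat_power ennreal_leI)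
    qed simp
    also have "\<dots> = ennreal (real (2 * N + 1) ^ k * exp (- c1 * real n * R\<^sup>2))"
      unfolding \<beta>_def by (rule ennreal_mult[symmetric]) auto
    finally show "(\<integral>\<^sup>+x. ennreal (p \<theta>0 x) * ennreal (\<psi> x) \<partial>\<mu>) \<le> ennreal (real (2 * N + 1) ^ k * exp (- c1 * real n * R\<^sup>2))"
      using \<psi>(3) by (rule order_trans[rotated])
    show "(\<integral>\<^sup>+x. ennreal (p \<theta> x) * ennreal (1 - \<psi> x) \<partial>\<mu>) \<le> ennreal (exp (- c1 * real n * R\<^sup>2))"
      if "\<theta> \<in> bounded_sieve n k Q" "R \<le> d \<theta> \<theta>0" for \<theta>
      using \<psi>(4)[OF cover[of \<theta>]] that by (simp add: S_def \<beta>_def)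
  qed
qed

section \<open>The sieve prior\<close>

text \<open>
  The prior at one sample size. Working with the law \<open>coord_law k\<close> of the first \<open>k\<close> coordinates,
  before they are mapped into the parameter set, avoids measurability questions about the
  \<open>\<sigma>\<close>-field of \<open>T\<close>.
\<close>

locale product_prior =
  fixes T :: "(nat \<Rightarrow> real) measure" and g :: "real \<Rightarrow> real" and \<tau> :: "nat \<Rightarrow> real" and r1 :: ereal
  assumes first_coords_measurable [measurable]: "\<And>k. first_coords k \<in> (\<Pi>\<^sub>M j\<in>{..<k}. lborel) \<rightarrow>\<^sub>M T"
    and g_measurable [measurable]: "g \<in> borel_measurable borel"
    and g_nonneg: "\<And>t. 0 \<le> g t"
    and g_integral: "(\<integral>\<^sup>+t. ennreal (g t) \<partial>lborel) = 1"
    and scale_pos: "\<And>j. 0 < \<tau> j"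
begin

abbreviation leb :: "nat \<Rightarrow> (nat \<Rightarrow> real) measure" where
  "leb k \<equiv> (\<Pi>\<^sub>M j\<in>{..<k}. lborel)"

definition coord_law :: "nat \<Rightarrow> (nat \<Rightarrow> real) measure" where
  "coord_law k = density (leb k)
     (\<lambda>u. prior_kernel g \<tau> r1 k u / (\<integral>\<^sup>+v. prior_kernel g \<tau> r1 k v \<partial>leb k))"

lemma prior_component_eq: "prior_component T g \<tau> r1 k = distr (coord_law k) T (first_coords k)"
  by (simp add: prior_component_def coord_law_def Let_def)

lemma prior_kernel_measurable [measurable]: "prior_kernel g \<tau> r1 k \<in> borel_measurable (leb k)"
  unfolding prior_kernel_def[abs_def] by measurable

lemma sets_coord_law [measurable_cong, simp]: "sets (coord_law k) = sets (leb k)"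
  by (simp add: coord_law_def)

lemma space_coord_law [simp]: "space (coord_law k) = space (leb k)"
  by (simp add: coord_law_def)

lemma nn_integral_leb_prod:
  fixes f :: "nat \<Rightarrow> real \<Rightarrow> ennreal"
  assumes "\<And>j. f j \<in> borel_measurable borel"
  shows "(\<integral>\<^sup>+u. (\<Prod>j<k. f j (u j)) \<partial>leb k) = (\<Prod>j<k. \<integral>\<^sup>+t. f j t \<partial>lborel)"
proof -
  interpret product_sigma_finite "\<lambda>_::nat. lborel :: real measure" ..
  show ?thesis using assms by (intro product_nn_integral_prod) auto
qed

lemma scaled_density_integral:
  assumes [measurable]: "A \<in> sets borel"
  shows "(\<integral>\<^sup>+t. ennreal (g (t / \<tau> j) / \<tau> j) * indicator A (t / \<tau> j) \<partial>lborel)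
    = (\<integral>\<^sup>+t. ennreal (g t) * indicator A t \<partial>lborel)"
proof -
  have p: "\<tau> j > 0" by (rule scale_pos)
  have "(\<integral>\<^sup>+t. ennreal (g (t / \<tau> j) / \<tau> j) * indicator A (t / \<tau> j) \<partial>lborel)
      = ennreal \<bar>\<tau> j\<bar> * (\<integral>\<^sup>+t. ennreal (g ((0 + \<tau> j * t) / \<tau> j) / \<tau> j) * indicator A ((0 + \<tau> j * t) / \<tau> j) \<partial>lborel)"
    using p by (intro nn_integral_real_affine) auto
  also have "\<dots> = (\<integral>\<^sup>+t. ennreal (\<tau> j) * (ennreal (g t / \<tau> j) * indicator A t) \<partial>lborel)"
    using p by (subst nn_integral_cmult) auto
  also have "\<dots> = (\<integral>\<^sup>+t. ennreal (g t) * indicator A t \<partial>lborel)"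
    using p g_nonneg by (intro nn_integral_cong) (simp add: mult.assoc[symmetric] flip: ennreal_mult)
  finally show ?thesis .
qed

lemma scaled_density_integral_1: "(\<integral>\<^sup>+t. ennreal (g (t / \<tau> j) / \<tau> j) \<partial>lborel) = 1"
  using scaled_density_integral[of UNIV j] g_integral by simp

lemma prior_kernel_le: "prior_kernel g \<tau> r1 k u \<le> (\<Prod>j<k. ennreal (g (u j / \<tau> j) / \<tau> j))"
  using g_nonneg scale_pos
  by (auto simp: prior_kernel_def prod_ennreal less_imp_le intro!: ennreal_leI mult_left_le prod_nonneg divide_nonneg_nonneg)

text \<open>
  Truncation only removes mass, so dividing by the normalizing constant can only increase the
  density of the prior. Lower bounds on prior masses are therefore insensitive to the truncation.
\<close>

lemma prior_kernel_integral_le_1: "(\<integral>\<^sup>+u. prior_kernel g \<tau> r1 k u \<partial>leb k) \<le> 1"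
proof -
  have "(\<integral>\<^sup>+u. prior_kernel g \<tau> r1 k u \<partial>leb k) \<le> (\<integral>\<^sup>+u. (\<Prod>j<k. ennreal (g (u j / \<tau> j) / \<tau> j)) \<partial>leb k)"
    by (intro nn_integral_mono prior_kernel_le)
  also have "\<dots> = (\<Prod>j<k. \<integral>\<^sup>+t. ennreal (g (t / \<tau> j) / \<tau> j) \<partial>lborel)"
    by (rule nn_integral_leb_prod) measurable
  finally show ?thesis by (simp add: scaled_density_integral_1)
qed

lemma prior_kernel_integral_untruncated:
  assumes "r1 = \<infinity>" shows "(\<integral>\<^sup>+u. prior_kernel g \<tau> r1 k u \<partial>leb k) = 1"
proof -
  have "(\<integral>\<^sup>+u. prior_kernel g \<tau> r1 k u \<partial>leb k) = (\<integral>\<^sup>+u. (\<Prod>j<k. ennreal (g (u j / \<tau> j) / \<tau> j)) \<partial>leb k)"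
    using g_nonneg scale_pos assms
    by (intro nn_integral_cong) (auto simp: prior_kernel_def prod_ennreal less_imp_le)
  also have "\<dots> = (\<Prod>j<k. \<integral>\<^sup>+t. ennreal (g (t / \<tau> j) / \<tau> j) \<partial>lborel)"
    by (rule nn_integral_leb_prod) measurable
  finally show ?thesis by (simp add: scaled_density_integral_1)
qed

text \<open>
  A probability measure, except when the normalizing constant vanishes; then it is the zero
  measure.
\<close>

lemma subprob_coord_law: "subprob_space (coord_law k)"
proof
  let ?Z = "\<integral>\<^sup>+v. prior_kernel g \<tau> r1 k v \<partial>leb k"
  have "emeasure (coord_law k) (space (coord_law k)) = (\<integral>\<^sup>+u. prior_kernel g \<tau> r1 k u / ?Z \<partial>leb k)"
    by (simp add: coord_law_def emeasure_density cong: nn_integral_cong)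
  also have "\<dots> = ?Z / ?Z"
    by (rule nn_integral_divide) measurable
  also have "\<dots> \<le> 1"
    using prior_kernel_integral_le_1[of k]
    by (cases "?Z = 0") (simp_all add: ennreal_divide_self order.strict_trans1[OF _ ennreal_one_less_top])
  finally show "emeasure (coord_law k) (space (coord_law k)) \<le> 1" .
  show "space (coord_law k) \<noteq> {}" by (simp add: space_PiM PiE_eq_empty_iff)
qed

lemma prior_component_subprob_algebra: "prior_component T g \<tau> r1 k \<in> space (subprob_algebra T)"
proof -
  interpret subprob_space "coord_law k" by (rule subprob_coord_law)
  have "space T \<noteq> {}"
    using measurable_space[OF first_coords_measurable[of k]] subprob_not_empty
    by (metis empty_iff equals0I space_coord_law)
  then have "subprob_space (prior_component T g \<tau> r1 k)"
    unfolding prior_component_eq by (intro subprob_space_distr) measurable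
  then show ?thesis by (simp add: space_subprob_algebra prior_component_eq)
qed

lemma prior_component_kernel [measurable]:
  "prior_component T g \<tau> r1 \<in> measure_pmf w \<rightarrow>\<^sub>M subprob_algebra T"
  using prior_component_subprob_algebra by simp

lemma sets_sieve_prior [measurable_cong, simp]: "sets (sieve_prior T w g \<tau> r1) = sets T"
  unfolding sieve_prior_def by (rule sets_bind) (auto simp: prior_component_eq)

lemma space_sieve_prior [simp]: "space (sieve_prior T w g \<tau> r1) = space T"
  by (rule sets_eq_imp_space_eq) simp

lemma subprob_sieve_prior: "subprob_space (sieve_prior T w g \<tau> r1)"
  unfolding sieve_prior_def
  by (rule subprob_space_bind[OF measure_pmf.subprob_space_axioms prior_component_kernel])

text \<open>
  The gateway from the prior on sequences to integrals over coordinate space.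
\<close>

lemma nn_integral_sieve_prior:
  assumes [measurable]: "f \<in> borel_measurable T"
  shows "(\<integral>\<^sup>+\<theta>. f \<theta> \<partial>sieve_prior T w g \<tau> r1)
    = (\<integral>\<^sup>+k. (\<integral>\<^sup>+u. f (first_coords k u) \<partial>coord_law k) \<partial>measure_pmf w)"
  unfolding sieve_prior_def
  by (subst nn_integral_bind[OF assms prior_component_kernel])
    (simp add: prior_component_eq nn_integral_distr)

end

context product_prior begin

text \<open>
  The hypothesis \<open>l1\<close> keeps the whole box inside the truncation ball.
\<close>

lemma coord_law_box_ge:
  assumes nonneg: "\<And>j. j < k \<Longrightarrow> 0 \<le> lo j" "0 \<le> \<delta>"
    and lo: "\<And>j t. j < k \<Longrightarrow> \<bar>t - c j\<bar> \<le> \<delta> \<Longrightarrow> lo j \<le> g (t / \<tau> j) / \<tau> j"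
    and l1: "ereal ((\<Sum>j<k. \<bar>c j\<bar>) + real k * \<delta>) \<le> r1"
  shows "ennreal (\<Prod>j<k. 2 * \<delta> * lo j)
    \<le> emeasure (coord_law k) (PiE {..<k} (\<lambda>j. {c j - \<delta>..c j + \<delta>}))"
proof -
  interpret product_sigma_finite "\<lambda>_::nat. lborel :: real measure" ..
  let ?B = "PiE {..<k} (\<lambda>j. {c j - \<delta>..c j + \<delta>})"
  let ?Z = "\<integral>\<^sup>+v. prior_kernel g \<tau> r1 k v \<partial>leb k"
  have B_meas [measurable]: "?B \<in> sets (leb k)" by (intro sets_PiM_I_finite) auto
  have ker: "ennreal (\<Prod>j<k. lo j) \<le> prior_kernel g \<tau> r1 k u" if u: "u \<in> ?B" for u
  proof -
    have ub: "\<bar>u j - c j\<bar> \<le> \<delta>" if "j < k" for j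
    proof -
      have "u j \<in> {c j - \<delta>..c j + \<delta>}" using u that by (intro PiE_mem[of u "{..<k}"]) auto
      then show ?thesis by auto
    qed
    have "(\<Sum>j<k. \<bar>u j\<bar>) \<le> (\<Sum>j<k. \<bar>c j\<bar> + \<delta>)"
    proof (intro sum_mono)
      fix j assume "j \<in> {..<k}"
      then show "\<bar>u j\<bar> \<le> \<bar>c j\<bar> + \<delta>" using ub[of j] by auto
    qed
    then have "ereal (\<Sum>j<k. \<bar>u j\<bar>) \<le> r1"
      using l1 by (intro order_trans[OF _ l1]) (simp add: sum.distrib)
    then show ?thesis
      using lo[OF _ ub] nonneg by (auto simp: prior_kernel_def intro!: ennreal_leI prod_mono)
  qed
  have div: "a \<le> a / ?Z" for a :: ennreal
  proof -
    have "a * ?Z \<le> a * 1" by (intro mult_left_mono prior_kernel_integral_le_1) simp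
    have "1 \<le> inverse ?Z"
    proof (cases "?Z = 0")
      case False
      have "?Z / ?Z \<le> 1 / ?Z" by (intro divide_right_mono_ennreal prior_kernel_integral_le_1)
      moreover have "?Z / ?Z = 1"
        using False prior_kernel_integral_le_1[of k]
        by (intro ennreal_divide_self) (auto intro: order.strict_trans1[OF _ ennreal_one_less_top])
      ultimately show ?thesis by (simp add: divide_ennreal_def)
    qed simp
    then have "a * 1 \<le> a * inverse ?Z" by (intro mult_left_mono) auto
    then show ?thesis by (simp add: divide_ennreal_def)
  qed
  have "ennreal (\<Prod>j<k. 2 * \<delta> * lo j) = ennreal (\<Prod>j<k. lo j) * (\<Prod>j<k. ennreal (2 * \<delta>))"
  proof -
    have "(\<Prod>j<k. ennreal (2 * \<delta>)) = ennreal (\<Prod>j<k. 2 * \<delta>)"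
      by (rule prod_ennreal) (use nonneg in simp)
    moreover have "0 \<le> (\<Prod>j<k. lo j)" "0 \<le> (\<Prod>j<k. 2 * \<delta>)"
      using nonneg by (intro prod_nonneg; simp)+
    ultimately show ?thesis
      by (simp only: ennreal_mult[symmetric] prod.distrib[symmetric] mult.commute)
  qed
  also have "(\<Prod>j<k. ennreal (2 * \<delta>)) = emeasure (leb k) ?B"
    using nonneg by (subst emeasure_PiM) auto
  also have "ennreal (\<Prod>j<k. lo j) * emeasure (leb k) ?B = (\<integral>\<^sup>+u. ennreal (\<Prod>j<k. lo j) * indicator ?B u \<partial>leb k)"
    by (simp add: nn_integral_cmult_indicator)
  also have "\<dots> \<le> (\<integral>\<^sup>+u. prior_kernel g \<tau> r1 k u / ?Z * indicator ?B u \<partial>leb k)"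
    by (intro nn_integral_mono) (auto simp: indicator_def intro: order_trans[OF ker div])
  also have "\<dots> = emeasure (coord_law k) ?B"
    by (simp add: coord_law_def emeasure_density)
  finally show ?thesis .
qed

lemma coord_law_coordinate_tail:
  assumes "r1 = \<infinity>" "i < k"
  shows "emeasure (coord_law k) {u \<in> space (leb k). t < \<bar>u i / \<tau> i\<bar>}
    = (\<integral>\<^sup>+s. ennreal (g s) * indicator {s. t < \<bar>s\<bar>} s \<partial>lborel)"
proof -
  have "i \<in> {..<k}" using assms by simp
  then have i_meas [measurable]: "(\<lambda>u. u i) \<in> borel_measurable (leb k)"
      using measurable_component_singleton[of i "{..<k}" "\<lambda>_. lborel :: real measure"] by simp
  define f where "f j s = ennreal (g (s / \<tau> j) / \<tau> j) * (if j = i then indicator {s. t < \<bar>s\<bar>} (s / \<tau> j) else 1)" for j s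
  have [measurable]: "f j \<in> borel_measurable borel" for j
    unfolding f_def by (cases "j = i") (simp_all, measurable)
  have set [measurable]: "{u \<in> space (leb k). t < \<bar>u i / \<tau> i\<bar>} \<in> sets (leb k)" by measurable
  have "emeasure (coord_law k) {u \<in> space (leb k). t < \<bar>u i / \<tau> i\<bar>}
     = (\<integral>\<^sup>+u. prior_kernel g \<tau> r1 k u * indicator {u \<in> space (leb k). t < \<bar>u i / \<tau> i\<bar>} u \<partial>leb k)"
    unfolding coord_law_def prior_kernel_integral_untruncated[OF assms(1)]
    by (subst emeasure_density) (auto simp: divide_ennreal_def)
  also have "\<dots> = (\<integral>\<^sup>+u. (\<Prod>j<k. f j (u j)) \<partial>leb k)"
  proof (intro nn_integral_cong)
    fix u assume u: "u \<in> space (leb k)"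
    have "(\<Prod>j<k. f j (u j)) = (\<Prod>j<k. ennreal (g (u j / \<tau> j) / \<tau> j)) * (\<Prod>j<k. if j = i then indicator {s. t < \<bar>s\<bar>} (u j / \<tau> j) else 1)"
      by (simp add: f_def prod.distrib)
    also have "(\<Prod>j<k. if j = i then indicator {s. t < \<bar>s\<bar>} (u j / \<tau> j) else (1 :: ennreal)) = indicator {s. t < \<bar>s\<bar>} (u i / \<tau> i)"
      using assms(2) by (simp add: prod.delta)
    also have "(\<Prod>j<k. ennreal (g (u j / \<tau> j) / \<tau> j)) = prior_kernel g \<tau> r1 k u"
      using g_nonneg scale_pos assms(1) by (auto simp: prior_kernel_def prod_ennreal less_imp_le)
    finally show "prior_kernel g \<tau> r1 k u * indicator {u \<in> space (leb k). t < \<bar>u i / \<tau> i\<bar>} u = (\<Prod>j<k. f j (u j))"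
      using u by (simp add: indicator_def)
  qed
  also have "\<dots> = (\<Prod>j<k. \<integral>\<^sup>+s. f j s \<partial>lborel)" by (rule nn_integral_leb_prod) measurable
  also have "\<dots> = (\<Prod>j<k. if j = i then (\<integral>\<^sup>+s. f i s \<partial>lborel) else 1)"
    by (intro prod.cong) (auto simp: f_def scaled_density_integral_1)
  also have "\<dots> = (\<integral>\<^sup>+s. f i s \<partial>lborel)" using assms(2) by (simp add: prod.delta)
  also have "\<dots> = (\<integral>\<^sup>+s. ennreal (g s) * indicator {s. t < \<bar>s\<bar>} s \<partial>lborel)"
    unfolding f_def using scaled_density_integral[of "{s. t < \<bar>s\<bar>}" i] by simp
  finally show ?thesis .
qed

text \<open>
  The norm is at most the sum of the absolute coordinates, so a vector of norm above \<open>R\<close> has a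
  coordinate above \<open>R/k\<close>; then a union bound over the coordinates.
\<close>

lemma coord_law_norm_tail_untruncated:
  assumes r1: "r1 = \<infinity>" and \<tau>: "\<And>j. \<tau> j \<le> \<tau>0" and t: "0 \<le> t" and kt: "real k * (\<tau>0 * t) \<le> R"
  shows "emeasure (coord_law k) {u \<in> space (leb k). R < norm2 k u}
    \<le> of_nat k * (\<integral>\<^sup>+s. ennreal (g s) * indicator {s. t < \<bar>s\<bar>} s \<partial>lborel)"
proof -
  let ?A = "\<lambda>i. {u \<in> space (leb k). t < \<bar>u i / \<tau> i\<bar>}"
  have meas: "?A i \<in> sets (leb k)" if "i < k" for i
  proof -
    have "i \<in> {..<k}" using that by simp
    then have [measurable]: "(\<lambda>u. u i) \<in> borel_measurable (leb k)"
      using measurable_component_singleton[of i "{..<k}" "\<lambda>_. lborel :: real measure"] by simp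
    show ?thesis by measurable
  qed
  have "{u \<in> space (leb k). R < norm2 k u} \<subseteq> (\<Union>i\<in>{..<k}. ?A i)"
  proof (intro subsetI, rule ccontr)
    fix u assume u: "u \<in> {u \<in> space (leb k). R < norm2 k u}" and no: "u \<notin> (\<Union>i\<in>{..<k}. ?A i)"
    have "\<bar>u j\<bar> \<le> \<tau>0 * t" if "j < k" for j
    proof -
      have "\<bar>u j / \<tau> j\<bar> \<le> t" using u no that by force
      then have "\<bar>u j\<bar> \<le> t * \<tau> j" using scale_pos[of j] by (simp add: abs_divide divide_le_eq)
      also have "\<dots> \<le> t * \<tau>0" by (intro mult_left_mono \<tau> t)
      finally show ?thesis by (simp add: mult.commute)
    qed
    then have "(\<Sum>j<k. \<bar>u j\<bar>) \<le> (\<Sum>j<k. \<tau>0 * t)" by (intro sum_mono) auto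
    then have "norm2 k u \<le> R" using norm2_le_sum[of k u] kt by simp
    then show False using u by simp
  qed
  then have "emeasure (coord_law k) {u \<in> space (leb k). R < norm2 k u} \<le> emeasure (coord_law k) (\<Union>i\<in>{..<k}. ?A i)"
    by (intro emeasure_mono) (use meas in auto)
  also have "\<dots> \<le> (\<Sum>i<k. emeasure (coord_law k) (?A i))"
    by (intro emeasure_subadditive_finite) (use meas in auto)
  also have "\<dots> = (\<Sum>i<k. \<integral>\<^sup>+s. ennreal (g s) * indicator {s. t < \<bar>s\<bar>} s \<partial>lborel)"
    by (intro sum.cong coord_law_coordinate_tail r1) auto
  finally show ?thesis by simp
qed

lemma coord_law_norm_tail_truncated:
  assumes "r1 \<le> ereal R"
  shows "emeasure (coord_law k) {u \<in> space (leb k). R < norm2 k u} = 0"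
proof -
  have zero: "prior_kernel g \<tau> r1 k u = 0" if "R < norm2 k u" for u
  proof -
    have "R < (\<Sum>j<k. \<bar>u j\<bar>)" using that norm2_le_sum[of k u] by linarith
    then have "\<not> ereal (\<Sum>j<k. \<bar>u j\<bar>) \<le> r1" using assms by (metis dual_order.trans ereal_less_eq(3) linorder_not_less)
    then show ?thesis by (simp add: prior_kernel_def)
  qed
  have meas [measurable]: "{u \<in> space (leb k). R < norm2 k u} \<in> sets (leb k)"
    unfolding norm2_def L2_set_def by measurable
  show ?thesis unfolding coord_law_def
    by (subst emeasure_density) (auto intro!: nn_integral_zero' AE_I2 simp: indicator_def zero nn_integral_0_iff_AE)
qed

end

lemma powr_plus_1_le:
  fixes a \<alpha> :: real
  assumes "0 \<le> a" "0 < \<alpha>"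
  shows "(a + 1) powr \<alpha> \<le> 2 powr \<alpha> * (a powr \<alpha> + 1)"
proof -
  have "(a + 1) powr \<alpha> \<le> (2 * max a 1) powr \<alpha>" using assms by (intro powr_mono2) auto
  also have "\<dots> = 2 powr \<alpha> * max a 1 powr \<alpha>" using assms by (simp add: powr_mult)
  also have "max a 1 powr \<alpha> \<le> a powr \<alpha> + 1" by (cases "a \<le> 1") (auto simp: max_def)
  finally show ?thesis by simp
qed

text \<open>
  The true parameter may lie on the boundary of the \<open>l\<^sup>1\<close> ball, and a cube around it may then
  leave the ball. The centre of the cube is therefore pulled towards \<open>0\<close> by a factor \<open>1 - s\<close>: the
  gain \<open>s r\<close> in the \<open>l\<^sup>1\<close> norm pays for the size of the cube, and \<open>s\<close> is small enough not to spoil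
  the distance to the truth. Without truncation, \<open>s = 0\<close>.
\<close>

lemma shrunk_center:
  fixes \<theta>0 :: "nat \<Rightarrow> real"
  assumes n: "2 \<le> n" and jn: "j \<le> n" and H: "0 < H1" "0 < H2"
    and l1: "ereal (\<Sum>i<j. \<bar>\<theta>0 i\<bar>) \<le> r1"
    and r1: "r1 = \<infinity> \<or> (\<exists>r. r1 = ereal r \<and> 1 / real n \<le> r \<and> r \<le> real n)"
  defines "\<delta> \<equiv> real n powr - (H1 + H2 + 4)"
  obtains s where "0 \<le> s" "s \<le> 1" "s * (\<Sum>i<j. \<bar>\<theta>0 i\<bar>) + real j * \<delta> \<le> real n powr - H1"
    "ereal ((1 - s) * (\<Sum>i<j. \<bar>\<theta>0 i\<bar>) + real j * \<delta>) \<le> r1"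
proof -
  have n0: "real n > 0" using n by simp
  have "real j * \<delta> \<le> real n powr 1 * real n powr - (H1 + H2 + 4)"
    unfolding \<delta>_def using jn n0 by (intro mult_right_mono) auto
  also have "\<dots> = real n powr - (H1 + H2 + 3)"
    by (subst powr_add[symmetric]) (simp add: algebra_simps)
  also have "\<dots> \<le> real n powr - (H1 + 3)" using n H by (intro powr_mono) auto
  finally have j\<delta>: "real j * \<delta> \<le> real n powr - (H1 + 3)" .
  have half: "real n powr - (H1 + 1) \<le> real n powr - H1 / 2"
  proof -
    have "real n powr - (H1 + 1) = real n powr - H1 / real n" using n0 by (simp add: powr_diff powr_minus field_simps powr_add)
    also have "\<dots> \<le> real n powr - H1 / 2" using n by (intro divide_left_mono) auto
    finally show ?thesis .
  qed
  have j\<delta>': "real j * \<delta> \<le> real n powr - H1 / 2"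
  proof -
    have "real n powr - (H1 + 3) \<le> real n powr - (H1 + 1)" using n by (intro powr_mono) auto
    then show ?thesis using j\<delta> half by linarith
  qed
  from r1 show ?thesis
  proof
    assume "r1 = \<infinity>"
    moreover have "real j * \<delta> \<le> real n powr - H1"
      using j\<delta>' powr_ge_zero[of "real n" "- H1"] by argo
    ultimately show ?thesis by (intro that[of 0]) auto
  next
    assume "\<exists>r. r1 = ereal r \<and> 1 / real n \<le> r \<and> r \<le> real n"
    then obtain r where r: "r1 = ereal r" "1 / real n \<le> r" "r \<le> real n" by blast
    define S where "S = (\<Sum>i<j. \<bar>\<theta>0 i\<bar>)"
    have S: "0 \<le> S" "S \<le> r" using l1 r by (auto simp: S_def intro: sum_nonneg)
    define s where "s = real n powr - (H1 + 2)"
    have "real n powr - (H1 + 2) \<le> real n powr 0" using n H by (intro powr_mono) auto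
    then have s: "0 \<le> s" "s \<le> 1" using n by (auto simp: s_def)
    have "s * S \<le> s * real n powr 1" using S r s n0 by (intro mult_left_mono) auto
    also have "\<dots> = real n powr - (H1 + 1)"
      unfolding s_def by (subst powr_add[symmetric]) (simp add: algebra_simps)
    finally have 1: "s * S + real j * \<delta> \<le> real n powr - H1" using half j\<delta>' by simp
    have "real j * \<delta> \<le> real n powr - (H1 + 2) * real n powr - 1"
      using j\<delta> by (subst powr_add[symmetric]) (simp add: algebra_simps)
    also have "\<dots> = s * (1 / real n)" using n0 by (simp add: s_def powr_minus_divide)
    also have "\<dots> \<le> s * r" using r s by (intro mult_left_mono) auto
    finally have "real j * \<delta> \<le> s * r" .
    moreover have "(1 - s) * S \<le> (1 - s) * r" using s S by (intro mult_left_mono) auto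
    ultimately have "(1 - s) * S + real j * \<delta> \<le> r" by (simp add: algebra_simps)
    then show ?thesis using 1 s r by (intro that[of s]) (auto simp: S_def)
  qed
qed

text \<open>
  Every point of the cube satisfies \<open>\<bar>t/\<tau>\<bar> \<le> \<bar>\<theta>0/\<tau>\<bar> + 1\<close> coordinatewise, because half the side of
  the cube is below every scale. The exponents \<open>\<bar>\<theta>0/\<tau>\<bar> powr \<alpha>\<close> have a sum bounded by hypothesis,
  and each coordinate contributes a further factor polynomial in \<open>1/n\<close>, so the mass is \<open>exp
  (-const * j * ln n)\<close>.
\<close>

lemma (in product_prior) coord_law_neighbourhood_mass:
  fixes \<theta>0 :: "nat \<Rightarrow> real" and C :: real
  assumes n: "3 \<le> n" and jn: "j \<le> n" and H: "0 < H1" "0 < H2"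
    and l1: "ereal (\<Sum>i<j. \<bar>\<theta>0 i\<bar>) \<le> r1"
    and r1: "r1 = \<infinity> \<or> (\<exists>r. r1 = ereal r \<and> 1 / real n \<le> r \<and> r \<le> real n)"
    and G: "0 < G1" "0 < G2" "0 < \<alpha>" "\<And>t. G1 * exp (- G2 * \<bar>t\<bar> powr \<alpha>) \<le> g t"
    and \<tau>: "0 < \<tau>0" "\<And>i. \<tau> i \<le> \<tau>0" "\<And>i. i < j \<Longrightarrow> real n powr - H2 \<le> \<tau> i"
    and C: "(\<Sum>i<j. \<bar>\<theta>0 i\<bar> powr \<alpha> / \<tau> i powr \<alpha>) \<le> C * real j * ln (real n)"
  shows "\<exists>B\<in>sets (leb j). (\<forall>u\<in>B. first_coords j u \<in> A_nbhd \<theta>0 n j H1) \<and>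
    ennreal (exp (- ((\<bar>ln (2 * G1 / \<tau>0)\<bar> + (H1 + H2 + 4) + G2 * 2 powr \<alpha> * (1 + \<bar>C\<bar>)) * (real j * ln (real n)))))
      \<le> emeasure (coord_law j) B"
proof -
  define \<delta> where "\<delta> = real n powr - (H1 + H2 + 4)"
  have n2: "2 \<le> n" using n by simp
  obtain s where s: "0 \<le> s" "s \<le> 1" "s * (\<Sum>i<j. \<bar>\<theta>0 i\<bar>) + real j * \<delta> \<le> real n powr - H1"
    "ereal ((1 - s) * (\<Sum>i<j. \<bar>\<theta>0 i\<bar>) + real j * \<delta>) \<le> r1"
    using shrunk_center[OF n2 jn H l1 r1] unfolding \<delta>_def by blast
  have \<delta>: "0 < \<delta>" using n by (simp add: \<delta>_def)
  have ln1: "1 \<le> ln (real n)"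
    using n exp_le by (subst ln_ge_iff) auto
  define c where "c i = (1 - s) * \<theta>0 i" for i
  define lo where "lo i = G1 * exp (- (G2 * (2 powr \<alpha> * (\<bar>\<theta>0 i\<bar> powr \<alpha> / \<tau> i powr \<alpha> + 1)))) / \<tau>0" for i
  let ?B = "PiE {..<j} (\<lambda>i. {c i - \<delta>..c i + \<delta>})"
  have lo: "lo i \<le> g (t / \<tau> i) / \<tau> i" if "i < j" "\<bar>t - c i\<bar> \<le> \<delta>" for i t
  proof -
    have pos: "0 < \<tau> i" by (rule scale_pos)
    have "\<delta> \<le> real n powr - H2" unfolding \<delta>_def using n H by (intro powr_mono) auto
    then have "\<delta> \<le> \<tau> i" using \<tau>(3)[OF that(1)] by simp
    have "\<bar>c i\<bar> \<le> 1 * \<bar>\<theta>0 i\<bar>" unfolding c_def abs_mult using s by (intro mult_right_mono) auto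
    then have "\<bar>t\<bar> \<le> \<bar>\<theta>0 i\<bar> + \<tau> i" using that(2) \<open>\<delta> \<le> \<tau> i\<close> by linarith
    then have "\<bar>t\<bar> / \<tau> i \<le> (\<bar>\<theta>0 i\<bar> + \<tau> i) / \<tau> i" using pos by (intro divide_right_mono) auto
    then have "\<bar>t / \<tau> i\<bar> \<le> \<bar>\<theta>0 i\<bar> / \<tau> i + 1" using pos by (simp add: abs_divide add_divide_distrib)
    then have "\<bar>t / \<tau> i\<bar> powr \<alpha> \<le> (\<bar>\<theta>0 i\<bar> / \<tau> i + 1) powr \<alpha>" using G by (intro powr_mono2) auto
    also have "\<dots> \<le> 2 powr \<alpha> * ((\<bar>\<theta>0 i\<bar> / \<tau> i) powr \<alpha> + 1)" by (rule powr_plus_1_le) (use pos G in auto)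
    also have "(\<bar>\<theta>0 i\<bar> / \<tau> i) powr \<alpha> = \<bar>\<theta>0 i\<bar> powr \<alpha> / \<tau> i powr \<alpha>" using pos by (simp add: powr_divide)
    finally have "G2 * \<bar>t / \<tau> i\<bar> powr \<alpha> \<le> G2 * (2 powr \<alpha> * (\<bar>\<theta>0 i\<bar> powr \<alpha> / \<tau> i powr \<alpha> + 1))"
      using G by (intro mult_left_mono) auto
    then have "G1 * exp (- (G2 * (2 powr \<alpha> * (\<bar>\<theta>0 i\<bar> powr \<alpha> / \<tau> i powr \<alpha> + 1)))) \<le> G1 * exp (- G2 * \<bar>t / \<tau> i\<bar> powr \<alpha>)"
      using G by (intro mult_left_mono) auto
    also have "\<dots> \<le> g (t / \<tau> i)" by (rule G)
    finally show ?thesis unfolding lo_def using pos \<tau>(2)[of i] G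
      by (intro frac_le) (auto intro: g_nonneg)
  qed
  have sum_c: "(\<Sum>i<j. \<bar>c i\<bar>) = (1 - s) * (\<Sum>i<j. \<bar>\<theta>0 i\<bar>)"
    unfolding c_def using s by (simp add: abs_mult sum_distrib_left)
  have "ennreal (\<Prod>i<j. 2 * \<delta> * lo i) \<le> emeasure (coord_law j) ?B"
    by (rule coord_law_box_ge) (use \<delta> lo s G \<tau> sum_c in \<open>auto simp: lo_def\<close>)
  moreover have "exp (- ((\<bar>ln (2 * G1 / \<tau>0)\<bar> + (H1 + H2 + 4) + G2 * 2 powr \<alpha> * (1 + \<bar>C\<bar>)) * (real j * ln (real n))))
      \<le> (\<Prod>i<j. 2 * \<delta> * lo i)"
  proof -
    let ?l = "ln (2 * G1 / \<tau>0)" and ?x = "\<lambda>i. \<bar>\<theta>0 i\<bar> powr \<alpha> / \<tau> i powr \<alpha>"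
    have "2 * \<delta> * lo i = exp (?l - (H1 + H2 + 4) * ln (real n) - G2 * 2 powr \<alpha> * (?x i + 1))" for i
    proof -
      have "exp (?l - (H1 + H2 + 4) * ln (real n) - G2 * 2 powr \<alpha> * (?x i + 1))
        = exp ?l * exp (- (H1 + H2 + 4) * ln (real n)) * exp (- (G2 * (2 powr \<alpha> * (?x i + 1))))"
        by (simp only: exp_add[symmetric]) (simp add: algebra_simps)
      moreover have "exp ?l = 2 * G1 / \<tau>0" using G \<tau> by simp
      moreover have "exp (- (H1 + H2 + 4) * ln (real n)) = \<delta>" using n by (simp add: \<delta>_def powr_def)
      ultimately show ?thesis by (simp add: lo_def)
    qed
    then have prod: "(\<Prod>i<j. 2 * \<delta> * lo i) = exp (\<Sum>i<j. ?l - (H1 + H2 + 4) * ln (real n) - G2 * 2 powr \<alpha> * (?x i + 1))"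
      by (simp add: exp_sum)
    have "- (\<bar>?l\<bar> * (real j * ln (real n))) \<le> real j * ?l"
    proof -
      have "real j * - ?l \<le> real j * (\<bar>?l\<bar> * ln (real n))"
      proof (intro mult_left_mono)
        have "- ?l \<le> \<bar>?l\<bar> * 1" by simp
        also have "\<dots> \<le> \<bar>?l\<bar> * ln (real n)" using ln1 by (intro mult_left_mono) auto
        finally show "- ?l \<le> \<bar>?l\<bar> * ln (real n)" .
      qed simp
      then show ?thesis by (simp add: mult_ac)
    qed
    moreover have "G2 * 2 powr \<alpha> * ((\<Sum>i<j. ?x i) + real j) \<le> G2 * 2 powr \<alpha> * ((1 + \<bar>C\<bar>) * (real j * ln (real n)))"
    proof (intro mult_left_mono)
      have "(\<Sum>i<j. ?x i) \<le> \<bar>C\<bar> * (real j * ln (real n))"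
      proof -
        have "C * (real j * ln (real n)) \<le> \<bar>C\<bar> * (real j * ln (real n))"
          using ln1 by (intro mult_right_mono) auto
        then show ?thesis using C by (simp add: mult_ac)
      qed
      moreover have "real j * 1 \<le> real j * ln (real n)" using ln1 by (intro mult_left_mono) auto
      ultimately show "(\<Sum>i<j. ?x i) + real j \<le> (1 + \<bar>C\<bar>) * (real j * ln (real n))"
        by (simp add: algebra_simps)
    qed (use G in auto)
    moreover have "(\<Sum>i<j. ?l - (H1 + H2 + 4) * ln (real n) - G2 * 2 powr \<alpha> * (?x i + 1))
      = real j * ?l - (H1 + H2 + 4) * (real j * ln (real n)) - G2 * 2 powr \<alpha> * ((\<Sum>i<j. ?x i) + real j)"
      by (simp only: sum_subtractf sum_distrib_left[symmetric] sum.distrib) simp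
    ultimately show ?thesis unfolding prod by (simp only: exp_le_cancel_iff distrib_right mult.assoc)
  qed
  ultimately have mass: "ennreal (exp (- ((\<bar>ln (2 * G1 / \<tau>0)\<bar> + (H1 + H2 + 4) + G2 * 2 powr \<alpha> * (1 + \<bar>C\<bar>)) * (real j * ln (real n)))))
      \<le> emeasure (coord_law j) ?B"
    using ennreal_leI order_trans by blast
  have nbhd: "first_coords j u \<in> A_nbhd \<theta>0 n j H1" if u: "u \<in> ?B" for u
  proof -
    have "\<bar>\<theta>0 i - u i\<bar> \<le> s * \<bar>\<theta>0 i\<bar> + \<delta>" if "i < j" for i
    proof -
      have "u i \<in> {c i - \<delta>..c i + \<delta>}" using u that by (intro PiE_mem[of u "{..<j}"]) auto
      then have "\<bar>c i - u i\<bar> \<le> \<delta>" by auto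
      moreover have "\<theta>0 i - u i = s * \<theta>0 i + (c i - u i)" by (simp add: c_def algebra_simps)
      moreover have "\<bar>s * \<theta>0 i\<bar> = s * \<bar>\<theta>0 i\<bar>" using s by (simp add: abs_mult)
      ultimately show ?thesis by linarith
    qed
    then have "(\<Sum>i<j. \<bar>\<theta>0 i - u i\<bar>) \<le> (\<Sum>i<j. s * \<bar>\<theta>0 i\<bar> + \<delta>)" by (intro sum_mono) auto
    also have "\<dots> = s * (\<Sum>i<j. \<bar>\<theta>0 i\<bar>) + real j * \<delta>" by (simp add: sum.distrib sum_distrib_left)
    also have "\<dots> \<le> real n powr - H1" by (rule s)
    finally have "(\<Sum>i<j. \<bar>first_coords j \<theta>0 i - first_coords j u i\<bar>) \<le> real n powr - H1"
      by (simp add: first_coords_def)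
    then have "norm2 j (\<lambda>i. first_coords j \<theta>0 i - first_coords j u i) \<le> real n powr - H1"
      by (rule order_trans[OF norm2_le_sum])
    then show ?thesis by (simp add: A_nbhd_def sieve_def first_coords_def)
  qed
  have "?B \<in> sets (leb j)" by (intro sets_PiM_I_finite) auto
  then show ?thesis using mass nbhd by blast
qed

text \<open>
  The basic inequality for the sieve prior. The type II term is at most \<open>\<gamma>\<close> for each of three
  parts of the parameter set: dimension above \<open>K\<close>, norm above \<open>R\<close>, and the rest, where the test
  applies. The evidence is bounded below by what the set \<open>S\<close> in dimension \<open>J\<close> contributes.
\<close>

lemma (in product_prior) expected_posterior_le:
  fixes \<mu> :: "'x measure" and p :: "(nat \<Rightarrow> real) \<Rightarrow> 'x \<Rightarrow> real" and q :: "nat pmf"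
  assumes \<theta>0: "\<theta>0 \<in> space T" and \<mu>: "sigma_finite_measure \<mu>"
    and p_meas: "(\<lambda>(\<theta>, x). p \<theta> x) \<in> borel_measurable (T \<Otimes>\<^sub>M \<mu>)"
    and nonneg: "\<And>\<theta> x. \<theta> \<in> space T \<Longrightarrow> x \<in> space \<mu> \<Longrightarrow> 0 \<le> p \<theta> x"
    and prob: "\<And>\<theta>. \<theta> \<in> space T \<Longrightarrow> prob_space (sample_law \<mu> (p \<theta>))"
    and B [measurable]: "B \<in> sets T"
    and \<psi> [measurable]: "\<psi> \<in> borel_measurable \<mu>" "\<And>x. x \<in> space \<mu> \<Longrightarrow> 0 \<le> \<psi> x \<and> \<psi> x \<le> 1"
    and \<gamma>: "0 \<le> \<gamma>" and \<beta>: "0 \<le> \<beta>"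
    and type1: "(\<integral>\<^sup>+x. ennreal (p \<theta>0 x) * ennreal (\<psi> x) \<partial>\<mu>) \<le> ennreal \<gamma>"
    and type2: "\<And>\<theta>. \<theta> \<in> sieve K \<Longrightarrow> norm2 K \<theta> \<le> R \<Longrightarrow> \<theta> \<in> B
      \<Longrightarrow> (\<integral>\<^sup>+x. ennreal (p \<theta> x) * ennreal (1 - \<psi> x) \<partial>\<mu>) \<le> ennreal \<gamma>"
    and dim_tail: "emeasure (measure_pmf q) {k. K < k} \<le> ennreal \<gamma>"
    and norm_tail: "\<And>k. k \<le> K \<Longrightarrow> emeasure (coord_law k) {u \<in> space (leb k). R < norm2 k u} \<le> ennreal \<gamma>"
    and box: "S \<in> sets (leb J)" "0 < w" "ennreal w \<le> emeasure (coord_law J) S"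
    and bad: "\<And>u. u \<in> S \<Longrightarrow>
      (\<integral>\<^sup>+x. ennreal (p \<theta>0 x) * indicator {x. p (first_coords J u) x < p \<theta>0 x * exp (- c)} x \<partial>\<mu>) \<le> ennreal \<beta>"
    and A: "exp (- A) \<le> pmf q J * (exp (- c) * (w / 2))"
  shows "(LINT x|sample_law \<mu> (p \<theta>0). posterior (sieve_prior T q g \<tau> r1) p B x)
    \<le> \<gamma> + 2 * \<beta> + exp A * (3 * \<gamma>)"
proof -
  let ?Q = "sieve_prior T q g \<tau> r1"
  let ?D = "\<lambda>x. \<integral>\<^sup>+\<theta>. ennreal (p \<theta> x) \<partial>?Q"
  interpret \<mu>: sigma_finite_measure \<mu> by fact
  interpret Q: subprob_space ?Q by (rule subprob_sieve_prior)
  have p_\<theta> [measurable]: "p \<theta> \<in> borel_measurable \<mu>" if "\<theta> \<in> space T" for \<theta>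
    using measurable_compose[OF measurable_Pair1'[OF that] p_meas] by simp
  have p_x [measurable]: "(\<lambda>\<theta>. p \<theta> x) \<in> borel_measurable T" if "x \<in> space \<mu>" for x
    using measurable_compose[OF measurable_Pair2'[OF that] p_meas] by simp
  have p_meas' [measurable]: "(\<lambda>z. p (fst z) (snd z)) \<in> borel_measurable (T \<Otimes>\<^sub>M \<mu>)"
    using p_meas by (simp add: case_prod_unfold)
  have p_swap [measurable]: "(\<lambda>z. p (snd z) (fst z)) \<in> borel_measurable (\<mu> \<Otimes>\<^sub>M T)"
    using measurable_compose[OF measurable_pair_swap' p_meas'] by (simp add: case_prod_unfold)
  have Q_pair: "sets (?Q \<Otimes>\<^sub>M \<mu>) = sets (T \<Otimes>\<^sub>M \<mu>)" "sets (\<mu> \<Otimes>\<^sub>M ?Q) = sets (\<mu> \<Otimes>\<^sub>M T)"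
    by (rule sets_pair_measure_cong; simp)+
  have p_meas_Q: "(\<lambda>(\<theta>, x). p \<theta> x) \<in> borel_measurable (?Q \<Otimes>\<^sub>M \<mu>)"
    using p_meas by (simp cong: measurable_cong_sets add: measurable_cong_sets[OF Q_pair(1) refl])
  note p0_meas [measurable] = p_\<theta>[OF \<theta>0]
  have sub: "first_coords k u \<in> space T" if "u \<in> space (leb k)" for k u
    using measurable_space[OF first_coords_measurable that] .
  have p_one: "(\<integral>\<^sup>+x. ennreal (p \<theta> x) \<partial>\<mu>) = 1" if "\<theta> \<in> space T" for \<theta>
    by (rule probability_density_integral[OF p_\<theta>[OF that] prob[OF that]])
  \<comment> \<open>the type II error over the far set, one dimension at a time\<close>
  define E where "E \<theta> = (\<integral>\<^sup>+x. ennreal (p \<theta> x) * ennreal (1 - \<psi> x) \<partial>\<mu>)" for \<theta>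
  have E_meas [measurable]: "E \<in> borel_measurable T" unfolding E_def by measurable
  have E_le_1: "E \<theta> \<le> 1" if "\<theta> \<in> space T" for \<theta>
  proof -
    have "E \<theta> \<le> (\<integral>\<^sup>+x. ennreal (p \<theta> x) \<partial>\<mu>)"
      unfolding E_def
    proof (rule nn_integral_mono)
      fix x assume x: "x \<in> space \<mu>"
      have "ennreal (1 - \<psi> x) \<le> 1" using \<psi>(2)[OF x] by simp
      then show "ennreal (p \<theta> x) * ennreal (1 - \<psi> x) \<le> ennreal (p \<theta> x)"
        using mult_left_mono[of "ennreal (1 - \<psi> x)" 1 "ennreal (p \<theta> x)"] by simp
    qed
    then show ?thesis using p_one[OF that] by simp
  qed
  have numerator: "(\<integral>\<^sup>+\<theta>\<in>B. E \<theta> \<partial>?Q) \<le> 3 * ennreal \<gamma>"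
  proof -
    have inner: "(\<integral>\<^sup>+u. E (first_coords k u) * indicator B (first_coords k u) \<partial>coord_law k)
        \<le> indicator {k. K < k} k + 2 * ennreal \<gamma>" for k
    proof -
      interpret C: subprob_space "coord_law k" by (rule subprob_coord_law)
      show ?thesis
      proof (cases "K < k")
        case True
        have "(\<integral>\<^sup>+u. E (first_coords k u) * indicator B (first_coords k u) \<partial>coord_law k) \<le> (\<integral>\<^sup>+u. 1 \<partial>coord_law k)"
          by (intro nn_integral_mono) (use E_le_1 sub in \<open>auto simp: indicator_def\<close>)
        also have "\<dots> \<le> 1" using C.subprob_emeasure_le_1 by simp
        finally show ?thesis using True by (simp add: add_increasing2)
      next
        case False
        then have k: "k \<le> K" by simp
        let ?T = "{u \<in> space (leb k). R < norm2 k u}"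
        have [measurable]: "?T \<in> sets (leb k)" unfolding norm2_def L2_set_def by measurable
        have norm2_eq: "norm2 K (first_coords k u) = norm2 k u" for u
        proof -
          have "(\<Sum>i<K. (first_coords k u i)\<^sup>2) = (\<Sum>i<k. (u i)\<^sup>2)"
            by (rule sum.mono_neutral_cong_right) (use k in \<open>auto simp: first_coords_def\<close>)
          then show ?thesis by (simp add: norm2_def L2_set_def)
        qed
        have "(\<integral>\<^sup>+u. E (first_coords k u) * indicator B (first_coords k u) \<partial>coord_law k)
          \<le> (\<integral>\<^sup>+u. indicator ?T u + ennreal \<gamma> \<partial>coord_law k)"
        proof (intro nn_integral_mono)
          fix u assume "u \<in> space (coord_law k)"
          then have u: "u \<in> space (leb k)" by simp
          have sv: "first_coords k u \<in> sieve K" using k by (auto simp: first_coords_def sieve_def)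
          show "E (first_coords k u) * indicator B (first_coords k u) \<le> indicator ?T u + ennreal \<gamma>"
          proof (cases "R < norm2 k u \<or> first_coords k u \<notin> B")
            case True
            then show ?thesis using E_le_1[OF sub[OF u]] u by (auto simp: indicator_def intro: add_increasing2)
          next
            case False
            then have "E (first_coords k u) \<le> ennreal \<gamma>"
              unfolding E_def by (intro type2 sv) (auto simp: norm2_eq)
            then show ?thesis by (auto simp: indicator_def intro: add_increasing)
          qed
        qed
        also have "\<dots> = emeasure (coord_law k) ?T + ennreal \<gamma> * emeasure (coord_law k) (space (coord_law k))"
          by (subst nn_integral_add) auto
        also have "\<dots> \<le> ennreal \<gamma> + ennreal \<gamma> * 1"
          by (intro add_mono norm_tail k mult_left_mono C.subprob_emeasure_le_1) simp
        finally show ?thesis using False by (simp add: mult_2)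
      qed
    qed
    have "(\<integral>\<^sup>+\<theta>\<in>B. E \<theta> \<partial>?Q) = (\<integral>\<^sup>+k. (\<integral>\<^sup>+u. E (first_coords k u) * indicator B (first_coords k u) \<partial>coord_law k) \<partial>measure_pmf q)"
      by (rule nn_integral_sieve_prior) measurable
    also have "\<dots> \<le> (\<integral>\<^sup>+k. indicator {k. K < k} k + 2 * ennreal \<gamma> \<partial>measure_pmf q)"
      by (intro nn_integral_mono inner)
    also have "\<dots> = emeasure (measure_pmf q) {k. K < k} + 2 * ennreal \<gamma>"
      by (subst nn_integral_add) auto
    also have "\<dots> \<le> ennreal \<gamma> + 2 * ennreal \<gamma>" by (intro add_mono dim_tail) simp
    also have "\<dots> = 3 * ennreal \<gamma>" using distrib_right[of 1 2 "ennreal \<gamma>"] by simp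
    finally show ?thesis .
  qed
  \<comment> \<open>of the whole mixture, only dimension \<open>J\<close> and the set \<open>S\<close> are kept\<close>
  have evidence: "(\<integral>\<^sup>+x. ennreal (p \<theta>0 x) * indicator {x. ?D x < ennreal (p \<theta>0 x * exp (- A))} x \<partial>\<mu>)
      \<le> 2 * ennreal \<beta>"
  proof -
    interpret C: subprob_space "coord_law J" by (rule subprob_coord_law)
    let ?\<nu> = "restrict_space (coord_law J) S"
    let ?F = "\<lambda>x. \<integral>\<^sup>+u. ennreal (p (first_coords J u) x) \<partial>?\<nu>"
    have S: "S \<subseteq> space (leb J)" "S \<inter> space (coord_law J) \<in> sets (coord_law J)"
      using sets.sets_into_space[OF box(1)] box(1) by (auto simp: Int_absorb2)
    have \<nu>_space: "space ?\<nu> = S" using S by (auto simp: space_restrict_space)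
    have \<nu>_mass: "emeasure ?\<nu> (space ?\<nu>) = emeasure (coord_law J) S"
      unfolding \<nu>_space using S by (intro emeasure_restrict_space) auto
    have fin: "finite_measure ?\<nu>"
      by (rule finite_measureI) (simp add: \<nu>_mass C.emeasure_eq_measure)
    have coords: "first_coords J \<in> ?\<nu> \<rightarrow>\<^sub>M T"
      by (intro measurable_restrict_space1) measurable
    have f_meas: "(\<lambda>(u, x). p (first_coords J u) x) \<in> borel_measurable (?\<nu> \<Otimes>\<^sub>M \<mu>)"
    proof -
      have "(\<lambda>z. (first_coords J (fst z), snd z)) \<in> ?\<nu> \<Otimes>\<^sub>M \<mu> \<rightarrow>\<^sub>M T \<Otimes>\<^sub>M \<mu>"
        by (intro measurable_Pair measurable_compose[OF measurable_fst coords] measurable_snd)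
      from measurable_compose[OF this p_meas'] show ?thesis by (simp add: case_prod_unfold)
    qed
    have ev: "(\<integral>\<^sup>+x. ennreal (p \<theta>0 x)
        * indicator {x. ?F x < ennreal (p \<theta>0 x * (exp (- c) * (w / 2)))} x \<partial>\<mu>)
      \<le> 2 * ennreal \<beta>"
      by (rule evidence_lower_bound[OF fin \<mu> f_meas p0_meas nonneg[OF \<theta>0] box(2)])
        (use box(3) bad in \<open>auto simp: \<nu>_mass[unfolded \<nu>_space] \<nu>_space\<close>)
    have den: "ennreal (pmf q J) * ?F x \<le> ?D x"
      if x: "x \<in> space \<mu>" for x
    proof -
      note [measurable] = p_x[OF x]
      have "?F x = (\<integral>\<^sup>+u. ennreal (p (first_coords J u) x) * indicator S u \<partial>coord_law J)"
        by (rule nn_integral_restrict_space) (rule S)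
      also have "\<dots> \<le> (\<integral>\<^sup>+u. ennreal (p (first_coords J u) x) \<partial>coord_law J)"
        by (intro nn_integral_mono) (auto simp: indicator_def)
      finally have "ennreal (pmf q J) * ?F x
        \<le> (\<integral>\<^sup>+u. ennreal (p (first_coords J u) x) \<partial>coord_law J) * emeasure (measure_pmf q) {J}"
        by (subst mult.commute) (simp add: emeasure_pmf_single mult_right_mono)
      also have "\<dots> = (\<integral>\<^sup>+k. (\<integral>\<^sup>+u. ennreal (p (first_coords J u) x) \<partial>coord_law J) * indicator {J} k \<partial>measure_pmf q)"
        by (rule nn_integral_cmult_indicator[symmetric]) simp
      also have "\<dots> \<le> (\<integral>\<^sup>+k. (\<integral>\<^sup>+u. ennreal (p (first_coords k u) x) \<partial>coord_law k) \<partial>measure_pmf q)"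
        by (intro nn_integral_mono) (auto simp: indicator_def)
      also have "\<dots> = ?D x"
        by (rule nn_integral_sieve_prior[symmetric]) measurable
      finally show ?thesis .
    qed
    have "(\<integral>\<^sup>+x. ennreal (p \<theta>0 x) * indicator {x. ?D x < ennreal (p \<theta>0 x * exp (- A))} x \<partial>\<mu>)
      \<le> (\<integral>\<^sup>+x. ennreal (p \<theta>0 x)
        * indicator {x. ?F x < ennreal (p \<theta>0 x * (exp (- c) * (w / 2)))} x \<partial>\<mu>)"
    proof (intro nn_integral_mono mult_left_mono)
      fix x assume x: "x \<in> space \<mu>"
      have "?F x < ennreal (p \<theta>0 x * (exp (- c) * (w / 2)))"
        if less: "?D x < ennreal (p \<theta>0 x * exp (- A))"
      proof (rule ccontr)
        assume "\<not> ?F x < ennreal (p \<theta>0 x * (exp (- c) * (w / 2)))"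
        then have ge: "ennreal (p \<theta>0 x * (exp (- c) * (w / 2))) \<le> ?F x" by simp
        have "p \<theta>0 x * exp (- A) \<le> p \<theta>0 x * (pmf q J * (exp (- c) * (w / 2)))"
          using A nonneg[OF \<theta>0 x] by (rule mult_left_mono)
        then have "ennreal (p \<theta>0 x * exp (- A)) \<le> ennreal (pmf q J * (p \<theta>0 x * (exp (- c) * (w / 2))))"
          by (intro ennreal_leI) (simp add: mult_ac)
        also have "\<dots> = ennreal (pmf q J) * ennreal (p \<theta>0 x * (exp (- c) * (w / 2)))"
          by (rule ennreal_mult) (use nonneg[OF \<theta>0 x] box(2) in auto)
        also have "\<dots> \<le> ennreal (pmf q J) * ?F x" by (intro mult_left_mono ge) simp
        also have "\<dots> \<le> ?D x" by (rule den[OF x])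
        finally show False using less by simp
      qed
      then show "indicator {x. ?D x < ennreal (p \<theta>0 x * exp (- A))} x
        \<le> (indicator {x. ?F x < ennreal (p \<theta>0 x * (exp (- c) * (w / 2)))} x :: ennreal)"
        by (simp add: indicator_def)
    qed simp
    then show ?thesis using ev by (rule order_trans)
  qed
  have post_meas: "(\<lambda>x. posterior ?Q p B x) \<in> borel_measurable \<mu>"
    unfolding posterior_def by measurable
  have "ennreal (LINT x|sample_law \<mu> (p \<theta>0). posterior ?Q p B x)
      = (\<integral>\<^sup>+x. ennreal (p \<theta>0 x) * ennreal (posterior ?Q p B x) \<partial>\<mu>)"
    by (rule expectation_sample_law[symmetric]) (use p0_meas post_meas prob[OF \<theta>0] posterior_bounds in auto)
  also have "\<dots> \<le> (\<integral>\<^sup>+x. ennreal (p \<theta>0 x) * ennreal (\<psi> x) \<partial>\<mu>)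
      + (\<integral>\<^sup>+x. ennreal (p \<theta>0 x) * indicator {x. ?D x < ennreal (p \<theta>0 x * exp (- A))} x \<partial>\<mu>)
      + ennreal (exp A) * (\<integral>\<^sup>+\<theta>\<in>B. (\<integral>\<^sup>+x. ennreal (p \<theta> x) * ennreal (1 - \<psi> x) \<partial>\<mu>) \<partial>?Q)"
    by (rule posterior_expectation_le[OF Q.finite_measure_axioms \<mu> p_meas_Q p0_meas _ nonneg[OF \<theta>0] \<psi>]) auto
  also have "\<dots> \<le> ennreal \<gamma> + 2 * ennreal \<beta> + ennreal (exp A) * (3 * ennreal \<gamma>)"
    by (intro add_mono mult_left_mono type1 evidence numerator[unfolded E_def]) simp
  also have "\<dots> = ennreal (\<gamma> + 2 * \<beta> + exp A * (3 * \<gamma>))"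
    using \<gamma> \<beta> by (simp add: ennreal_plus ennreal_mult)
  finally show ?thesis using \<gamma> \<beta> by (subst (asm) ennreal_le_iff) auto
qed

section \<open>Rates\<close>

lemma eventually_const_le_nat: "\<forall>\<^sub>F n in sequentially. (B :: real) \<le> real n"
  by real_asymp

text \<open>
  The sequences \<open>j\<^sub>n\<close> and \<open>k\<^sub>n\<close>, with \<open>e n = n\<epsilon>\<^sub>n\<^sup>2\<close> and \<open>y n = j\<^sub>n log n / L(n)\<close>, so that \<open>k\<^sub>n\<close>
  is the integer part of \<open>M\<^sub>0 y n\<close>.
\<close>

locale rates =
  fixes \<epsilon> :: "nat \<Rightarrow> real" and L :: "real \<Rightarrow> real" and j0 :: real
  assumes eps_pos: "\<And>n. n \<ge> 1 \<Longrightarrow> 0 < \<epsilon> n" and eps_lim: "\<epsilon> \<longlonglongrightarrow> 0"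
    and info_lim: "filterlim (\<lambda>n. real n * (\<epsilon> n)\<^sup>2 / ln (real n)) at_top sequentially"
    and j0_pos: "0 < j0"
    and L_sv: "slowly_varying L" and L_le: "\<forall>\<^sub>F x in at_top. L x \<le> ln x"
begin

abbreviation e :: "nat \<Rightarrow> real" where "e n \<equiv> real n * (\<epsilon> n)\<^sup>2"
abbreviation J :: "nat \<Rightarrow> nat" where "J \<equiv> j_seq j0 \<epsilon>"
abbreviation K :: "real \<Rightarrow> nat \<Rightarrow> nat" where "K M0 \<equiv> k_seq j0 M0 \<epsilon> L"
definition y :: "nat \<Rightarrow> real" where "y n = real (J n) * ln (real n) / L (real n)"

lemma ln_ge_1: "\<forall>\<^sub>F n in sequentially. 1 \<le> ln (real n)"
  by real_asymp

lemma ln_le_e: "\<forall>\<^sub>F n in sequentially. B * ln (real n) \<le> e n"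
proof -
  have "\<forall>\<^sub>F n in sequentially. B \<le> e n / ln (real n)"
    using info_lim by (simp add: filterlim_at_top)
  with ln_ge_1 show ?thesis by eventually_elim (simp add: le_divide_eq)
qed

lemma e_ge: "\<forall>\<^sub>F n in sequentially. B \<le> e n"
  using ln_le_e[of "max B 0"] ln_ge_1
proof eventually_elim
  case (elim n)
  have "B \<le> max B 0 * 1" by simp
  also have "\<dots> \<le> max B 0 * ln (real n)" using elim by (intro mult_left_mono) auto
  finally show ?case using elim by simp
qed

lemma e_le: "\<forall>\<^sub>F n in sequentially. e n \<le> real n"
proof -
  have "\<forall>\<^sub>F n in sequentially. \<epsilon> n < 1"
    using eps_lim by (rule order_tendstoD) simp
  with eventually_ge_at_top[of 1] show ?thesis
  proof eventually_elim
    case (elim n)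
    have "(\<epsilon> n)\<^sup>2 \<le> 1" using elim eps_pos[of n] by (intro power_le_one) auto
    then have "e n \<le> real n * 1" by (intro mult_left_mono) auto
    then show ?case by simp
  qed
qed

lemma J_bounds: "\<forall>\<^sub>F n in sequentially. j0 / 2 * e n \<le> real (J n) * ln (real n)
    \<and> real (J n) * ln (real n) \<le> j0 * e n"
  using ln_ge_1 ln_le_e[of "2 / j0"]
proof eventually_elim
  case (elim n)
  define x where "x = j0 * real n * (\<epsilon> n)\<^sup>2 / ln (real n)"
  have x_ln: "x * ln (real n) = j0 * e n" using elim by (simp add: x_def)
  have "2 * ln (real n) \<le> j0 * e n" using elim j0_pos by (simp add: field_simps)
  then have "2 \<le> x" using elim by (simp add: x_def le_divide_eq mult_ac)
  have J: "real (J n) = of_int \<lfloor>x\<rfloor>" unfolding j_seq_def x_def[symmetric] using \<open>2 \<le> x\<close> by simp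
  have "x / 2 \<le> real (J n)" "real (J n) \<le> x" using \<open>2 \<le> x\<close> unfolding J by linarith+
  then have "x / 2 * ln (real n) \<le> real (J n) * ln (real n)" "real (J n) * ln (real n) \<le> x * ln (real n)"
    using elim by (intro mult_right_mono; simp)+
  then show ?case using x_ln by simp
qed

lemma J_le_n: "\<forall>\<^sub>F n in sequentially. J n \<le> n"
proof -
  have "\<forall>\<^sub>F n in sequentially. j0 \<le> ln (real n)" by real_asymp
  with J_bounds ln_ge_1 e_le show ?thesis
  proof eventually_elim
    case (elim n)
    have "real (J n) * ln (real n) \<le> j0 * e n" using elim by simp
    also have "\<dots> \<le> j0 * real n" using elim j0_pos by (intro mult_left_mono) auto
    also have "\<dots> \<le> ln (real n) * real n" using elim by (intro mult_right_mono) auto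
    finally have "real (J n) \<le> real n" using elim by (simp add: mult.commute)
    then show ?case by simp
  qed
qed

lemma J_ge: "\<forall>\<^sub>F n in sequentially. B \<le> real (J n)"
  using J_bounds ln_le_e[of "2 * max B 0 / j0"] ln_ge_1
proof eventually_elim
  case (elim n)
  have "max B 0 * ln (real n) = j0 / 2 * (2 * max B 0 / j0 * ln (real n))" using j0_pos by simp
  also have "\<dots> \<le> j0 / 2 * e n" using elim j0_pos by (intro mult_left_mono) auto
  also have "\<dots> \<le> real (J n) * ln (real n)" using elim by simp
  finally have "max B 0 \<le> real (J n)" using elim by simp
  then show ?case by simp
qed

lemma L_bounds: "\<forall>\<^sub>F n in sequentially. 0 < L (real n) \<and> L (real n) \<le> ln (real n)"
proof -
  obtain X where "\<And>x. x \<ge> X \<Longrightarrow> 0 < L x" using L_sv by (auto simp: slowly_varying_def)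
  then have "\<forall>\<^sub>F x in at_top. 0 < L x"
    by (auto intro: eventually_at_top_linorderI)
  then have "\<forall>\<^sub>F x in at_top. 0 < L x \<and> L x \<le> ln x"
    using L_le by (rule eventually_conj)
  then show ?thesis by (rule eventually_compose_filterlim[OF _ filterlim_real_sequentially])
qed

text \<open>
  A slowly varying function decays more slowly than any power; Potter's bound from a fixed base
  point gives \<open>n powr (-1/2)\<close>, up to a constant. This makes \<open>y n\<close> and \<open>k\<^sub>n\<close> polynomially bounded.
\<close>

lemma L_ge: "\<forall>\<^sub>F n in sequentially. 1 / real n \<le> L (real n)"
proof -
  obtain X c where X: "0 < X" "0 < c"
    and P: "\<forall>x\<ge>X. 0 < L x \<and> (\<forall>z\<ge>x. c * sqrt (x / z) * L x \<le> L z)"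
    using slowly_varying_Potter[OF L_sv] by blast
  define C where "C = c * sqrt X * L X"
  have "C > 0" using X P by (simp add: C_def)
  have "\<forall>\<^sub>F n in sequentially. (1 / C)\<^sup>2 \<le> real n" by (rule eventually_const_le_nat)
  with eventually_const_le_nat[of X] show ?thesis
  proof eventually_elim
    case (elim n)
    have "n > 0" using elim(1) X by (cases n) auto
    have "1 / C \<le> sqrt (real n)" using elim(2) by (rule real_le_rsqrt)
    then have "1 \<le> C * sqrt (real n)" using \<open>C > 0\<close> by (simp add: divide_le_eq mult.commute)
    then have "sqrt (real n) \<le> C * real n"
      using mult_right_mono[of 1 "C * sqrt (real n)" "sqrt (real n)"] by (simp add: mult.assoc)
    then have "1 / real n \<le> C / sqrt (real n)"
      using \<open>n > 0\<close> by (simp add: divide_le_eq le_divide_eq field_simps)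
    also have "\<dots> = c * sqrt (X / real n) * L X" by (simp add: C_def real_sqrt_divide)
    also have "\<dots> \<le> L (real n)" using P elim(1) by blast
    finally show ?case .
  qed
qed

lemma y_bounds: "\<forall>\<^sub>F n in sequentially. real (J n) \<le> y n \<and> y n \<le> j0 * e n * real n \<and> y n \<le> real n ^ 3"
  using J_bounds L_bounds L_ge e_le eventually_const_le_nat[of j0] eventually_ge_at_top[of 1]
proof eventually_elim
  case (elim n)
  have "real (J n) * L (real n) \<le> real (J n) * ln (real n)" using elim by (intro mult_left_mono) auto
  then have 1: "real (J n) \<le> y n" using elim by (simp add: y_def le_divide_eq)
  have "1 \<le> L (real n) * real n" using elim by (simp add: divide_le_eq)
  have "0 \<le> e n" by simp
  have "real (J n) * ln (real n) \<le> j0 * e n" using elim by simp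
  also have "\<dots> = j0 * e n * 1" by simp
  also have "\<dots> \<le> j0 * e n * (L (real n) * real n)"
    using j0_pos \<open>1 \<le> L (real n) * real n\<close> by (intro mult_left_mono) auto
  finally have 2: "y n \<le> j0 * e n * real n" using elim by (simp add: y_def divide_le_eq mult_ac)
  have "j0 * e n \<le> real n * real n" using elim j0_pos by (intro mult_mono) auto
  then have "j0 * e n * real n \<le> real n * real n * real n" by (intro mult_right_mono) auto
  then show ?case using 1 2 by (simp add: power3_eq_cube)
qed

lemma K_bounds:
  assumes M0: "1 \<le> M0"
  shows "\<forall>\<^sub>F n in sequentially. J n \<le> K M0 n \<and> real (K M0 n) \<le> real n ^ 3
    \<and> real (K M0 n) * ln (real n) \<le> M0 * j0 * (e n * ln (real n) / L (real n))
    \<and> (\<forall>k. K M0 n < k \<longrightarrow> M0 * y n \<le> real k)"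
  using y_bounds J_bounds L_bounds ln_ge_1 eventually_const_le_nat[of "M0 * j0"] e_le eventually_ge_at_top[of 1]
proof eventually_elim
  case (elim n)
  have K: "K M0 n = nat \<lfloor>M0 * y n\<rfloor>" by (simp add: k_seq_def y_def mult_ac)
  have "0 \<le> y n" using elim by linarith
  then have nonneg: "0 \<le> M0 * y n" using M0 by simp
  have up: "real (K M0 n) \<le> M0 * y n" unfolding K using nonneg by linarith
  have "1 * real (J n) \<le> M0 * y n" using M0 elim by (intro mult_mono) auto
  then have "J n \<le> K M0 n" unfolding K by (simp add: le_nat_floor)
  moreover have "M0 * y n \<le> real k" if "K M0 n < k" for k
    using that unfolding K by linarith
  moreover have "real (K M0 n) \<le> real n ^ 3"
  proof -
    have "M0 * y n \<le> M0 * (j0 * e n * real n)" using M0 elim by (intro mult_left_mono) auto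
    also have "\<dots> = (M0 * j0) * e n * real n" by (simp add: mult_ac)
    also have "\<dots> \<le> real n * real n * real n" using elim M0 j0_pos by (intro mult_right_mono mult_mono) auto
    finally show ?thesis using up by (simp add: power3_eq_cube)
  qed
  moreover have "real (K M0 n) * ln (real n) \<le> M0 * j0 * (e n * ln (real n) / L (real n))"
  proof -
    have "real (K M0 n) * ln (real n) \<le> M0 * y n * ln (real n)" using up elim by (intro mult_right_mono) auto
    also have "\<dots> = M0 * ((real (J n) * ln (real n)) * (ln (real n) / L (real n)))" by (simp add: y_def)
    also have "\<dots> \<le> M0 * ((j0 * e n) * (ln (real n) / L (real n)))"
      using elim M0 by (intro mult_left_mono mult_right_mono) auto
    finally show ?thesis by (simp add: mult_ac)
  qed
  ultimately show ?case by blast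
qed

text \<open>
  For \<open>k > k\<^sub>n\<close>, hence \<open>k \<ge> M\<^sub>0 y n\<close>, Potter's bound and the comparison \<open>\<kappa>\<close> of \<open>L\<close> at \<open>n\<close> and at
  \<open>y n\<close> give \<open>k L(k) \<ge> c\<kappa> j\<^sub>n log n \<surd>(k / y n)\<close>. The exponent of the tail is thus a multiple of
  \<open>\<surd>M\<^sub>0 e n\<close>, and polynomial factors in \<open>n\<close> are absorbed because \<open>e n\<close> dominates \<open>log n\<close>.
\<close>

lemma prior_dimension_tail:
  assumes \<kappa>: "0 < \<kappa>" "\<forall>\<^sub>F n in sequentially. \<kappa> * L (real n) \<le> L (y n)"
    and b: "0 < b" and A: "0 \<le> A"
  shows "\<exists>M. \<forall>M0\<ge>M. \<forall>\<^sub>F n in sequentially. \<forall>q :: nat pmf.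
    (\<forall>k\<ge>1. pmf q k \<le> exp (- b * real k * L (real k))) \<longrightarrow>
    emeasure (measure_pmf q) {k. K M0 n < k} \<le> ennreal (exp (- A * e n))"
proof -
  obtain X c where X: "0 < X" "0 < c"
    and P: "\<forall>x\<ge>X. 0 < L x \<and> (\<forall>z\<ge>x. c * sqrt (x / z) * L x \<le> L z)"
    using slowly_varying_Potter[OF L_sv] by blast
  \<comment> \<open>the value of \<open>\<surd>M0\<close> at which the exponent of the tail reaches \<open>(A + 1) e n\<close>\<close>
  define s where "s = 4 * (A + 1) / (b * c * \<kappa> * j0)"
  define S where "S = (\<Sum>k. inverse (real k ^ 2))"
  have s: "0 < s" using A b X \<kappa> j0_pos by (simp add: s_def)
  show ?thesis
  proof (intro exI[of _ "max 1 (s\<^sup>2)"] allI impI)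
    fix M0 assume "max 1 (s\<^sup>2) \<le> M0"
    then have M0: "1 \<le> M0" "s \<le> sqrt M0" using s by (auto intro: real_le_rsqrt)
    show "\<forall>\<^sub>F n in sequentially. \<forall>q :: nat pmf.
      (\<forall>k\<ge>1. pmf q k \<le> exp (- b * real k * L (real k))) \<longrightarrow>
      emeasure (measure_pmf q) {k. K M0 n < k} \<le> ennreal (exp (- A * e n))"
      using \<kappa>(2) K_bounds[OF M0(1)] y_bounds J_bounds L_bounds ln_le_e[of 7] J_ge[of X] J_ge[of "1 / (b * c * \<kappa>)"]
        ln_ge_1 eventually_const_le_nat[of "384 * S"] eventually_ge_at_top[of 1]
    proof eventually_elim
      case (elim n)
      show ?case
      proof (intro allI impI)
        fix q :: "nat pmf"
        assume q: "\<forall>k\<ge>1. pmf q k \<le> exp (- b * real k * L (real k))"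
        define \<Lambda> where "\<Lambda> = b * c * \<kappa> * (real (J n) * ln (real n))"
        have yX: "X \<le> y n" "0 < y n" using elim X by linarith+
        have y_L: "y n * L (real n) = real (J n) * ln (real n)" using elim by (simp add: y_def)
        have pmf_le: "pmf q k \<le> exp (- (\<Lambda> * sqrt (real k / y n)))" if k: "K M0 n < k" for k
        proof -
          have "M0 * y n \<le> real k" using elim k by blast
          moreover have "1 * y n \<le> M0 * y n" using M0 yX by (intro mult_right_mono) auto
          ultimately have yk: "y n \<le> real k" by simp
          have "k \<ge> 1" using k by simp
          have "c * sqrt (y n / real k) * (\<kappa> * L (real n)) \<le> c * sqrt (y n / real k) * L (y n)"
            using elim X yX by (intro mult_left_mono) auto
          also have "\<dots> \<le> L (real k)" using P yX yk by blast
          finally have "b * real k * (c * sqrt (y n / real k) * (\<kappa> * L (real n))) \<le> b * real k * L (real k)"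
            using b by (intro mult_left_mono) auto
          moreover have "b * real k * (c * sqrt (y n / real k) * (\<kappa> * L (real n))) = \<Lambda> * sqrt (real k / y n)"
          proof -
            have "sqrt (y n / real k) * real k = sqrt (real k / y n) * y n"
              using yX \<open>k \<ge> 1\<close> by (simp add: real_sqrt_divide real_div_sqrt field_simps)
            then have "b * real k * (c * sqrt (y n / real k) * (\<kappa> * L (real n)))
                = b * c * \<kappa> * (y n * L (real n)) * sqrt (real k / y n)"
              by (simp add: algebra_simps)
            then show ?thesis by (simp add: \<Lambda>_def y_L)
          qed
          ultimately have "exp (- b * real k * L (real k)) \<le> exp (- (\<Lambda> * sqrt (real k / y n)))" by simp
          then show ?thesis using q \<open>k \<ge> 1\<close> by (meson order_trans)
        qed
        have "1 \<le> b * c * \<kappa> * real (J n)" using elim b X \<kappa> by (simp add: divide_le_eq mult_ac)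
        also have "\<dots> \<le> b * c * \<kappa> * real (J n) * ln (real n)"
          using mult_left_mono[of 1 "ln (real n)" "b * c * \<kappa> * real (J n)"] elim b X \<kappa> by simp
        finally have \<Lambda>1: "1 \<le> \<Lambda>" by (simp add: \<Lambda>_def mult_ac)
        have "emeasure (measure_pmf q) {k. K M0 n < k}
          \<le> ennreal (384 * (y n)\<^sup>2 * exp (- (\<Lambda> * sqrt M0 / 2)) * S)"
          unfolding S_def by (rule pmf_tail_le[OF yX(2) \<Lambda>1]) (use M0 elim pmf_le in auto)
        also have "\<dots> \<le> ennreal (exp (- A * e n))"
        proof (rule ennreal_leI)
          have "S \<ge> 0" unfolding S_def by (intro suminf_nonneg inverse_power_summable) auto
          have y2: "(y n)\<^sup>2 \<le> (real n ^ 3)\<^sup>2" using elim yX by (intro power_mono) auto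
          have "384 * (y n)\<^sup>2 * S = (384 * S) * (y n)\<^sup>2" by simp
          also have "\<dots> \<le> real n * (real n ^ 3)\<^sup>2" using elim y2 \<open>S \<ge> 0\<close> by (intro mult_mono) auto
          also have "\<dots> = real n ^ 7" by (simp add: power_numeral_reduce)
          also have "\<dots> = exp (7 * ln (real n))" using elim by (simp add: exp_of_nat_mult[of 7, simplified])
          also have "\<dots> \<le> exp (e n)" using elim by simp
          finally have 1: "384 * (y n)\<^sup>2 * S \<le> exp (e n)" .
          have "b * c * \<kappa> * (j0 / 2 * e n) \<le> \<Lambda>" unfolding \<Lambda>_def using elim b X \<kappa> by (intro mult_left_mono) auto
          then have "b * c * \<kappa> * (j0 / 2 * e n) * s \<le> \<Lambda> * sqrt M0" using M0 s \<Lambda>1 by (intro mult_mono) auto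
          moreover have "b * c * \<kappa> * (j0 / 2 * e n) * s = 2 * ((A + 1) * e n)"
            using b X \<kappa> j0_pos by (simp add: s_def)
          ultimately have "2 * ((A + 1) * e n) \<le> \<Lambda> * sqrt M0" by (simp only:)
          then have "(A + 1) * e n \<le> \<Lambda> * sqrt M0 / 2" by argo
          then have 2: "exp (- (\<Lambda> * sqrt M0 / 2)) \<le> exp (- ((A + 1) * e n))" by simp
          have "384 * (y n)\<^sup>2 * exp (- (\<Lambda> * sqrt M0 / 2)) * S = (384 * (y n)\<^sup>2 * S) * exp (- (\<Lambda> * sqrt M0 / 2))"
            by simp
          also have "\<dots> \<le> exp (e n) * exp (- ((A + 1) * e n))" using 1 2 by (intro mult_mono) auto
          also have "\<dots> = exp (- A * e n)" by (simp add: exp_add[symmetric] algebra_simps)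
          finally show "384 * (y n)\<^sup>2 * exp (- (\<Lambda> * sqrt M0 / 2)) * S \<le> exp (- A * e n)" .
        qed
        finally show "emeasure (measure_pmf q) {k. K M0 n < k} \<le> ennreal (exp (- A * e n))" .
      qed
    qed
  qed
qed

end

context rates begin

text \<open>
  All quantities entering the choice of the mesh are powers of \<open>n\<close>: \<open>k\<^sub>n \<le> n\<^sup>3\<close> and \<open>R \<ge> n powr
  (-1/2)\<close>. A mesh \<open>n powr (-B)\<close> is fine enough for a suitable \<open>B\<close>, and the number of cells is \<open>n
  powr O(k\<^sub>n) = exp (O(e n * ln n / L n))\<close>.
\<close>

lemma mesh_asymptotics:
  fixes D0 D1 D2 \<zeta> Q M0 c1 A :: real
  assumes D: "0 \<le> D0" "0 \<le> D1" "0 < D2" and \<zeta>: "0 < \<zeta>" and Q: "0 < Q" and M0: "1 \<le> M0" and c1: "0 < c1"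
    and A: "0 \<le> A"
  shows "\<exists>M_min\<ge>1. \<forall>M\<ge>M_min. \<forall>\<^sub>F n in sequentially. \<exists>h N R. 0 < h \<and> 0 < R
     \<and> R\<^sup>2 = M * (ln (real n) / L (real n)) * (\<epsilon> n)\<^sup>2
     \<and> D0 * real (K M0 n) powr D1 * (real (K M0 n) * h) powr D2 < \<zeta> * R
     \<and> real n powr Q \<le> real N * h
     \<and> real (2 * N + 1) ^ K M0 n * exp (- c1 * real n * R\<^sup>2) \<le> exp (- A * e n)
     \<and> exp (- c1 * real n * R\<^sup>2) \<le> exp (- A * e n)"
    (is "\<exists>M_min\<ge>1. \<forall>M\<ge>M_min. eventually (?mesh M) sequentially")
proof -
  \<comment> \<open>chosen such that \<open>(n\<^sup>3) powr D1 * (n\<^sup>3 * n powr (-B)) powr D2 = 1/n\<close>\<close>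
  define B where "B = (3 * D1 + 3 * D2 + 1) / D2"
  have B: "0 < B" using D by (simp add: B_def add_nonneg_pos)
  define M_min where "M_min = max 1 (((Q + B + 1) * (M0 * j0) + A) / c1)"
  show ?thesis
  proof (intro exI[of _ M_min] conjI allI impI)
    show "1 \<le> M_min" by (simp add: M_min_def)
    fix M assume "M_min \<le> M"
    then have M: "1 \<le> M" "(Q + B + 1) * (M0 * j0) + A \<le> c1 * M"
      using c1 by (auto simp: M_min_def divide_le_eq mult.commute)
    have small: "\<forall>\<^sub>F n in sequentially. D0 * real n powr - 1 < \<zeta> * real n powr - (1/2)"
      using \<zeta> by real_asymp
    show "eventually (?mesh M) sequentially"
      using small K_bounds[OF M0] L_bounds ln_ge_1 e_ge[of 1] eventually_ge_at_top[of 6]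
    proof eventually_elim
      case (elim n)
      have n: "6 \<le> n" "0 < real n" using elim by auto
      have eps: "0 < \<epsilon> n" using n by (intro eps_pos) auto
      define r where "r = ln (real n) / L (real n)"
      have r: "1 \<le> r" using elim by (simp add: r_def le_divide_eq)
      define h where "h = real n powr - B"
      define N where "N = nat \<lceil>real n powr (Q + B)\<rceil>"
      define R where "R = sqrt (M * r * (\<epsilon> n)\<^sup>2)"
      have R2: "R\<^sup>2 = M * r * (\<epsilon> n)\<^sup>2" using M r by (simp add: R_def)
      have h: "0 < h" using n by (simp add: h_def)
      have Mr: "1 \<le> M * r" using mult_mono[of 1 M 1 r] M r by simp
      have R_pos: "0 < R" using Mr eps by (simp add: R_def)
      have R_ge: "real n powr - (1/2) \<le> R"
      proof -
        have "1 / real n \<le> (\<epsilon> n)\<^sup>2" using elim n by (simp add: divide_le_eq mult.commute)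
        also have "\<dots> \<le> M * r * (\<epsilon> n)\<^sup>2" using mult_right_mono[OF Mr, of "(\<epsilon> n)\<^sup>2"] by simp
        finally have "sqrt (1 / real n) \<le> R" unfolding R_def by (rule real_sqrt_le_mono)
        moreover have "real n powr - (1/2) = 1 / real n powr (1/2)" by (rule powr_minus_divide)
        ultimately show ?thesis using n by (simp add: powr_half_sqrt real_sqrt_divide)
      qed
      have k: "real (K M0 n) \<le> real n powr 3" using elim n by (simp add: powr_numeral)
      have "D0 * real (K M0 n) powr D1 * (real (K M0 n) * h) powr D2
          \<le> D0 * (real n powr 3) powr D1 * (real n powr 3 * h) powr D2"
        using k D h by (intro mult_mono powr_mono2) auto
      also have "real n powr 3 * h = real n powr (3 - B)"
        unfolding h_def by (subst powr_add[symmetric]) simp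
      also have "D0 * (real n powr 3) powr D1 * (real n powr (3 - B)) powr D2 = D0 * real n powr (3 * D1 + (3 - B) * D2)"
        by (simp only: powr_powr powr_add mult.assoc)
      also have "3 * D1 + (3 - B) * D2 = - 1" using D by (simp add: B_def field_simps)
      also have "D0 * real n powr - 1 < \<zeta> * real n powr - (1/2)" using elim by simp
      also have "\<dots> \<le> \<zeta> * R" using R_ge \<zeta> by simp
      finally have 1: "D0 * real (K M0 n) powr D1 * (real (K M0 n) * h) powr D2 < \<zeta> * R" .
      have N_ge: "real n powr (Q + B) \<le> real N" unfolding N_def by linarith
      have 2: "real n powr Q \<le> real N * h"
      proof -
        have "real n powr Q = real n powr (Q + B) * h" by (simp add: h_def powr_add[symmetric])
        also have "\<dots> \<le> real N * h" using N_ge h by (intro mult_right_mono) auto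
        finally show ?thesis .
      qed
      have P1: "1 \<le> real n powr (Q + B)" using n Q B by (simp add: ge_one_powr_ge_zero)
      have "real N \<le> real n powr (Q + B) + 1" unfolding N_def using P1 by linarith
      then have "real (2 * N + 1) \<le> 6 * real n powr (Q + B)" using P1 by simp
      also have "\<dots> \<le> real n * real n powr (Q + B)" using n by (intro mult_right_mono) auto
      also have "\<dots> = real n powr (Q + B + 1)" using n by (simp add: powr_add)
      also have "\<dots> = exp ((Q + B + 1) * ln (real n))" using n by (simp add: powr_def)
      finally have "real (2 * N + 1) ^ K M0 n \<le> exp ((Q + B + 1) * ln (real n)) ^ K M0 n" by (intro power_mono) auto
      also have "\<dots> = exp ((Q + B + 1) * (real (K M0 n) * ln (real n)))"
        by (simp add: exp_of_nat_mult[symmetric] mult_ac)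
      also have "\<dots> \<le> exp ((Q + B + 1) * (M0 * j0 * (e n * ln (real n) / L (real n))))"
        using elim Q B by (simp only: exp_le_cancel_iff, intro mult_left_mono) auto
      also have "\<dots> = exp ((Q + B + 1) * (M0 * j0) * (e n * r))" by (simp add: r_def mult.assoc)
      finally have card: "real (2 * N + 1) ^ K M0 n \<le> exp ((Q + B + 1) * (M0 * j0) * (e n * r))" .
      have er: "e n \<le> e n * r" using mult_left_mono[OF r, of "e n"] elim by simp
      have nR: "- c1 * real n * R\<^sup>2 = - (c1 * M * (e n * r))" by (simp add: R2 mult_ac)
      have key: "((Q + B + 1) * (M0 * j0) + A) * (e n * r) \<le> c1 * M * (e n * r)"
        using M(2) elim r by (intro mult_right_mono) auto
      have AA: "A * e n \<le> A * (e n * r)" using er A by (intro mult_left_mono) auto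
      have nonneg: "0 \<le> (Q + B + 1) * (M0 * j0) * (e n * r)" using Q B M0 j0_pos elim r by auto
      have 3: "real (2 * N + 1) ^ K M0 n * exp (- c1 * real n * R\<^sup>2) \<le> exp (- A * e n)"
      proof -
        have "real (2 * N + 1) ^ K M0 n * exp (- c1 * real n * R\<^sup>2)
           \<le> exp ((Q + B + 1) * (M0 * j0) * (e n * r)) * exp (- (c1 * M * (e n * r)))"
          unfolding nR by (intro mult_right_mono card) auto
        also have "\<dots> = exp ((Q + B + 1) * (M0 * j0) * (e n * r) - c1 * M * (e n * r))"
          by (simp add: exp_add[symmetric])
        also have "\<dots> \<le> exp (- A * e n)" using key AA by (simp add: distrib_right)
        finally show ?thesis .
      qed
      have 4: "exp (- c1 * real n * R\<^sup>2) \<le> exp (- A * e n)"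
        using key AA nonneg unfolding nR by (simp add: distrib_right)
      show ?case using h R_pos R2 1 2 3 4 unfolding r_def by blast
    qed
  qed
qed

end

text \<open>
  With \<open>k \<le> n\<^sup>3\<close>, a norm above \<open>n powr Q\<close> forces a coordinate, in units of its scale, above a
  multiple of \<open>n powr (Q - 3)\<close>, and the choice of \<open>Q\<close> makes its \<open>\<alpha>\<close>-th power at least of order
  \<open>n\<^sup>2\<close>, which dominates \<open>e n \<le> n\<close>. Under truncation such norms are eventually impossible.
\<close>

lemma (in rates) norm_tail:
  fixes G3 G4 \<alpha> \<tau>0 A Q :: real and r1 :: ereal
  assumes G: "0 < G3" "0 < G4" "0 < \<alpha>" "0 < \<tau>0" and A: "0 \<le> A" and Q: "3 + 2 / \<alpha> \<le> Q"
  shows "\<forall>\<^sub>F n in sequentially. \<forall>T g \<tau> k. product_prior T g \<tau> \<longrightarrow> (\<forall>t. g t \<le> G3 * exp (- G4 * \<bar>t\<bar> powr \<alpha>)) \<longrightarrow>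
     (\<forall>j. \<tau> j \<le> \<tau>0) \<longrightarrow> real k \<le> real n ^ 3 \<longrightarrow>
     emeasure (product_prior.coord_law g \<tau> r1 k) {u \<in> space (\<Pi>\<^sub>M j\<in>{..<k}. lborel). real n powr Q < norm2 k u}
       \<le> ennreal (exp (- A * e n))"
proof (cases "r1 = \<infinity>")
  case True
  obtain C where C: "0 \<le> C" "\<And>g t. 0 \<le> t \<Longrightarrow> (\<forall>s. g s \<le> G3 * exp (- G4 * \<bar>s\<bar> powr \<alpha>)) \<Longrightarrow>
    (\<integral>\<^sup>+s. ennreal (g s) * indicator {s. t < \<bar>s\<bar>} s \<partial>lborel) \<le> ennreal (C * exp (- (G4 / 2 * t powr \<alpha>)))"
    using stretched_exponential_tail[OF G(2,3,1)] by blast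
  define D where "D = G4 / 2 / \<tau>0 powr \<alpha>"
  have D: "0 < D" using G by (simp add: D_def)
  define C' A' where "C' = C + 1" and "A' = A + 1"
  have "0 < C'" "0 < A'" using C(1) A by (simp_all add: C'_def A'_def)
  then have "\<forall>\<^sub>F n in sequentially. real n ^ 3 * (C' * exp (- (D * real n ^ 2))) \<le> exp (- (A' * real n))"
    using D by real_asymp
  with e_le eventually_ge_at_top[of 1] show ?thesis
  proof eventually_elim
    case (elim n)
    show ?case
    proof (intro allI impI)
      fix T :: "(nat \<Rightarrow> real) measure" and g :: "real \<Rightarrow> real" and \<tau> :: "nat \<Rightarrow> real" and k :: nat
      assume prior: "product_prior T g \<tau>" and g: "\<forall>t. g t \<le> G3 * exp (- G4 * \<bar>t\<bar> powr \<alpha>)"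
        and \<tau>: "\<forall>j. \<tau> j \<le> \<tau>0" and k: "real k \<le> real n ^ 3"
      interpret product_prior T g \<tau> r1 by fact
      define t where "t = real n powr (Q - 3) / \<tau>0"
      have t: "0 \<le> t" using G by (simp add: t_def)
      have "real k * (\<tau>0 * t) \<le> real n powr 3 * real n powr (Q - 3)"
        using k elim G by (auto simp: t_def powr_numeral intro!: mult_right_mono)
      also have "\<dots> = real n powr Q" by (subst powr_add[symmetric]) simp
      finally have kt: "real k * (\<tau>0 * t) \<le> real n powr Q" .
      have D_t: "D * real n ^ 2 \<le> G4 / 2 * t powr \<alpha>"
      proof -
        have "2 \<le> (Q - 3) * \<alpha>" using Q G by (simp add: field_simps)
        then have "real n powr 2 \<le> real n powr ((Q - 3) * \<alpha>)" using elim by (intro powr_mono) auto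
        then have "real n ^ 2 / \<tau>0 powr \<alpha> \<le> t powr \<alpha>"
          using elim G by (simp add: t_def powr_divide powr_powr divide_right_mono powr_numeral)
        then have "G4 / 2 * (real n ^ 2 / \<tau>0 powr \<alpha>) \<le> G4 / 2 * t powr \<alpha>" using G by (intro mult_left_mono) auto
        then show ?thesis by (simp add: D_def)
      qed
      have "emeasure (coord_law k) {u \<in> space (leb k). real n powr Q < norm2 k u}
        \<le> of_nat k * (\<integral>\<^sup>+s. ennreal (g s) * indicator {s. t < \<bar>s\<bar>} s \<partial>lborel)"
        by (rule coord_law_norm_tail_untruncated[OF True _ t kt]) (use \<tau> in auto)
      also have "\<dots> \<le> of_nat k * ennreal (C * exp (- (G4 / 2 * t powr \<alpha>)))"
        by (intro mult_left_mono C(2) t g) simp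
      also have "\<dots> = ennreal (real k * (C * exp (- (G4 / 2 * t powr \<alpha>))))"
        using C(1) by (simp add: ennreal_of_nat_eq_real_of_nat ennreal_mult)
      also have "\<dots> \<le> ennreal (exp (- A * e n))"
      proof (rule ennreal_leI)
        have "real k * (C * exp (- (G4 / 2 * t powr \<alpha>))) \<le> real n ^ 3 * (C' * exp (- (D * real n ^ 2)))"
          using k D_t C(1) unfolding C'_def by (intro mult_mono) auto
        also have "\<dots> \<le> exp (- (A' * real n))" using elim by simp
        also have "\<dots> \<le> exp (- A * real n)" by (simp add: A'_def distrib_right)
        also have "\<dots> \<le> exp (- A * e n)" using elim A mult_left_mono[of "e n" "real n" A] by simp
        finally show "real k * (C * exp (- (G4 / 2 * t powr \<alpha>))) \<le> exp (- A * e n)" .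
      qed
      finally show "emeasure (coord_law k) {u \<in> space (leb k). real n powr Q < norm2 k u} \<le> ennreal (exp (- A * e n))" .
    qed
  qed
next
  case False
  have "\<forall>\<^sub>F n in sequentially. r1 \<le> ereal (real n)"
    using False eventually_const_le_nat[of "real_of_ereal r1"] by (cases r1) auto
  with eventually_ge_at_top[of 1] show ?thesis
  proof eventually_elim
    case (elim n)
    have "real n powr 1 \<le> real n powr Q"
    proof (rule powr_mono)
      have "0 < 2 / \<alpha>" using G by simp
      then show "1 \<le> Q" using Q by linarith
    qed (use elim in auto)
    then have "r1 \<le> ereal (real n powr Q)" using elim by (simp add: order_trans[OF elim(2)])
    then show ?case by (auto simp: product_prior.coord_law_norm_tail_truncated)
  qed
qed

section \<open>Posterior contraction\<close>

locale sieve_posterior = rates \<epsilon> L j0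
  for \<epsilon> :: "nat \<Rightarrow> real" and L :: "real \<Rightarrow> real" and j0 :: real +
  fixes T :: "(nat \<Rightarrow> real) measure"
    and \<mu> :: "nat \<Rightarrow> 'x measure"
    and p :: "nat \<Rightarrow> (nat \<Rightarrow> real) \<Rightarrow> 'x \<Rightarrow> real"
    and d :: "nat \<Rightarrow> (nat \<Rightarrow> real) \<Rightarrow> (nat \<Rightarrow> real) \<Rightarrow> real"
    and \<theta>0 :: "nat \<Rightarrow> real"
    and \<pi> :: "nat \<Rightarrow> nat pmf"
    and g :: "nat \<Rightarrow> real \<Rightarrow> real"
    and \<tau> :: "nat \<Rightarrow> nat \<Rightarrow> real"
    and r1 :: ereal
    and m :: real
  assumes \<theta>0: "\<theta>0 \<in> space T"
    and sieve_sub: "\<And>k. sieve k \<subseteq> space T"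
    and prior: "\<And>n. n \<ge> 1 \<Longrightarrow> product_prior T (g n) (\<tau> n)"
    and \<mu>: "\<And>n. n \<ge> 1 \<Longrightarrow> sigma_finite_measure (\<mu> n)"
    and p_meas: "\<And>n. n \<ge> 1 \<Longrightarrow> (\<lambda>(\<theta>, x). p n \<theta> x) \<in> borel_measurable (T \<Otimes>\<^sub>M \<mu> n)"
    and p_nonneg: "\<And>n \<theta> x. n \<ge> 1 \<Longrightarrow> \<theta> \<in> space T \<Longrightarrow> x \<in> space (\<mu> n) \<Longrightarrow> 0 \<le> p n \<theta> x"
    and p_prob: "\<And>n \<theta>. n \<ge> 1 \<Longrightarrow> \<theta> \<in> space T \<Longrightarrow> prob_space (sample_law (\<mu> n) (p n \<theta>))"
    and d_semi: "\<And>n. n \<ge> 1 \<Longrightarrow> semimetric_on (space T) (d n)"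
    and d_meas: "\<And>n. n \<ge> 1 \<Longrightarrow> (\<lambda>\<theta>. d n \<theta> \<theta>0) \<in> borel_measurable T"
    and r1_pos: "0 < r1" and \<theta>0_l1: "\<And>k. ereal (\<Sum>j<k. \<bar>\<theta>0 j\<bar>) \<le> r1"
    and m: "2 \<le> m"
    and A1: "\<forall>\<^sub>F n in sequentially.
           KL (\<mu> n) (p n \<theta>0) (p n (first_coords (J n) \<theta>0)) \<le> ereal (e n) \<and>
           V (\<mu> n) m (p n \<theta>0) (p n (first_coords (J n) \<theta>0)) \<le> ennreal (e n powr (m / 2))"
    and A2: "\<exists>H1>0. \<forall>\<^sub>F n in sequentially. A_nbhd \<theta>0 n (J n) H1 \<subseteq> B_tilde (\<mu> n) (p n) \<theta>0 (J n) (e n) m"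
begin

lemma p_section_measurable: "n \<ge> 1 \<Longrightarrow> \<theta> \<in> space T \<Longrightarrow> p n \<theta> \<in> borel_measurable (\<mu> n)"
  using measurable_compose[OF measurable_Pair1' p_meas] by simp

lemma p_integral: "n \<ge> 1 \<Longrightarrow> \<theta> \<in> space T \<Longrightarrow> (\<integral>\<^sup>+x. ennreal (p n \<theta> x) \<partial>\<mu> n) = 1"
  by (rule probability_density_integral[OF p_section_measurable p_prob])

lemma first_coords_in_space: "first_coords k u \<in> space T"
  using sieve_sub[of k] by (auto simp: sieve_def first_coords_def)

lemma truncation_radius_bounds:
  "\<forall>\<^sub>F n in sequentially. r1 = \<infinity> \<or> (\<exists>r. r1 = ereal r \<and> 1 / real n \<le> r \<and> r \<le> real n)"
proof (cases r1)
  case (real r)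
  then have "0 < r" using r1_pos by simp
  have "\<forall>\<^sub>F n in sequentially. 1 / r \<le> real n" by (rule eventually_const_le_nat)
  with eventually_const_le_nat[of r] eventually_ge_at_top[of 1] show ?thesis
  proof eventually_elim
    case (elim n)
    then have "1 / real n \<le> r" using \<open>0 < r\<close> by (simp add: field_simps)
    then show ?case using elim real by blast
  qed
qed (use r1_pos in auto)

text \<open>
  The set \<open>S\<close> of coordinate vectors certifies that the evidence is at least \<open>exp (-A e n) p\<^sub>0\<close>,
  except on an event of probability \<open>4 e n powr (-m/2)\<close>: one factor \<open>2\<close> is visible, the other is
  lost in \<open>evidence_lower_bound\<close>.
\<close>

definition evidence_set :: "real \<Rightarrow> nat \<Rightarrow> (nat \<Rightarrow> real) set \<Rightarrow> real \<Rightarrow> bool" where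
  "evidence_set A n S w \<longleftrightarrow> S \<in> sets (\<Pi>\<^sub>M j\<in>{..<J n}. lborel) \<and> 0 < w \<and>
     ennreal w \<le> emeasure (product_prior.coord_law (g n) (\<tau> n) r1 (J n)) S \<and>
     (\<forall>u\<in>S. (\<integral>\<^sup>+x. ennreal (p n \<theta>0 x) * indicator {x. p n (first_coords (J n) u) x < p n \<theta>0 x * exp (- (6 * e n))} x \<partial>\<mu> n)
        \<le> ennreal (2 * e n powr (- m / 2))) \<and>
     exp (- (A * e n)) \<le> pmf (\<pi> n) (J n) * (exp (- (6 * e n)) * (w / 2))"

text \<open>
  Three factors make up the lower bound \<open>exp (-A e n)\<close>: the weight \<open>\<pi>(j\<^sub>n) \<ge> exp (-a j\<^sub>n log n)\<close>,
  where \<open>L \<le> ln\<close> is used at \<open>j\<^sub>n\<close>; the mass of the cube in dimension \<open>j\<^sub>n\<close>; and the loss \<open>exp (-6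
  e n)\<close> of the density on it.
\<close>

lemma neighbourhood_mass:
  assumes pos: "0 < a" "0 < G1" "0 < G2" "0 < \<alpha>" "0 < \<tau>0" "0 < H2"
    and prior_bounds: "\<forall>\<^sub>F n in sequentially.
         (\<forall>k\<ge>1. exp (- a * real k * L (real k)) \<le> pmf (\<pi> n) k) \<and>
         (\<forall>t. G1 * exp (- G2 * \<bar>t\<bar> powr \<alpha>) \<le> g n t) \<and> (\<forall>j. \<tau> n j \<le> \<tau>0) \<and>
         (\<forall>j < J n. real n powr (- H2) \<le> \<tau> n j) \<and>
         (\<Sum>j < J n. \<bar>\<theta>0 j\<bar> powr \<alpha> / \<tau> n j powr \<alpha>) \<le> C * real (J n) * ln (real n)"
  shows "\<exists>A\<ge>0. \<forall>\<^sub>F n in sequentially. \<exists>S w. evidence_set A n S w"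
proof -
  obtain H1 where H1: "0 < H1" "\<forall>\<^sub>F n in sequentially. A_nbhd \<theta>0 n (J n) H1 \<subseteq> B_tilde (\<mu> n) (p n) \<theta>0 (J n) (e n) m"
    using A2 by blast
  define C1 where "C1 = \<bar>ln (2 * G1 / \<tau>0)\<bar> + (H1 + H2 + 4) + G2 * 2 powr \<alpha> * (1 + \<bar>C\<bar>)"
  have C1: "0 \<le> C1" using pos H1 by (simp add: C1_def)
  \<comment> \<open>\<open>7 = 6 + 1\<close>, where the \<open>1\<close> pays for the factor \<open>1/2\<close> of the evidence bound\<close>
  define A where "A = a * j0 + C1 * j0 + 7"
  have L_J: "\<forall>\<^sub>F n in sequentially. L (real (J n)) \<le> ln (real (J n))"
  proof -
    have "filterlim (\<lambda>n. real (J n)) at_top sequentially"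
      unfolding filterlim_at_top using J_ge by blast
    from eventually_compose_filterlim[OF L_le this] show ?thesis .
  qed
  show ?thesis
  proof (intro exI[of _ A] conjI)
    show "0 \<le> A" using pos C1 j0_pos by (simp add: A_def)
    show "\<forall>\<^sub>F n in sequentially. \<exists>S w. evidence_set A n S w"
      using prior_bounds H1(2) A1 L_J J_le_n J_bounds J_ge[of 1] e_ge[of 1] truncation_radius_bounds
        eventually_ge_at_top[of 3]
    proof eventually_elim
      case (elim n)
      have n: "1 \<le> n" "3 \<le> n" using elim by auto
      interpret product_prior T "g n" "\<tau> n" r1 by (rule prior[OF n(1)])
      define w where "w = exp (- (C1 * (real (J n) * ln (real n))))"
      obtain S where S: "S \<in> sets (leb (J n))" "\<forall>u\<in>S. first_coords (J n) u \<in> A_nbhd \<theta>0 n (J n) H1"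
          "ennreal w \<le> emeasure (coord_law (J n)) S"
        using coord_law_neighbourhood_mass[of n "J n" H1 H2 \<theta>0 G1 G2 \<alpha> \<tau>0 C]
          elim(1,5,9) n(2) pos H1(1) \<theta>0_l1[of "J n"] unfolding w_def C1_def by blast
      have bad: "(\<integral>\<^sup>+x. ennreal (p n \<theta>0 x) * indicator {x. p n (first_coords (J n) u) x < p n \<theta>0 x * exp (- (6 * e n))} x \<partial>\<mu> n)
        \<le> ennreal (2 * e n powr (- m / 2))" if u: "u \<in> S" for u
      proof -
        have "first_coords (J n) u \<in> B_tilde (\<mu> n) (p n) \<theta>0 (J n) (e n) m" using S(2) u elim(2) by blast
        then have tilde: "KL_tilde (\<mu> n) (p n \<theta>0) (p n (first_coords (J n) \<theta>0)) (p n (first_coords (J n) u)) \<le> ennreal (e n)"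
          "V_tilde (\<mu> n) (p n \<theta>0) m (p n (first_coords (J n) \<theta>0)) (p n (first_coords (J n) u)) \<le> ennreal (e n powr (m / 2))"
          by (auto simp: B_tilde_def)
        show ?thesis
          by (rule density_drop_probability[OF p_section_measurable[OF n(1) \<theta>0]
              p_section_measurable[OF n(1) first_coords_in_space] p_section_measurable[OF n(1) first_coords_in_space]
              p_nonneg[OF n(1) \<theta>0] p_nonneg[OF n(1) first_coords_in_space] p_nonneg[OF n(1) first_coords_in_space]
              p_integral[OF n(1) \<theta>0] m elim(8) _ _ tilde]) (use elim(3) in auto)
      qed
      have "exp (- (A * e n)) \<le> pmf (\<pi> n) (J n) * (exp (- (6 * e n)) * (w / 2))"
      proof -
        have J1: "1 \<le> J n" using elim(7) by simp
        have "ln (real (J n)) \<le> ln (real n)" using J1 elim(5) by (subst ln_le_cancel_iff) auto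
        then have "real (J n) * L (real (J n)) \<le> real (J n) * ln (real n)"
          using elim(4) by (intro mult_left_mono) auto
        also have "\<dots> \<le> j0 * e n" using elim(6) by blast
        finally have "a * (real (J n) * L (real (J n))) \<le> a * (j0 * e n)" using pos by (intro mult_left_mono) auto
        then have "exp (- (a * j0 * e n)) \<le> exp (- a * real (J n) * L (real (J n)))" by (simp add: mult.assoc)
        also have "\<dots> \<le> pmf (\<pi> n) (J n)" using elim(1) J1 by blast
        finally have 1: "exp (- (a * j0 * e n)) \<le> pmf (\<pi> n) (J n)" .
        have "C1 * (real (J n) * ln (real n)) \<le> C1 * (j0 * e n)" using elim(6) C1 by (intro mult_left_mono) auto
        then have 2: "exp (- (C1 * j0 * e n)) \<le> w" by (simp add: w_def mult.assoc)
        have "exp (- e n) \<le> exp (- 1)" using elim(8) by simp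
        also have "\<dots> \<le> 1 / 2" using exp_ge_add_one_self[of 1] by (simp add: exp_minus inverse_eq_divide divide_le_eq)
        finally have "exp (- (C1 * j0 * e n)) * exp (- e n) \<le> w * (1 / 2)" using 2 by (intro mult_mono) (auto simp: w_def)
        then have 3: "exp (- (C1 * j0 * e n)) * exp (- e n) \<le> w / 2" by simp
        have "- (A * e n) = - (a * j0 * e n) + (- (6 * e n) + (- (C1 * j0 * e n) + - e n))"
          by (simp add: A_def algebra_simps)
        then have "exp (- (A * e n)) = exp (- (a * j0 * e n)) * (exp (- (6 * e n)) * (exp (- (C1 * j0 * e n)) * exp (- e n)))"
          by (simp only: exp_add)
        also have "\<dots> \<le> pmf (\<pi> n) (J n) * (exp (- (6 * e n)) * (w / 2))"
          using 1 3 by (intro mult_mono mult_nonneg_nonneg) (auto simp: w_def)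
        finally show ?thesis .
      qed
      then show ?case using S bad by (intro exI[of _ S] exI[of _ w]) (auto simp: evidence_set_def w_def)
    qed
  qed
qed

definition far_set :: "real \<Rightarrow> nat \<Rightarrow> (nat \<Rightarrow> real) set" where
  "far_set M n = {\<theta> \<in> space T. M * (ln (real n) / L (real n)) * (\<epsilon> n)\<^sup>2 \<le> (d n \<theta> \<theta>0)\<^sup>2}"

definition risk :: "real \<Rightarrow> nat \<Rightarrow> real" where
  "risk M n = (LINT x|sample_law (\<mu> n) (p n \<theta>0).
     posterior (sieve_prior T (\<pi> n) (g n) (\<tau> n) r1) (p n) (far_set M n) x)"

lemma risk_nonneg: "0 \<le> risk M n"
  unfolding risk_def by (intro integral_nonneg_AE AE_I2) (simp add: posterior_bounds)

text \<open>
  The exponentially small part is absorbed into the polynomial rate.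
\<close>

lemma risk_rate:
  assumes "\<forall>\<^sub>F n in sequentially. risk M n \<le> 4 * e n powr (- m / 2) + 4 * exp (- e n)"
  shows "risk M \<in> O(\<lambda>n. e n powr (- m / 2)) \<and> risk M \<longlonglongrightarrow> 0"
proof -
  define N where "N = nat \<lceil>m / 2\<rceil>"
  have N: "m / 2 \<le> real N" unfolding N_def by linarith
  define C :: real where "C = 4 + 4 * fact N"
  have bound: "\<forall>\<^sub>F n in sequentially. risk M n \<le> C * e n powr (- m / 2)"
    using assms e_ge[of 1]
  proof eventually_elim
    case (elim n)
    have "exp (- e n) \<le> fact N * e n powr (- (m / 2))" by (rule exp_minus_le_powr) (use elim N in auto)
    then show ?case using elim(1) by (simp add: C_def algebra_simps)
  qed
  have O: "risk M \<in> O(\<lambda>n. e n powr (- m / 2))"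
    by (rule bigoI[where c = C]) (use bound in \<open>eventually_elim, simp add: risk_nonneg\<close>)
  have e_top: "filterlim e at_top sequentially"
    unfolding filterlim_at_top using e_ge by blast
  have "((\<lambda>n. e n powr (- m / 2)) \<longlongrightarrow> 0) sequentially"
    using tendsto_neg_powr[OF _ e_top, of "- m / 2"] m by simp
  then have "(\<lambda>n. C * e n powr (- m / 2)) \<longlonglongrightarrow> 0" using tendsto_mult_right_zero by blast
  from tendsto_sandwich[OF _ bound tendsto_const this] have "risk M \<longlonglongrightarrow> 0"
    by (simp add: risk_nonneg)
  with O show ?thesis by blast
qed

lemma posterior_contraction:
  assumes \<kappa>: "0 < \<kappa>" "\<forall>\<^sub>F n in sequentially. \<kappa> * L (real n) \<le> L (y n)"
    and prior_bounds: "\<forall>\<^sub>F n in sequentially.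
         (\<forall>k\<ge>1. exp (- a * real k * L (real k)) \<le> pmf (\<pi> n) k \<and>
                 pmf (\<pi> n) k \<le> exp (- b * real k * L (real k))) \<and>
         (\<forall>t. G1 * exp (- G2 * \<bar>t\<bar> powr \<alpha>) \<le> g n t \<and>
               g n t \<le> G3 * exp (- G4 * \<bar>t\<bar> powr \<alpha>)) \<and>
         (\<forall>j. \<tau> n j \<le> \<tau>0) \<and>
         (\<forall>j < K M1 n. real n powr (- H2) \<le> \<tau> n j) \<and>
         (\<Sum>j < J n. \<bar>\<theta>0 j\<bar> powr \<alpha> / \<tau> n j powr \<alpha>) \<le> C * real (J n) * ln (real n)"
    and M1: "1 < M1"
    and pos: "0 < a" "0 < b" "0 < G1" "0 < G2" "0 < G3" "0 < G4" "0 < H2" "0 < \<alpha>" "0 < \<tau>0"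
  shows "\<exists>M0_min Q_min. \<forall>M0 Q. M0 > 1 \<longrightarrow> M0 \<ge> M0_min \<longrightarrow> Q > 0 \<longrightarrow> Q \<ge> Q_min \<longrightarrow>
    (\<exists>D0 D1 D2. 0 \<le> D0 \<and> 0 \<le> D1 \<and> 0 < D2 \<and> (\<forall>\<^sub>F n in sequentially.
       \<forall>\<theta> \<in> bounded_sieve n (K M0 n) Q. \<forall>\<theta>' \<in> bounded_sieve n (K M0 n) Q.
         d n \<theta> \<theta>' \<le> D0 * real (K M0 n) powr D1 * norm2 (K M0 n) (\<lambda>j. \<theta> j - \<theta>' j) powr D2)) \<longrightarrow>
    (\<exists>c1 \<zeta>. 0 < c1 \<and> 0 < \<zeta> \<and> \<zeta> < 1 \<and> (\<forall>\<^sub>F n in sequentially.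
       \<forall>\<theta>1 \<in> bounded_sieve n (K M0 n) Q. \<exists>\<phi>. \<phi> \<in> borel_measurable (\<mu> n) \<and>
         (\<forall>x \<in> space (\<mu> n). 0 \<le> \<phi> x \<and> \<phi> x \<le> (1 :: real)) \<and>
         (LINT x|sample_law (\<mu> n) (p n \<theta>0). \<phi> x) \<le> exp (- c1 * real n * (d n \<theta>0 \<theta>1)\<^sup>2) \<and>
         (\<forall>\<theta> \<in> space T. d n \<theta> \<theta>1 < \<zeta> * d n \<theta>0 \<theta>1 \<longrightarrow>
           (LINT x|sample_law (\<mu> n) (p n \<theta>). 1 - \<phi> x) \<le> exp (- c1 * real n * (d n \<theta>0 \<theta>1)\<^sup>2)))) \<longrightarrow>
    (\<exists>M_min. \<forall>M \<ge> M_min. risk M \<in> O(\<lambda>n. e n powr (- m / 2)) \<and> risk M \<longlonglongrightarrow> 0)"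
    (is "\<exists>M0_min Q_min. \<forall>M0 Q. _ \<longrightarrow> _ \<longrightarrow> _ \<longrightarrow> _ \<longrightarrow> (\<exists>D0 D1 D2. _ \<and> _ \<and> _ \<and> ?A3 M0 Q D0 D1 D2) \<longrightarrow>
      (\<exists>c1 \<zeta>. _ \<and> _ \<and> _ \<and> ?A4 M0 Q c1 \<zeta>) \<longrightarrow> _")
proof -
  have lower: "\<forall>\<^sub>F n in sequentially.
         (\<forall>k\<ge>1. exp (- a * real k * L (real k)) \<le> pmf (\<pi> n) k) \<and>
         (\<forall>t. G1 * exp (- G2 * \<bar>t\<bar> powr \<alpha>) \<le> g n t) \<and> (\<forall>j. \<tau> n j \<le> \<tau>0) \<and>
         (\<forall>j < J n. real n powr (- H2) \<le> \<tau> n j) \<and>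
         (\<Sum>j < J n. \<bar>\<theta>0 j\<bar> powr \<alpha> / \<tau> n j powr \<alpha>) \<le> C * real (J n) * ln (real n)"
    using prior_bounds K_bounds[OF less_imp_le[OF M1]]
    by eventually_elim (meson order_less_le_trans)
  obtain A where A: "0 \<le> A" and mass: "\<forall>\<^sub>F n in sequentially. \<exists>S w. evidence_set A n S w"
    using neighbourhood_mass[OF pos(1,3,4,8,9,7) lower] by blast
  have A1: "0 \<le> A + 1" using A by simp
  obtain M0_min where M0_min: "\<And>M0. M0_min \<le> M0 \<Longrightarrow> \<forall>\<^sub>F n in sequentially. \<forall>q :: nat pmf.
    (\<forall>k\<ge>1. pmf q k \<le> exp (- b * real k * L (real k))) \<longrightarrow>
    emeasure (measure_pmf q) {k. K M0 n < k} \<le> ennreal (exp (- (A + 1) * e n))"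
    using prior_dimension_tail[OF \<kappa> pos(2) A1] by blast
  show ?thesis
  proof (rule exI[of _ M0_min], rule exI[of _ "3 + 2 / \<alpha>"], intro allI impI, elim exE conjE)
    fix M0 Q D0 D1 D2 c1 \<zeta> :: real
    assume M0: "1 < M0" "M0_min \<le> M0" and Q: "0 < Q" "3 + 2 / \<alpha> \<le> Q"
      and D: "0 \<le> D0" "0 \<le> D1" "0 < D2" and A3: "?A3 M0 Q D0 D1 D2"
      and c1: "0 < c1" "0 < \<zeta>" "\<zeta> < 1" and A4: "?A4 M0 Q c1 \<zeta>"
    have "1 \<le> M0" using M0 by simp
    obtain M_min where M_min: "\<And>M. M_min \<le> M \<Longrightarrow> \<forall>\<^sub>F n in sequentially. \<exists>h N R. 0 < h \<and> 0 < R
     \<and> R\<^sup>2 = M * (ln (real n) / L (real n)) * (\<epsilon> n)\<^sup>2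
     \<and> D0 * real (K M0 n) powr D1 * (real (K M0 n) * h) powr D2 < \<zeta> * R
     \<and> real n powr Q \<le> real N * h
     \<and> real (2 * N + 1) ^ K M0 n * exp (- c1 * real n * R\<^sup>2) \<le> exp (- (A + 1) * e n)
     \<and> exp (- c1 * real n * R\<^sup>2) \<le> exp (- (A + 1) * e n)"
      using mesh_asymptotics[OF D c1(2) Q(1) \<open>1 \<le> M0\<close> c1(1) A1] by blast
    note tails = norm_tail[OF pos(5,6,8,9) A1 Q(2), of r1]
    show "\<exists>M_min. \<forall>M \<ge> M_min. risk M \<in> O(\<lambda>n. e n powr (- m / 2)) \<and> risk M \<longlonglongrightarrow> 0"
    proof (intro exI[of _ M_min] allI impI risk_rate)
      fix M assume M: "M_min \<le> M"
      show "\<forall>\<^sub>F n in sequentially. risk M n \<le> 4 * e n powr (- m / 2) + 4 * exp (- e n)"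
        using A3 A4 M_min[OF M] mass M0_min[OF M0(2)] tails prior_bounds K_bounds[OF \<open>1 \<le> M0\<close>]
          e_ge[of 1] eventually_ge_at_top[of 1]
      proof eventually_elim
        case (elim n)
        have n: "1 \<le> n" using elim by simp
        interpret product_prior T "g n" "\<tau> n" r1 by (rule prior[OF n])
        define \<gamma> where "\<gamma> = exp (- (A + 1) * e n)"
        obtain h N R where mesh: "0 < h" "0 < R" "R\<^sup>2 = M * (ln (real n) / L (real n)) * (\<epsilon> n)\<^sup>2"
          "D0 * real (K M0 n) powr D1 * (real (K M0 n) * h) powr D2 < \<zeta> * R" "real n powr Q \<le> real N * h"
          "real (2 * N + 1) ^ K M0 n * exp (- c1 * real n * R\<^sup>2) \<le> \<gamma>" "exp (- c1 * real n * R\<^sup>2) \<le> \<gamma>"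
          using elim(3) unfolding \<gamma>_def by blast
        obtain \<psi> where \<psi>: "\<psi> \<in> borel_measurable (\<mu> n)" "\<And>x. x \<in> space (\<mu> n) \<Longrightarrow> 0 \<le> \<psi> x \<and> \<psi> x \<le> (1 :: real)"
          "(\<integral>\<^sup>+x. ennreal (p n \<theta>0 x) * ennreal (\<psi> x) \<partial>\<mu> n) \<le> ennreal (real (2 * N + 1) ^ K M0 n * exp (- c1 * real n * R\<^sup>2))"
          "\<And>\<theta>. \<theta> \<in> bounded_sieve n (K M0 n) Q \<Longrightarrow> R \<le> d n \<theta> \<theta>0
            \<Longrightarrow> (\<integral>\<^sup>+x. ennreal (p n \<theta> x) * ennreal (1 - \<psi> x) \<partial>\<mu> n) \<le> ennreal (exp (- c1 * real n * R\<^sup>2))"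
          by (rule sieve_test[OF d_semi[OF n] \<theta>0 sieve_sub p_section_measurable[OF n] p_prob[OF n]
                D(1,3) elim(1) c1(1,2) elim(2) mesh(2,1,4,5)], assumption, assumption, rule that)
        obtain S w where box: "S \<in> sets (leb (J n))" "0 < w" "ennreal w \<le> emeasure (coord_law (J n)) S"
          "\<And>u. u \<in> S \<Longrightarrow> (\<integral>\<^sup>+x. ennreal (p n \<theta>0 x) * indicator {x. p n (first_coords (J n) u) x < p n \<theta>0 x * exp (- (6 * e n))} x \<partial>\<mu> n)
            \<le> ennreal (2 * e n powr (- m / 2))"
          "exp (- (A * e n)) \<le> pmf (\<pi> n) (J n) * (exp (- (6 * e n)) * (w / 2))"
          using elim(4) unfolding evidence_set_def by blast
        have far_meas: "far_set M n \<in> sets T"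
        proof -
          note [measurable] = d_meas[OF n]
          show ?thesis unfolding far_set_def by measurable
        qed
        have type2: "(\<integral>\<^sup>+x. ennreal (p n \<theta> x) * ennreal (1 - \<psi> x) \<partial>\<mu> n) \<le> ennreal \<gamma>"
          if "\<theta> \<in> sieve (K M0 n)" "norm2 (K M0 n) \<theta> \<le> real n powr Q" "\<theta> \<in> far_set M n" for \<theta>
        proof -
          have "\<theta> \<in> space T" and R: "R\<^sup>2 \<le> (d n \<theta> \<theta>0)\<^sup>2" using that(3) mesh(3) by (auto simp: far_set_def)
          have "0 \<le> d n \<theta> \<theta>0" using d_semi[OF n] \<theta>0 \<open>\<theta> \<in> space T\<close> by (auto simp: semimetric_on_def)
          with R have "R \<le> d n \<theta> \<theta>0" by (rule power2_le_imp_le)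
          then show ?thesis using \<psi>(4)[of \<theta>] that(1,2) mesh(7)
            by (auto simp: bounded_sieve_def intro: order_trans[OF _ ennreal_leI])
        qed
        have norm_le: "emeasure (coord_law k) {u \<in> space (leb k). real n powr Q < norm2 k u} \<le> ennreal \<gamma>"
          if "k \<le> K M0 n" for k
        proof -
          have "real k \<le> real n ^ 3" using that elim(8) by linarith
          then show ?thesis using elim(6,7) product_prior_axioms unfolding \<gamma>_def by blast
        qed
        have dim_le: "emeasure (measure_pmf (\<pi> n)) {k. K M0 n < k} \<le> ennreal \<gamma>"
          using elim(5,7) unfolding \<gamma>_def by blast
        have "risk M n \<le> \<gamma> + 2 * (2 * e n powr (- m / 2)) + exp (A * e n) * (3 * \<gamma>)"
          unfolding risk_def
          by (rule expected_posterior_le[OF \<theta>0 \<mu>[OF n] p_meas[OF n] p_nonneg[OF n] p_prob[OF n] far_meas \<psi>(1,2) _ _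
               order_trans[OF \<psi>(3) ennreal_leI[OF mesh(6)]] type2 dim_le norm_le box(1,2,3,4,5)])
            (auto simp: \<gamma>_def)
        also have "exp (A * e n) * (3 * \<gamma>) = 3 * exp (- e n)"
          by (simp add: \<gamma>_def exp_add[symmetric] algebra_simps)
        also have "\<gamma> \<le> exp (- e n)"
        proof -
          have "0 \<le> A * e n" using A by simp
          then show ?thesis by (simp add: \<gamma>_def algebra_simps)
        qed
        finally show ?case by simp
      qed
    qed
  qed
qed

end

text \<open>
  The hypothesis \<open>W\<close>, which depends on \<open>x\<close> only, may be used to choose the thresholds \<open>a\<close> and \<open>b\<close>
  although it is stated after them: either it holds at some \<open>x0\<close>, whose data determine the
  thresholds, or the implication is void.
\<close>

lemma thresholds_before_constants:
  assumes "\<And>x0. P x0 \<Longrightarrow> W x0 \<Longrightarrow>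
    \<exists>a b. \<forall>x y. P x \<longrightarrow> Q a x \<longrightarrow> R y \<longrightarrow> S b y \<longrightarrow> X x y \<longrightarrow> Y x y \<longrightarrow> Z x y"
  shows "\<exists>a b. \<forall>x y. P x \<longrightarrow> Q a x \<longrightarrow> R y \<longrightarrow> S b y \<longrightarrow> X x y \<longrightarrow> Y x y \<longrightarrow> W x \<longrightarrow> Z x y"
proof (cases "\<exists>x0. P x0 \<and> W x0")
  case True
  then obtain x0 where "P x0" "W x0" by blast
  from assms[OF this] obtain a b
    where "\<forall>x y. P x \<longrightarrow> Q a x \<longrightarrow> R y \<longrightarrow> S b y \<longrightarrow> X x y \<longrightarrow> Y x y \<longrightarrow> Z x y"
    by blast
  then show ?thesis by (intro exI[of _ a] exI[of _ b]) blast
next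
  case False
  then show ?thesis by blast
qed

theorem theorem1:
  fixes T :: "(nat \<Rightarrow> real) measure"
    and \<Theta> :: "(nat \<Rightarrow> real) set"
    and \<mu> :: "nat \<Rightarrow> 'x measure"
    and p :: "nat \<Rightarrow> (nat \<Rightarrow> real) \<Rightarrow> 'x \<Rightarrow> real"
    and d :: "nat \<Rightarrow> (nat \<Rightarrow> real) \<Rightarrow> (nat \<Rightarrow> real) \<Rightarrow> real"
    and \<theta>0 :: "nat \<Rightarrow> real"
    and \<epsilon> :: "nat \<Rightarrow> real"
    and L :: "real \<Rightarrow> real"
    and \<pi> :: "nat \<Rightarrow> nat pmf"
    and g :: "nat \<Rightarrow> real \<Rightarrow> real"
    and \<tau> :: "nat \<Rightarrow> nat \<Rightarrow> real"
    and r1 :: ereal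
    and j0 m :: real
  defines "P \<equiv> \<lambda>n \<theta>. sample_law (\<mu> n) (p n \<theta>)"
    and "prior \<equiv> \<lambda>n. sieve_prior T (\<pi> n) (g n) (\<tau> n) r1"
    and "J \<equiv> j_seq j0 \<epsilon>"
    and "K \<equiv> \<lambda>M0. k_seq j0 M0 \<epsilon> L"
  \<comment> \<open>parameter space and model\<close>
  assumes "space T = \<Theta>" and "\<theta>0 \<in> \<Theta>"
    and "\<And>k. sieve k \<subseteq> \<Theta>"
    and "\<And>k. first_coords k \<in> (\<Pi>\<^sub>M j\<in>{..<k}. lborel) \<rightarrow>\<^sub>M T"
    and "\<And>n. n \<ge> 1 \<Longrightarrow> sigma_finite_measure (\<mu> n)"
    and "\<And>n. n \<ge> 1 \<Longrightarrow> (\<lambda>(\<theta>, x). p n \<theta> x) \<in> borel_measurable (T \<Otimes>\<^sub>M \<mu> n)"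
    and "\<And>n \<theta> x. n \<ge> 1 \<Longrightarrow> \<theta> \<in> \<Theta> \<Longrightarrow> x \<in> space (\<mu> n) \<Longrightarrow> 0 \<le> p n \<theta> x"
    and "\<And>n \<theta>. n \<ge> 1 \<Longrightarrow> \<theta> \<in> \<Theta> \<Longrightarrow> prob_space (P n \<theta>)"
    and "\<And>n. n \<ge> 1 \<Longrightarrow> semimetric_on \<Theta> (d n)"
    and "\<And>n. n \<ge> 1 \<Longrightarrow> (\<lambda>\<theta>. d n \<theta> \<theta>0) \<in> borel_measurable T"
  \<comment> \<open>rates\<close>
    and "\<And>n. n \<ge> 1 \<Longrightarrow> 0 < \<epsilon> n" and "\<epsilon> \<longlonglongrightarrow> 0"
    and "filterlim (\<lambda>n. real n * (\<epsilon> n)\<^sup>2 / ln (real n)) at_top sequentially"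
    and "0 < j0"
    and "slowly_varying L" and "\<forall>\<^sub>F x in at_top. L x \<le> ln x"
    and "\<exists>\<kappa>>0. \<forall>\<^sub>F n in sequentially.
           \<kappa> * L (real n) \<le> L (real (J n) * ln (real n) / L (real n))"
  \<comment> \<open>sieve prior\<close>
    and "\<And>n. n \<ge> 1 \<Longrightarrow> pmf (\<pi> n) 0 = 0"
    and "\<And>n. n \<ge> 1 \<Longrightarrow> g n \<in> borel_measurable borel"
    and "\<And>n t. n \<ge> 1 \<Longrightarrow> 0 \<le> g n t"
    and "\<And>n. n \<ge> 1 \<Longrightarrow> (\<integral>\<^sup>+t. ennreal (g n t) \<partial>lborel) = 1"
    and "\<And>n j. n \<ge> 1 \<Longrightarrow> 0 < \<tau> n j"
    and "0 < r1" and "\<And>k. ereal (\<Sum>j<k. \<bar>\<theta>0 j\<bar>) \<le> r1"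
  \<comment> \<open>(A1)\<close>
    and "2 \<le> m"
    and "\<forall>\<^sub>F n in sequentially.
           KL (\<mu> n) (p n \<theta>0) (p n (first_coords (J n) \<theta>0)) \<le> ereal (real n * (\<epsilon> n)\<^sup>2) \<and>
           V (\<mu> n) m (p n \<theta>0) (p n (first_coords (J n) \<theta>0))
             \<le> ennreal ((real n * (\<epsilon> n)\<^sup>2) powr (m / 2))"
  \<comment> \<open>(A2)\<close>
    and "\<exists>H1>0. \<forall>\<^sub>F n in sequentially.
           A_nbhd \<theta>0 n (J n) H1 \<subseteq> B_tilde (\<mu> n) (p n) \<theta>0 (J n) (real n * (\<epsilon> n)\<^sup>2) m"
  \<comment> \<open>the sieve constants \<open>M0\<close> and \<open>Q\<close> are large enough\<close>
  shows "\<exists>M0_min Q_min. \<forall>M0 Q. M0 > 1 \<longrightarrow> M0 \<ge> M0_min \<longrightarrow> Q > 0 \<longrightarrow> Q \<ge> Q_min \<longrightarrow>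
    \<comment> \<open>(A3)\<close>
    (\<exists>D0 D1 D2. 0 \<le> D0 \<and> 0 \<le> D1 \<and> 0 < D2 \<and> (\<forall>\<^sub>F n in sequentially.
       \<forall>\<theta> \<in> bounded_sieve n (K M0 n) Q. \<forall>\<theta>' \<in> bounded_sieve n (K M0 n) Q.
         d n \<theta> \<theta>' \<le> D0 * real (K M0 n) powr D1 * norm2 (K M0 n) (\<lambda>j. \<theta> j - \<theta>' j) powr D2)) \<longrightarrow>
    \<comment> \<open>(A4)\<close>
    (\<exists>c1 \<zeta>. 0 < c1 \<and> 0 < \<zeta> \<and> \<zeta> < 1 \<and> (\<forall>\<^sub>F n in sequentially.
       \<forall>\<theta>1 \<in> bounded_sieve n (K M0 n) Q. \<exists>\<phi>. \<phi> \<in> borel_measurable (\<mu> n) \<and>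
         (\<forall>x \<in> space (\<mu> n). 0 \<le> \<phi> x \<and> \<phi> x \<le> (1 :: real)) \<and>
         (LINT x|P n \<theta>0. \<phi> x) \<le> exp (- c1 * real n * (d n \<theta>0 \<theta>1)\<^sup>2) \<and>
         (\<forall>\<theta> \<in> \<Theta>. d n \<theta> \<theta>1 < \<zeta> * d n \<theta>0 \<theta>1 \<longrightarrow>
           (LINT x|P n \<theta>. 1 - \<phi> x) \<le> exp (- c1 * real n * (d n \<theta>0 \<theta>1)\<^sup>2)))) \<longrightarrow>
    \<comment> \<open>(A5)\<close>
    (\<exists>a b G1 G2 G3 G4 H2 \<alpha> \<tau>0 C.
       0 < a \<and> 0 < b \<and> 0 < G1 \<and> 0 < G2 \<and> 0 < G3 \<and> 0 < G4 \<and> 0 < H2 \<and> 0 < \<alpha> \<and> 0 < \<tau>0 \<and>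
       (\<forall>\<^sub>F n in sequentially.
         (\<forall>k\<ge>1. exp (- a * real k * L (real k)) \<le> pmf (\<pi> n) k \<and>
                 pmf (\<pi> n) k \<le> exp (- b * real k * L (real k))) \<and>
         (\<forall>t. G1 * exp (- G2 * \<bar>t\<bar> powr \<alpha>) \<le> g n t \<and>
               g n t \<le> G3 * exp (- G4 * \<bar>t\<bar> powr \<alpha>)) \<and>
         (\<forall>j. \<tau> n j \<le> \<tau>0) \<and>
         (\<forall>j < K M0 n. real n powr (- H2) \<le> \<tau> n j) \<and>
         (\<Sum>j < J n. \<bar>\<theta>0 j\<bar> powr \<alpha> / \<tau> n j powr \<alpha>) \<le> C * real (J n) * ln (real n))) \<longrightarrow>
    (\<exists>M_min. \<forall>M \<ge> M_min.
      (\<lambda>n. LINT x|P n \<theta>0. posterior (prior n) (p n)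
             {\<theta> \<in> \<Theta>. M * (ln (real n) / L (real n)) * (\<epsilon> n)\<^sup>2 \<le> (d n \<theta> \<theta>0)\<^sup>2} x)
        \<in> O(\<lambda>n. (real n * (\<epsilon> n)\<^sup>2) powr (- m / 2)) \<and>
      (\<lambda>n. LINT x|P n \<theta>0. posterior (prior n) (p n)
             {\<theta> \<in> \<Theta>. M * (ln (real n) / L (real n)) * (\<epsilon> n)\<^sup>2 \<le> (d n \<theta> \<theta>0)\<^sup>2} x)
        \<longlonglongrightarrow> 0)"
proof -
  have priors: "product_prior T (g n) (\<tau> n)" if "n \<ge> 1" for n
    by (rule product_prior.intro) (fact assms(8), (fact assms(23-26)[OF that])+)
  have model: "sieve_posterior \<epsilon> L j0 T \<mu> p d \<theta>0 g \<tau> r1 m"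
  proof (intro sieve_posterior.intro rates.intro sieve_posterior_axioms.intro)
    show "\<theta>0 \<in> space T" "\<And>k. sieve k \<subseteq> space T" using assms(5-7) by auto
    show "\<And>n \<theta> x. n \<ge> 1 \<Longrightarrow> \<theta> \<in> space T \<Longrightarrow> x \<in> space (\<mu> n) \<Longrightarrow> 0 \<le> p n \<theta> x"
      "\<And>n \<theta>. n \<ge> 1 \<Longrightarrow> \<theta> \<in> space T \<Longrightarrow> prob_space (sample_law (\<mu> n) (p n \<theta>))"
      "\<And>n. n \<ge> 1 \<Longrightarrow> semimetric_on (space T) (d n)"
      using assms(5,11-13) unfolding P_def by auto
  qed (fact assms priors assms(30,31)[unfolded J_def])+
  interpret sieve_posterior \<epsilon> L j0 T \<mu> p d \<theta>0 \<pi> g \<tau> r1 m by (fact model)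
  obtain \<kappa> where \<kappa>: "0 < \<kappa>" "\<forall>\<^sub>F n in sequentially. \<kappa> * L (real n) \<le> L (y n)"
    using assms(21) unfolding y_def J_def by blast
  have risk_eq: "risk M = (\<lambda>n. LINT x|sample_law (\<mu> n) (p n \<theta>0).
     posterior (sieve_prior T (\<pi> n) (g n) (\<tau> n) r1) (p n)
       {\<theta> \<in> space T. M * (ln (real n) / L (real n)) * (\<epsilon> n)\<^sup>2 \<le> (d n \<theta> \<theta>0)\<^sup>2} x)" for M
    by (rule ext) (simp only: risk_def far_set_def)
  show ?thesis
    unfolding P_def prior_def J_def K_def \<open>space T = \<Theta>\<close>[symmetric]
    by (rule thresholds_before_constants, elim exE conjE,
        rule posterior_contraction[OF \<kappa>, unfolded risk_eq], assumption+)
qed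

end
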